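(* Let $T:I\to I$ be a proper one-dimensional Iwasawa continued fraction map with transfer operator $H$, acting on the complex Banach space $BV(I)$. Then the set $G$ of eigenvalues $\lambda$ of $H$ of modulus $1$ is finite, the corresponding eigenspaces $E_\lambda\subset BV(I)$ are finite-dimensional, and there are bounded linear operators $U_\lambda$ ($\lambda\in G$) and $V$ on $BV(I)$ such that for all $n\ge1$ $$H^n=\sum_{\lambda\in G}\lambda^nU_\lambda+V^n,$$ with $U_\lambda^2=U_\lambda$, $U_\lambda U_{\lambda'}=0$ if $\lambda'\ne\lambda$, $U_\lambda V=VU_\lambda=0$, $U_\lambda(BV(I))=E_\lambda$, and $V$ has spectral radius strictly less than $1$.
   Context: Setting: $I=[a,b]$ is a compact nondegenerate interval. A (one-dimensional) Iwasawa continued fraction map is a map $T:I\to I$ for which $I$ admits a countable partition (up to common endpoints, and up to the point $0$ where the value of $T$ is irrelevant) into nondegenerate subintervals such that on each of them $T(x)=\iota(x)+\text{const}$, where $\iota$ is one fixed function among $1/x,\,-1/x,\,|1/x|,\,-|1/x|$; hence $|T'(x)|=1/x^2$. Let $\mathcal H$ be the set of inverse branches of $T$; for $h\in\mathcal H$, $I_h$ is the partition interval which is the range of $h$, and $TI_h$ is the domain of $h$. It is required that $TI_h=I$ for every $h$, except possibly for the leftmost and rightmost partition intervals, for which $TI_h$ must still be an interval sharing an endpoint with $I$. $T$ is proper if $\max\{|a|,|b|\}<1$. Transfer operator: for $f\in L^1(I)$ (complex-valued), $Hf(x)=\sum_{h\in\mathcal H}|h'(x)|\,f(h(x))\,\chi_{TI_h}(x)$.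 $BV(I)\subset L^1(I)$ is the Banach space of (classes of) complex functions of bounded variation, with norm $\|f\|_{BV}=\|f\|_1+\inf_{g=f\text{ a.e.}}\mathrm{var}_I\,g$. *)

theory Defs
  imports "HOL-Analysis.Analysis"
begin

section \<open>Classes of integrable complex functions\<close>

definition l1_rel :: "(real \<Rightarrow> complex) \<Rightarrow> (real \<Rightarrow> complex) \<Rightarrow> bool" where
  "l1_rel f g \<longleftrightarrow> integrable lborel f \<and> integrable lborel g \<and> (AE x in lborel. f x = g x)"

lemma l1_rel_part_equivp: "part_equivp l1_rel"
proof (rule part_equivpI)
  show "\<exists>f. l1_rel f f"
    by (rule exI[of _ "\<lambda>_. 0"]) (simp add: l1_rel_def)
  show "symp l1_rel"
    by (auto simp: symp_def l1_rel_def elim: AE_mp)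
  show "transp l1_rel"
    by (auto simp: transp_def l1_rel_def elim: AE_mp)
qed

quotient_type l1 = "real \<Rightarrow> complex" / partial: l1_rel
  by (rule l1_rel_part_equivp)

instantiation l1 :: ab_group_add
begin

lift_definition zero_l1 :: l1 is "\<lambda>_. 0"
  by (simp add: l1_rel_def)

lift_definition plus_l1 :: "l1 \<Rightarrow> l1 \<Rightarrow> l1" is "\<lambda>f g x. f x + g x"
  by (auto simp: l1_rel_def elim: AE_mp)

lift_definition minus_l1 :: "l1 \<Rightarrow> l1 \<Rightarrow> l1" is "\<lambda>f g x. f x - g x"
  by (auto simp: l1_rel_def elim: AE_mp)

lift_definition uminus_l1 :: "l1 \<Rightarrow> l1" is "\<lambda>f x. - f x"
  by (auto simp: l1_rel_def elim: AE_mp)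

instance
  by standard (transfer; simp add: l1_rel_def add_ac)+

end

lift_definition scale_l1 :: "complex \<Rightarrow> l1 \<Rightarrow> l1" (infixr "*\<^sub>C" 75) is "\<lambda>c f x. c * f x"
  by (auto simp: l1_rel_def elim: AE_mp)

lift_definition norm_l1 :: "l1 \<Rightarrow> real" is "\<lambda>f. LINT x|lborel. norm (f x)"
  by (auto simp: l1_rel_def intro!: integral_cong_AE elim: AE_mp)

interpretation l1: vector_space scale_l1
  by standard (transfer; simp add: l1_rel_def algebra_simps)+

section \<open>The space BV of a compact interval\<close>

definition variation :: "real \<Rightarrow> real \<Rightarrow> (real \<Rightarrow> complex) \<Rightarrow> ennreal" where
  "variation a b g =
     (SUP xs\<in>{xs. sorted xs \<and> set xs \<subseteq> {a..b}}.
        ennreal (\<Sum>i<length xs - 1. norm (g (xs ! Suc i) - g (xs ! i))))"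

(* L^1 of the interval is identified with the classes that vanish almost everywhere off it. *)

definition L1_on :: "real \<Rightarrow> real \<Rightarrow> l1 set" where
  "L1_on a b = {u. AE x in lborel. x \<notin> {a..b} \<longrightarrow> rep_l1 u x = 0}"

definition ess_variation :: "real \<Rightarrow> real \<Rightarrow> l1 \<Rightarrow> ennreal" where
  "ess_variation a b u =
     (INF g\<in>{g. AE x in lborel. x \<in> {a..b} \<longrightarrow> g x = rep_l1 u x}. variation a b g)"

definition BV :: "real \<Rightarrow> real \<Rightarrow> l1 set" where
  "BV a b = {u \<in> L1_on a b. ess_variation a b u < \<infinity>}"

definition norm_BV :: "real \<Rightarrow> real \<Rightarrow> l1 \<Rightarrow> real" where
  "norm_BV a b u = norm_l1 u + enn2real (ess_variation a b u)"

section \<open>Operators on BV\<close>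

(* Operators on BV are maps on the whole type of which only the values on BV matter. *)

definition bounded_operator :: "real \<Rightarrow> real \<Rightarrow> (l1 \<Rightarrow> l1) \<Rightarrow> bool" where
  "bounded_operator a b A \<longleftrightarrow>
     (\<forall>u\<in>BV a b. A u \<in> BV a b) \<and>
     (\<forall>u\<in>BV a b. \<forall>v\<in>BV a b. A (u + v) = A u + A v) \<and>
     (\<forall>c. \<forall>u\<in>BV a b. A (c *\<^sub>C u) = c *\<^sub>C A u) \<and>
     (\<exists>C. \<forall>u\<in>BV a b. norm_BV a b (A u) \<le> C * norm_BV a b u)"

definition spectrum :: "real \<Rightarrow> real \<Rightarrow> (l1 \<Rightarrow> l1) \<Rightarrow> complex set" where
  "spectrum a b A =
     {z. \<not> (\<exists>R. bounded_operator a b R \<and>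
               (\<forall>u\<in>BV a b. R (z *\<^sub>C u - A u) = u \<and> z *\<^sub>C R u - A (R u) = u))}"

definition spectral_radius :: "real \<Rightarrow> real \<Rightarrow> (l1 \<Rightarrow> l1) \<Rightarrow> ennreal" where
  "spectral_radius a b A = (SUP z\<in>spectrum a b A. ennreal (cmod z))"

definition eigenspace :: "real \<Rightarrow> real \<Rightarrow> (l1 \<Rightarrow> l1) \<Rightarrow> complex \<Rightarrow> l1 set" where
  "eigenspace a b A z = {u \<in> BV a b. A u = z *\<^sub>C u}"

definition eigenvalue :: "real \<Rightarrow> real \<Rightarrow> (l1 \<Rightarrow> l1) \<Rightarrow> complex \<Rightarrow> bool" where
  "eigenvalue a b A z \<longleftrightarrow> (\<exists>u \<in> BV a b. u \<noteq> 0 \<and> A u = z *\<^sub>C u)"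

definition peripheral_eigenvalues :: "real \<Rightarrow> real \<Rightarrow> (l1 \<Rightarrow> l1) \<Rightarrow> complex set" where
  "peripheral_eigenvalues a b A = {z. cmod z = 1 \<and> eigenvalue a b A z}"

definition finite_dimensional :: "l1 set \<Rightarrow> bool" where
  "finite_dimensional E \<longleftrightarrow> (\<exists>B. finite B \<and> B \<subseteq> E \<and> l1.span B = E)"

section \<open>Iwasawa continued fraction maps\<close>

(* The inverse branches h are indexed by their ranges J. Since partition intervals may share
   endpoints, at which the value of T can come from either side, a branch is taken on the
   interior of J; its domain is then the open interval with the same endpoints as T I_h.
   This changes the transfer operator only on a countable set. *)

definition branch_dom :: "(real \<Rightarrow> real) \<Rightarrow> real set \<Rightarrow> real set" where
  "branch_dom T J = T ` interior J"

definition inv_branch :: "(real \<Rightarrow> real) \<Rightarrow> real set \<Rightarrow> real \<Rightarrow> real" where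
  "inv_branch T J = inv_into (interior J) T"

definition inversions :: "(real \<Rightarrow> real) set" where
  "inversions = {\<lambda>x. 1 / x, \<lambda>x. - 1 / x, \<lambda>x. \<bar>1 / x\<bar>, \<lambda>x. - \<bar>1 / x\<bar>}"

(* In the fourth conjunct, the premise on K excludes the endpoints common to two intervals. *)

definition iwasawa_partition :: "real \<Rightarrow> real \<Rightarrow> (real \<Rightarrow> real) \<Rightarrow> real set set \<Rightarrow> bool" where
  "iwasawa_partition a b T P \<longleftrightarrow>
     countable P \<and>
     (\<forall>J\<in>P. \<exists>l r. l < r \<and> J = {l..r} \<and> J \<subseteq> {a..b}) \<and>
     (\<forall>J\<in>P. \<forall>K\<in>P. J \<noteq> K \<longrightarrow> interior J \<inter> interior K = {}) \<and>
     (\<exists>\<iota>\<in>inversions. \<forall>J\<in>P. \<exists>c. \<forall>x\<in>J - {0}. (\<forall>K\<in>P. x \<in> K \<longrightarrow> K = J) \<longrightarrow> T x = \<iota> x + c) \<and>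
     {a..b} - {0} \<subseteq> \<Union>P \<and>
     (\<forall>J\<in>P. branch_dom T J = {a<..<b} \<or>
        ((\<forall>K\<in>P. Inf J \<le> Inf K) \<or> (\<forall>K\<in>P. Sup K \<le> Sup J)) \<and>
        (\<exists>u v. u < v \<and> branch_dom T J = {u<..<v} \<and> (u = a \<or> v = b)))"

definition iwasawa_map :: "real \<Rightarrow> real \<Rightarrow> (real \<Rightarrow> real) \<Rightarrow> real set set \<Rightarrow> bool" where
  "iwasawa_map a b T P \<longleftrightarrow>
     a < b \<and> T ` {a..b} \<subseteq> {a..b} \<and> iwasawa_partition a b T P"

definition proper_interval :: "real \<Rightarrow> real \<Rightarrow> bool" where
  "proper_interval a b \<longleftrightarrow> max \<bar>a\<bar> \<bar>b\<bar> < 1"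

definition transfer_fun ::
    "(real \<Rightarrow> real) \<Rightarrow> real set set \<Rightarrow> (real \<Rightarrow> complex) \<Rightarrow> real \<Rightarrow> complex" where
  "transfer_fun T P f x =
     (\<Sum>\<^sub>\<infinity>J\<in>P. of_real \<bar>deriv (inv_branch T J) x\<bar> * f (inv_branch T J x) *
        indicator (branch_dom T J) x)"

(* The class of the result does not depend on the representative, because inverse branches
   pull null sets back to null sets. *)

definition transfer_op :: "(real \<Rightarrow> real) \<Rightarrow> real set set \<Rightarrow> l1 \<Rightarrow> l1" where
  "transfer_op T P u = abs_l1 (transfer_fun T P (rep_l1 u))"

end

(* The transfer operator H satisfies a Lasota-Yorke inequality: some power of H contracts the
   variation up to a multiple of the L^1 norm. A branch range away from 0 is an interval on which
   the variation of x^2 f(x) can be controlled by the variation of f; there are infinitely many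
   branches, but the total weight of those near 0 is small, and only the at most two incomplete
   branches create jumps. Since an interior jump costs a full supremum, the supremum of H^n f is
   estimated separately: cutting the interval into pieces that meet a single branch of T^n each
   (up to branches of small weight) gives a bound of order m^(2n) var f, with m = max |a| |b| < 1.

   The spectral decomposition follows from this inequality and the compactness of the inclusion
   of BV in L^1, without analytic functional calculus. The limit of the L^1 norms of H^n u is a
   seminorm for which H is an isometry. Its null space X_s has finite codimension by a separation
   argument, so some polynomial in H maps BV into X_s; as H is isometric modulo X_s, the polynomial
   may be taken with simple roots, all of modulus one. On X_s the powers of H decay exponentially,
   which makes z - H invertible there for |z| near 1 and turns eigenvectors modulo X_s
   into eigenvectors. *)
theory Submission
  imports Defs "HOL-Computational_Algebra.Fundamental_Theorem_Algebra"
begin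

text \<open>The only contraction is that the weight of a branch is \<open>|h'| = h^2\<close>, at
  most \<open>m^2\<close> with \<open>m < 1\<close>. It cannot simply be iterated: one step adds to
  \<open>m^2\<close> times the variation a multiple of the supremum, this multiple contains twice
  the number of incomplete branches, and the supremum is in turn only bounded by the variation, so
  the resulting factor need not be below 1. Hence the supremum must be shown to decay at the same
  rate as the variation. The number of pieces used for this may grow without control in
  \<open>n\<close>: the bound is expressed by increments of a monotone function, which add up over
  adjacent pieces, so only the coefficient of the L^1 norm sees how many pieces there are. The two
  decays combine to order \<open>n m^(2n)\<close>, where the factor \<open>n\<close> is harmless.
  Polynomials in \<open>H\<close> separate the eigenvalues only modulo the null space of the
  limiting seminorm. Interpolation polynomials at the unimodular roots give the projections there,
  and the resolvent on the null space supplies the exact correction.\<close>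

section \<open>Quasi-compact operators\<close>

text \<open>\<open>N\<close> is the strong and \<open>w\<close> the weak norm. Completeness is put
  as convergence of absolutely summable series, the form taken by the Neumann series of the
  resolvent. \<open>compact_embedding\<close> covers balls by sets of small
  \<open>w\<close>-diameter rather than by balls with centres: later the sets are intersected with a
  subspace and the centres are picked inside it.\<close>

locale quasi_compact = vector_space scale
  for scale :: "complex \<Rightarrow> 'a::ab_group_add \<Rightarrow> 'a" (infixr "\<odot>" 75) +
  fixes X :: "'a set" and N w :: "'a \<Rightarrow> real" and H :: "'a \<Rightarrow> 'a"
  assumes subspace_X: "subspace X"
    and N_add: "x \<in> X \<Longrightarrow> y \<in> X \<Longrightarrow> N (x + y) \<le> N x + N y"
    and N_scale: "x \<in> X \<Longrightarrow> N (c \<odot> x) = cmod c * N x"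
    and w_add: "x \<in> X \<Longrightarrow> y \<in> X \<Longrightarrow> w (x + y) \<le> w x + w y"
    and w_scale: "x \<in> X \<Longrightarrow> w (c \<odot> x) = cmod c * w x"
    and w_nonneg: "x \<in> X \<Longrightarrow> 0 \<le> w x"
    and w_eq_0: "x \<in> X \<Longrightarrow> w x = 0 \<Longrightarrow> x = 0"
    and w_le_N: "x \<in> X \<Longrightarrow> w x \<le> N x"
    and N_complete: "(\<And>n. u n \<in> X) \<Longrightarrow> summable (\<lambda>n. N (u n)) \<Longrightarrow>
      \<exists>s\<in>X. (\<lambda>n. N (s - (\<Sum>k<n. u k))) \<longlonglongrightarrow> 0"
    and compact_embedding: "0 < e \<Longrightarrow>
      \<exists>F. finite F \<and> {x\<in>X. N x \<le> R} \<subseteq> \<Union>F \<and> (\<forall>S\<in>F. \<forall>x\<in>S. \<forall>y\<in>S. w (x - y) < e)"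
    and H_X: "x \<in> X \<Longrightarrow> H x \<in> X"
    and H_add: "x \<in> X \<Longrightarrow> y \<in> X \<Longrightarrow> H (x + y) = H x + H y"
    and H_scale: "x \<in> X \<Longrightarrow> H (c \<odot> x) = c \<odot> H x"
    and w_H: "x \<in> X \<Longrightarrow> w (H x) \<le> w x"
    and H_bound: "\<exists>M. \<forall>x\<in>X. N (H x) \<le> M * N x"
    and Lasota_Yorke: "\<exists>n \<theta> K. 0 < n \<and> \<theta> < 1 \<and> (\<forall>x\<in>X. N ((H ^^ n) x) \<le> \<theta> * N x + K * w x)"
begin

abbreviation Hp :: "nat \<Rightarrow> 'a \<Rightarrow> 'a" where "Hp n \<equiv> H ^^ n"

section \<open>Arithmetic of the two norms and of the iterates\<close>

lemmas X_closed [simp, intro] =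
  subspace_0[OF subspace_X] subspace_add[OF subspace_X] subspace_scale[OF subspace_X]
  subspace_diff[OF subspace_X] subspace_neg[OF subspace_X] subspace_sum[OF subspace_X]

declare H_X [simp, intro]

lemma N_nonneg: "x \<in> X \<Longrightarrow> 0 \<le> N x"
  using w_nonneg w_le_N by force

lemma N_0 [simp]: "N 0 = 0" and w_0 [simp]: "w 0 = 0"
  using N_scale[of 0 0] w_scale[of 0 0] by auto

lemma H_0 [simp]: "H 0 = 0"
  using H_scale[of 0 0] by simp

lemma H_minus: "x \<in> X \<Longrightarrow> H (- x) = - H x"
  using H_scale[of x "-1"] by simp

lemma H_diff: "x \<in> X \<Longrightarrow> y \<in> X \<Longrightarrow> H (x - y) = H x - H y"
  using H_add[of x "- y"] by (simp add: H_minus)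

lemma H_sum: "(\<And>i. i \<in> A \<Longrightarrow> f i \<in> X) \<Longrightarrow> H (sum f A) = (\<Sum>i\<in>A. H (f i))"
  by (induction A rule: infinite_finite_induct) (auto simp: H_add)

lemma N_minus: "x \<in> X \<Longrightarrow> N (- x) = N x"
  using N_scale[of x "-1"] by simp

lemma N_diff: "x \<in> X \<Longrightarrow> y \<in> X \<Longrightarrow> N (x - y) \<le> N x + N y"
  using N_add[of x "- y"] by (simp add: N_minus)

lemma N_sum: "(\<And>i. i \<in> A \<Longrightarrow> f i \<in> X) \<Longrightarrow> N (sum f A) \<le> (\<Sum>i\<in>A. N (f i))"
proof (induction A rule: infinite_finite_induct)
  case (insert i A)
  then show ?case using N_add[of "f i" "sum f A"] by force
qed auto

lemma Hp_X [simp, intro]: "x \<in> X \<Longrightarrow> Hp n x \<in> X"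
  by (induction n) auto

lemma Hp_0 [simp]: "Hp n 0 = 0"
  by (induction n) auto

lemma Hp_add: "x \<in> X \<Longrightarrow> y \<in> X \<Longrightarrow> Hp n (x + y) = Hp n x + Hp n y"
  by (induction n) (auto simp: H_add)

lemma Hp_scale: "x \<in> X \<Longrightarrow> Hp n (c \<odot> x) = c \<odot> Hp n x"
  by (induction n) (auto simp: H_scale)

lemma Hp_diff: "x \<in> X \<Longrightarrow> y \<in> X \<Longrightarrow> Hp n (x - y) = Hp n x - Hp n y"
  by (induction n) (auto simp: H_diff)

lemma Hp_sum: "(\<And>i. i \<in> A \<Longrightarrow> f i \<in> X) \<Longrightarrow> Hp n (sum f A) = (\<Sum>i\<in>A. Hp n (f i))"
  by (induction A rule: infinite_finite_induct) (auto simp: Hp_add)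

lemma Hp_Hp: "Hp m (Hp n x) = Hp (m + n) x"
  by (simp add: funpow_add)

lemma w_Hp: "x \<in> X \<Longrightarrow> w (Hp n x) \<le> w x"
proof (induction n)
  case (Suc n) then show ?case using w_H[of "Hp n x"] by auto
qed auto

text \<open>The coefficient \<open>C\<close> does not depend on \<open>e\<close>: a geometric series
  bounds what all the steps add, so the strong norm of late iterates is governed by the weak norm.
  Remainders modulo the Lasota-Yorke period \<open>n1\<close> cost the factor
  \<open>M ^ n1\<close>.\<close>

lemma N_Hp_small:
  "\<exists>C\<ge>0. \<forall>e>0. \<exists>n0. \<forall>n\<ge>n0. \<forall>x\<in>X. N (Hp n x) \<le> e * N x + C * w x"
  and N_Hp_bounded: "\<exists>A\<ge>0. \<forall>n. \<forall>x\<in>X. N (Hp n x) \<le> A * N x"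
proof -
  obtain n1 \<theta>1 K1 where *: "0 < n1" "\<theta>1 < 1" "\<And>x. x \<in> X \<Longrightarrow> N (Hp n1 x) \<le> \<theta>1 * N x + K1 * w x"
    using Lasota_Yorke by blast
  obtain M1 where M1: "\<And>x. x \<in> X \<Longrightarrow> N (H x) \<le> M1 * N x" using H_bound by blast
  define \<theta> K M where "\<theta> = max 0 \<theta>1" and "K = max 0 K1" and "M = max 1 M1"
  have th: "0 \<le> \<theta>" "\<theta> < 1" "0 \<le> K" "1 \<le> M" using * by (auto simp: \<theta>_def K_def M_def)
  have LY: "N (Hp n1 x) \<le> \<theta> * N x + K * w x" if "x \<in> X" for x
  proof -
    have "\<theta>1 * N x \<le> \<theta> * N x" "K1 * w x \<le> K * w x"
      using N_nonneg[OF that] w_nonneg[OF that] by (auto simp: \<theta>_def K_def intro!: mult_right_mono)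
    then show ?thesis using *(3)[OF that] by linarith
  qed
  have Mb: "N (H x) \<le> M * N x" if "x \<in> X" for x
  proof -
    have "M1 * N x \<le> M * N x"
      using N_nonneg[OF that] by (auto simp: M_def intro!: mult_right_mono)
    then show ?thesis using M1[OF that] by linarith
  qed
  have Mp: "N (Hp r x) \<le> M ^ r * N x" if "x \<in> X" for x r
  proof (induction r)
    case (Suc r)
    have "N (Hp (Suc r) x) \<le> M * N (Hp r x)" using Mb[of "Hp r x"] that by simp
    also have "\<dots> \<le> M * (M ^ r * N x)" using Suc th by (intro mult_left_mono) auto
    finally show ?case by (simp add: mult_ac)
  qed simp
  \<comment> \<open>The fixed point of \<open>t \<mapsto> \<theta> * t + K\<close>, so that the
    bound reproduces itself in the induction.\<close>
  define C where "C = K / (1 - \<theta>)"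
  have C: "0 \<le> C" "\<theta> * C + K = C" using th by (auto simp: C_def field_simps)
  have kn: "N (Hp (n1 * k) x) \<le> \<theta> ^ k * N x + C * w x" if "x \<in> X" for x k
  proof (induction k)
    case 0 then show ?case using C w_nonneg[OF that] by simp
  next
    case (Suc k)
    have "N (Hp (n1 * Suc k) x) = N (Hp n1 (Hp (n1 * k) x))" by (simp add: Hp_Hp)
    also have "\<dots> \<le> \<theta> * N (Hp (n1 * k) x) + K * w (Hp (n1 * k) x)" using LY that by auto
    also have "\<dots> \<le> \<theta> * (\<theta> ^ k * N x + C * w x) + K * w x"
      using Suc th w_Hp[OF that] by (intro add_mono mult_left_mono) auto
    also have "\<dots> = \<theta> ^ Suc k * N x + (\<theta> * C + K) * w x" by (simp add: algebra_simps)
    finally show ?case by (simp add: C)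
  qed
  have main: "N (Hp n x) \<le> \<theta> ^ (n div n1) * M ^ n1 * N x + C * w x" if "x \<in> X" for x n
  proof -
    have "N (Hp n x) = N (Hp (n1 * (n div n1)) (Hp (n mod n1) x))" by (simp add: Hp_Hp)
    also have "\<dots> \<le> \<theta> ^ (n div n1) * N (Hp (n mod n1) x) + C * w (Hp (n mod n1) x)"
      using kn that by auto
    also have "\<dots> \<le> \<theta> ^ (n div n1) * (M ^ n1 * N x) + C * w x"
    proof (intro add_mono mult_left_mono w_Hp that)
      have "M ^ (n mod n1) \<le> M ^ n1" using th *(1) by (intro power_increasing) auto
      then show "N (Hp (n mod n1) x) \<le> M ^ n1 * N x"
        using Mp[OF that, of "n mod n1"] mult_right_mono[OF _ N_nonneg[OF that]] by fastforce
    qed (use th C in auto)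
    finally show ?thesis by (simp add: mult_ac)
  qed
  show "\<exists>A\<ge>0. \<forall>n. \<forall>x\<in>X. N (Hp n x) \<le> A * N x"
  proof (intro exI conjI allI ballI)
    show "0 \<le> M ^ n1 + C" using th C by auto
    fix n x assume x: "x \<in> X"
    have "\<theta> ^ (n div n1) * M ^ n1 * N x \<le> 1 * M ^ n1 * N x"
      using th N_nonneg[OF x] by (intro mult_right_mono) (auto intro!: power_le_one)
    moreover have "C * w x \<le> C * N x" using C w_le_N[OF x] by (auto intro: mult_left_mono)
    ultimately show "N (Hp n x) \<le> (M ^ n1 + C) * N x"
      using main[OF x, of n] by (simp add: algebra_simps)
  qed
  show "\<exists>C\<ge>0. \<forall>e>0. \<exists>n0. \<forall>n\<ge>n0. \<forall>x\<in>X. N (Hp n x) \<le> e * N x + C * w x"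
  proof (rule exI[of _ C], intro conjI allI impI)
    show "0 \<le> C" by fact
    fix e :: real assume "0 < e"
    then have "0 < e / M ^ n1" using th by auto
    then obtain k where k: "\<theta> ^ k < e / M ^ n1"
      using real_arch_pow_inv th by blast
    show "\<exists>n0. \<forall>n\<ge>n0. \<forall>x\<in>X. N (Hp n x) \<le> e * N x + C * w x"
    proof (intro exI allI impI ballI)
      fix n x assume n: "k * n1 \<le> n" and x: "x \<in> X"
      have "k \<le> n div n1" using n *(1) by (simp add: less_eq_div_iff_mult_less_eq)
      then have "\<theta> ^ (n div n1) \<le> \<theta> ^ k" using th by (intro power_decreasing) auto
      then have "\<theta> ^ (n div n1) * M ^ n1 \<le> e" using k th
        by (smt (verit) pos_less_divide_eq mult_right_mono zero_less_power)
      then show "N (Hp n x) \<le> e * N x + C * w x"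
        using main[OF x, of n] mult_right_mono[OF _ N_nonneg[OF x]] by force
    qed
  qed
qed

section \<open>The limiting seminorm and its null space\<close>

definition lim_norm :: "'a \<Rightarrow> real" where "lim_norm x = lim (\<lambda>n. w (Hp n x))"

definition stable :: "'a set" where "stable = {x\<in>X. lim_norm x = 0}"

lemma lim_norm_tendsto: "x \<in> X \<Longrightarrow> (\<lambda>n. w (Hp n x)) \<longlonglongrightarrow> lim_norm x"
proof -
  assume x: "x \<in> X"
  have "decseq (\<lambda>n. w (Hp n x))"
    using x by (auto intro!: decseq_SucI w_H)
  moreover have "bdd_below (range (\<lambda>n. w (Hp n x)))"
    using x by (auto intro!: bdd_belowI[of _ 0] w_nonneg)
  ultimately have "convergent (\<lambda>n. w (Hp n x))"
    by (auto simp: convergent_def dest: LIMSEQ_decseq_INF)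
  then show ?thesis unfolding lim_norm_def convergent_LIMSEQ_iff .
qed

lemma lim_norm_le_w_Hp: "x \<in> X \<Longrightarrow> lim_norm x \<le> w (Hp n x)"
  by (rule decseq_ge[OF _ lim_norm_tendsto]) (auto intro!: decseq_SucI w_H)

lemma lim_norm_nonneg: "x \<in> X \<Longrightarrow> 0 \<le> lim_norm x"
  by (rule LIMSEQ_le_const[OF lim_norm_tendsto]) (auto intro!: w_nonneg)

lemma lim_norm_add: "x \<in> X \<Longrightarrow> y \<in> X \<Longrightarrow> lim_norm (x + y) \<le> lim_norm x + lim_norm y"
  by (rule LIMSEQ_le[OF lim_norm_tendsto tendsto_add[OF lim_norm_tendsto lim_norm_tendsto]])
     (auto simp: Hp_add intro!: w_add)

lemma lim_norm_scale: "x \<in> X \<Longrightarrow> lim_norm (c \<odot> x) = cmod c * lim_norm x"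
  by (rule LIMSEQ_unique[OF lim_norm_tendsto])
     (auto simp: Hp_scale w_scale intro!: tendsto_mult_left lim_norm_tendsto)

text \<open>The sequence of \<open>H x\<close> is that of \<open>x\<close> without its first term.
  This is what forces eigenvalues modulo \<open>stable\<close> to have modulus 1.\<close>

lemma lim_norm_H: "x \<in> X \<Longrightarrow> lim_norm (H x) = lim_norm x"
proof (rule LIMSEQ_unique[OF lim_norm_tendsto])
  assume "x \<in> X"
  then have "(\<lambda>n. w (Hp (Suc n) x)) \<longlonglongrightarrow> lim_norm x" by (intro LIMSEQ_Suc lim_norm_tendsto)
  then show "(\<lambda>n. w (Hp n (H x))) \<longlonglongrightarrow> lim_norm x" by (simp only: funpow_Suc_right o_apply)
qed auto

lemma lim_norm_Hp: "x \<in> X \<Longrightarrow> lim_norm (Hp n x) = lim_norm x"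
  by (induction n) (auto simp: lim_norm_H)

lemma lim_norm_diff: "x \<in> X \<Longrightarrow> y \<in> X \<Longrightarrow> lim_norm (x - y) \<le> lim_norm x + lim_norm y"
  using lim_norm_add[of x "- y"] lim_norm_scale[of y "-1"] by simp

lemma lim_norm_triangle: "x \<in> X \<Longrightarrow> y \<in> X \<Longrightarrow> lim_norm x \<le> lim_norm (x - y) + lim_norm y"
  using lim_norm_add[of "x - y" y] by simp

lemma lim_norm_0 [simp]: "lim_norm 0 = 0"
  using lim_norm_scale[of 0 0] by simp

lemma lim_norm_le_w: "x \<in> X \<Longrightarrow> lim_norm x \<le> w x"
  using lim_norm_le_w_Hp[of x 0] by simp

lemma lim_norm_minus_commute: "x \<in> X \<Longrightarrow> y \<in> X \<Longrightarrow> lim_norm (x - y) = lim_norm (y - x)"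
  using lim_norm_scale[of "x - y" "-1"] by simp

lemma subspace_stable: "subspace stable"
proof (rule subspaceI)
  show "0 \<in> stable" by (simp add: stable_def)
next
  fix x y assume xy: "x \<in> stable" "y \<in> stable"
  then have "x + y \<in> X" "lim_norm (x + y) \<le> 0" using lim_norm_add[of x y] by (simp_all add: stable_def)
  then show "x + y \<in> stable" using lim_norm_nonneg[of "x + y"] unfolding stable_def by simp
next
  fix c x assume "x \<in> stable"
  then show "c \<odot> x \<in> stable" by (simp add: stable_def lim_norm_scale)
qed

lemmas stable_closed [simp, intro] =
  subspace_0[OF subspace_stable] subspace_add[OF subspace_stable] subspace_scale[OF subspace_stable]
  subspace_diff[OF subspace_stable] subspace_neg[OF subspace_stable] subspace_sum[OF subspace_stable]

lemma Hp_stable [simp, intro]: "x \<in> stable \<Longrightarrow> Hp n x \<in> stable"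
  by (simp add: stable_def lim_norm_Hp)

lemma H_stable [simp, intro]: "x \<in> stable \<Longrightarrow> H x \<in> stable"
  by (simp add: stable_def lim_norm_H)

lemma stable_X [simp]: "x \<in> stable \<Longrightarrow> x \<in> X" by (simp add: stable_def)

lemma XsI: "x \<in> X \<Longrightarrow> lim_norm x = 0 \<Longrightarrow> x \<in> stable" unfolding stable_def by simp

lemma lim_norm_stable: "x \<in> stable \<Longrightarrow> lim_norm x = 0" unfolding stable_def by simp

section \<open>Finite codimension of the null space\<close>

text \<open>A late iterate moves all points of the finite set \<open>S\<close> into one strong ball
  whose radius does not depend on \<open>S\<close>, and it keeps them separated for
  \<open>w\<close>, because \<open>lim_norm\<close> is at most \<open>w\<close> after any number of
  steps. The sets of a finite cover of that ball with \<open>w\<close>-diameter below 1/2 then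
  contain at most one point each.\<close>

lemma lim_norm_separated_card:
  "\<exists>M. \<forall>S. finite S \<and> S \<subseteq> X \<and> (\<forall>x\<in>S. lim_norm x \<le> 1) \<and>
      (\<forall>x\<in>S. \<forall>y\<in>S. x \<noteq> y \<longrightarrow> 1/2 \<le> lim_norm (x - y)) \<longrightarrow> card S \<le> M"
proof -
  obtain C where C: "C \<ge> 0"
    "\<And>e. e > 0 \<Longrightarrow> \<exists>n0. \<forall>n\<ge>n0. \<forall>x\<in>X. N (Hp n x) \<le> e * N x + C * w x"
    using N_Hp_small by blast
  obtain F where F: "finite F" "{x\<in>X. N x \<le> 1 + C * 2} \<subseteq> \<Union>F"
      "\<And>S x y. S \<in> F \<Longrightarrow> x \<in> S \<Longrightarrow> y \<in> S \<Longrightarrow> w (x - y) < 1/2"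
    using compact_embedding[of "1/2" "1 + C * 2"] by auto
  have "card S \<le> card F" if S: "finite S" "S \<subseteq> X" "\<forall>x\<in>S. lim_norm x \<le> 1"
      "\<forall>x\<in>S. \<forall>y\<in>S. x \<noteq> y \<longrightarrow> 1/2 \<le> lim_norm (x - y)" for S
  proof -
    have "\<forall>\<^sub>F n in sequentially. N (Hp n x) \<le> 1 + C * 2" if x: "x \<in> S" for x
    proof -
      have xX: "x \<in> X" and px: "lim_norm x < 2" using x S by force+
      obtain m where m: "w (Hp m x) < 2"
        using order_tendstoD(2)[OF lim_norm_tendsto[OF xX] px] eventually_sequentially by auto
      \<comment> \<open>Once the weak norm is below 2, this \<open>e\<close> makes the strong norm
        of \<open>Hp m x\<close> contribute at most 1, whatever its size. The time from which this
        works depends on \<open>x\<close>; a common time exists because \<open>S\<close> is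
        finite.\<close>
      define e where "e = 1 / (1 + N (Hp m x))"
      have pos: "1 + N (Hp m x) > 0" using N_nonneg[of "Hp m x"] xX by auto
      then have e: "e > 0" "e * N (Hp m x) \<le> 1" by (auto simp: e_def field_simps)
      obtain n0 where n0: "\<And>n y. n \<ge> n0 \<Longrightarrow> y \<in> X \<Longrightarrow> N (Hp n y) \<le> e * N y + C * w y"
        using C(2)[OF e(1)] by blast
      have "N (Hp n x) \<le> 1 + C * 2" if "n \<ge> n0 + m" for n
      proof -
        have "N (Hp n x) = N (Hp (n - m) (Hp m x))" using that by (simp add: Hp_Hp)
        also have "\<dots> \<le> e * N (Hp m x) + C * w (Hp m x)" using n0 that xX by auto
        also have "\<dots> \<le> 1 + C * 2" using e m C by (intro add_mono mult_left_mono) auto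
        finally show ?thesis .
      qed
      then show ?thesis by (auto simp: eventually_sequentially)
    qed
    then have "\<forall>\<^sub>F n in sequentially. \<forall>x\<in>S. N (Hp n x) \<le> 1 + C * 2"
      using S(1) by (simp add: eventually_ball_finite_distrib)
    then obtain n where n: "\<And>x. x \<in> S \<Longrightarrow> N (Hp n x) \<le> 1 + C * 2"
      by (auto simp: eventually_sequentially)
    have "\<exists>D. D \<in> F \<and> Hp n x \<in> D" if "x \<in> S" for x
      using F(2) n[OF that] S(2) that by blast
    then obtain D where D: "\<And>x. x \<in> S \<Longrightarrow> D x \<in> F \<and> Hp n x \<in> D x" by metis
    have "inj_on D S"
    proof (rule inj_onI, rule ccontr)
      fix x y assume xy: "x \<in> S" "y \<in> S" "D x = D y" "x \<noteq> y"
      then have "w (Hp n x - Hp n y) < 1/2" using D F(3) by metis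
      moreover have "lim_norm (x - y) \<le> w (Hp n x - Hp n y)"
        using lim_norm_le_w_Hp[of "x - y" n] xy S by (auto simp: Hp_diff subset_iff)
      ultimately show False using S(4) xy by force
    qed
    then show ?thesis using F(1) D by (intro card_inj_on_le) auto
  qed
  then show ?thesis by blast
qed

text \<open>A separated set of greatest cardinality is a net, since a point at distance at least 1/2
  from all of its elements could be added.\<close>

lemma lim_norm_ball_net: "\<exists>Z. finite Z \<and> Z \<subseteq> X \<and> (\<forall>x\<in>X. lim_norm x \<le> 1 \<longrightarrow> (\<exists>z\<in>Z. lim_norm (x - z) < 1/2))"
proof -
  define Q where "Q S \<longleftrightarrow> finite S \<and> S \<subseteq> X \<and> (\<forall>x\<in>S. lim_norm x \<le> 1) \<and>
      (\<forall>x\<in>S. \<forall>y\<in>S. x \<noteq> y \<longrightarrow> 1/2 \<le> lim_norm (x - y))" for S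
  obtain M where M: "\<And>S. Q S \<Longrightarrow> card S \<le> M" using lim_norm_separated_card unfolding Q_def by blast
  have "Q {}" by (simp add: Q_def)
  then obtain Z where Z: "Q Z" "\<And>S. Q S \<Longrightarrow> card S \<le> card Z"
    using ex_has_greatest_nat[of Q "{}" card "Suc M"] M by (auto simp: less_Suc_eq_le)
  have net: "\<exists>z\<in>Z. lim_norm (x - z) < 1/2" if x: "x \<in> X" "lim_norm x \<le> 1" for x
  proof (rule ccontr)
    assume n: "\<not> ?thesis"
    then have "x \<notin> Z" using lim_norm_0 by force
    moreover have "Q (insert x Z)"
      using Z(1) x n unfolding Q_def
      by (auto simp: not_less lim_norm_minus_commute[OF _ x(1)] subset_iff)
    ultimately show False using Z(2)[of "insert x Z"] Z(1) by (auto simp: Q_def)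
  qed
  have "finite Z" "Z \<subseteq> X" using Z(1) by (simp_all add: Q_def)
  with net show ?thesis by (intro exI[of _ Z]) simp
qed

text \<open>Magnifying the error of an approximation back to the unit ball and applying the net
  again halves the error; the scaled net points stay in the span.\<close>

lemma lim_norm_dense_span:
  "\<exists>Z. finite Z \<and> Z \<subseteq> X \<and> (\<forall>x\<in>X. \<forall>e>0. \<exists>z\<in>span Z. lim_norm (x - z) < e)"
proof -
  obtain Z where Z: "finite Z" "Z \<subseteq> X" "\<And>x. x \<in> X \<Longrightarrow> lim_norm x \<le> 1 \<Longrightarrow> \<exists>z\<in>Z. lim_norm (x - z) < 1/2"
    using lim_norm_ball_net by blast
  have sZ: "span Z \<subseteq> X" using Z(2) subspace_X by (rule span_minimal)
  have step: "\<exists>z\<in>span Z. lim_norm (x - z) \<le> (1/2)^n" if "x \<in> X" "lim_norm x \<le> 1" for x n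
  proof (induction n)
    case 0 show ?case using that by (intro bexI[of _ 0]) (auto simp: span_zero)
  next
    case (Suc n)
    then obtain z where z: "z \<in> span Z" "lim_norm (x - z) \<le> (1/2)^n" by blast
    let ?y = "of_real (2^n) \<odot> (x - z)"
    have zX: "z \<in> X" "x - z \<in> X" "?y \<in> X" using z sZ that by auto
    have "lim_norm ?y = 2^n * lim_norm (x - z)" using lim_norm_scale[OF zX(2)] by (simp only: norm_of_real) simp
    also have "\<dots> \<le> 2^n * (1/2)^n" using z by (intro mult_left_mono) auto
    finally have "lim_norm ?y \<le> 1" by (simp add: power_divide)
    then obtain y where y: "y \<in> Z" "lim_norm (?y - y) < 1/2" using Z(3) zX by blast
    let ?c = "of_real ((1/2)^n) :: complex"
    have c: "?c * of_real (2^n) = 1" unfolding of_real_mult[symmetric] by (simp add: power_divide)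
    have yX: "?y - y \<in> X" using y Z zX by auto
    have "x - (z + ?c \<odot> y) = ?c \<odot> (?y - y)"
      unfolding scale_right_diff_distrib[of ?c ?y y] scale_scale c by simp
    then have "lim_norm (x - (z + ?c \<odot> y)) = (1/2)^n * lim_norm (?y - y)"
      using lim_norm_scale[OF yX] by (simp only: norm_of_real) simp
    also have "\<dots> \<le> (1/2)^n * (1/2)" using y by (intro mult_left_mono) auto
    finally show ?case using z(1) y(1)
      by (intro bexI[of _ "z + ?c \<odot> y"]) (auto intro!: span_add span_scale intro: span_base)
  qed
  have "\<exists>z\<in>span Z. lim_norm (x - z) < e" if x: "x \<in> X" and e: "0 < e" for x e
  proof -
    define r where "r = 1 + lim_norm x"
    have r: "r > 0" "lim_norm x \<le> r" using lim_norm_nonneg[OF x] by (auto simp: r_def)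
    let ?y = "of_real (1/r) \<odot> x"
    have y: "?y \<in> X" "lim_norm ?y \<le> 1" using x r by (auto simp: lim_norm_scale norm_divide)
    obtain n where n: "(1/2)^n < e / r" using real_arch_pow_inv[of "e/r" "1/2"] e r by auto
    obtain z where z: "z \<in> span Z" "lim_norm (?y - z) \<le> (1/2)^n" using step[OF y] by blast
    have "x - of_real r \<odot> z = of_real r \<odot> (?y - z)"
      using r by (simp add: scale_right_diff_distrib flip: of_real_mult)
    moreover have "?y - z \<in> X" using y z sZ by auto
    ultimately have "lim_norm (x - of_real r \<odot> z) = r * lim_norm (?y - z)" using r by (simp add: lim_norm_scale)
    also have "\<dots> \<le> r * (1/2)^n" using z r by (intro mult_left_mono) auto
    also have "\<dots> < e" using n r by (simp add: pos_less_divide_eq mult.commute)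
    finally show ?thesis using z by (intro bexI[of _ "of_real r \<odot> z"]) (auto intro: span_scale)
  qed
  then show ?thesis using Z by blast
qed

text \<open>Finite-dimensional subspaces are closed, also for a seminorm. When a generator
  \<open>a\<close> is added, either it is at distance 0 from the old span and can be replaced by an
  element of it, or its distance is positive and the coefficients of \<open>a\<close> in
  approximations of \<open>x\<close> form a Cauchy sequence.\<close>

lemma span_lim_norm_closed:
  assumes "finite Z" "Z \<subseteq> X" "x \<in> X" "\<And>e. 0 < e \<Longrightarrow> \<exists>z\<in>span Z. lim_norm (x - z) < e"
  shows "\<exists>z\<in>span Z. lim_norm (x - z) = 0"
  using assms
proof (induction Z arbitrary: x rule: finite_induct)
  case empty
  have "lim_norm x \<le> 0"
  proof (rule field_le_epsilon)
    fix e :: real assume "0 < e"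
    then show "lim_norm x \<le> 0 + e" using empty(3)[of e] by auto
  qed
  then show ?case using lim_norm_nonneg[of x] empty by auto
next
  case (insert a Z)
  have sub: "span Z \<subseteq> X" using insert by (intro span_minimal subspace_X) auto
  have a: "a \<in> X" and ZX: "Z \<subseteq> X" and x: "x \<in> X" using insert.prems by simp_all
  show ?case
  proof (cases "\<forall>e>0. \<exists>z\<in>span Z. lim_norm (a - z) < e")
    case True
    then obtain y where y: "y \<in> span Z" "lim_norm (a - y) = 0" using insert.IH[OF ZX a] by blast
    have "\<exists>z\<in>span Z. lim_norm (x - z) < e" if "0 < e" for e
    proof -
      obtain z where z: "z \<in> span (insert a Z)" "lim_norm (x - z) < e"
        using insert.prems(3)[OF \<open>0 < e\<close>] by blast
      then obtain k where k: "z - k \<odot> a \<in> span Z" by (auto simp: span_insert)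
      let ?z = "(z - k \<odot> a) + k \<odot> y"
      have "span (insert a Z) \<subseteq> X" using insert.prems by (intro span_minimal subspace_X) auto
      then have X: "z \<in> X" "y \<in> X" using z y sub by auto
      have eq: "x - ?z = (x - z) + k \<odot> (a - y)" by (simp add: algebra_simps)
      have "lim_norm (x - ?z) \<le> lim_norm (x - z) + lim_norm (k \<odot> (a - y))"
        unfolding eq using X a x by (intro lim_norm_add) simp_all
      also have "lim_norm (k \<odot> (a - y)) = 0" using y X a by (simp add: lim_norm_scale)
      finally show ?thesis using z k y by (intro bexI[of _ ?z]) (auto intro!: span_add span_scale)
    qed
    then have "\<exists>z\<in>span Z. lim_norm (x - z) = 0" using insert.IH[OF ZX x] by blast
    then show ?thesis using span_mono[of Z "insert a Z"] by blast
  next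
    case False
    then obtain d where d: "d > 0" "\<And>z. z \<in> span Z \<Longrightarrow> d \<le> lim_norm (a - z)" by (auto simp: not_less)
    have "\<exists>k y. y \<in> span Z \<and> lim_norm (x - (k \<odot> a + y)) < (1/2)^n" for n
    proof -
      obtain z where z: "z \<in> span (insert a Z)" "lim_norm (x - z) < (1/2)^n"
        using insert.prems(3)[of "(1/2)^n"] by auto
      then obtain k where "z - k \<odot> a \<in> span Z" by (auto simp: span_insert)
      then show ?thesis using z by (intro exI[of _ k] exI[of _ "z - k \<odot> a"]) auto
    qed
    then obtain k y where ky: "\<And>n. y n \<in> span Z" "\<And>n. lim_norm (x - (k n \<odot> a + y n)) < (1/2)^n"
      by metis
    \<comment> \<open>Dividing by \<open>c\<close> turns the distance of \<open>a\<close> from the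
      span into a bound for the coefficient.\<close>
    have dk: "d * cmod c \<le> lim_norm (c \<odot> a + z)" if "z \<in> span Z" for c z
    proof (cases "c = 0")
      case True then show ?thesis using lim_norm_nonneg[of z] that sub by auto
    next
      case False
      have "c \<odot> a + z = c \<odot> (a - (- (1/c)) \<odot> z)" using False by (simp add: algebra_simps)
      moreover have zX: "a - (- (1/c)) \<odot> z \<in> X" using that sub a by auto
      ultimately have "lim_norm (c \<odot> a + z) = cmod c * lim_norm (a - (- (1/c)) \<odot> z)" by (simp only: lim_norm_scale)
      moreover have "d \<le> lim_norm (a - (- (1/c)) \<odot> z)" using that by (intro d) (intro span_scale)
      then have "d * cmod c \<le> lim_norm (a - (- (1/c)) \<odot> z) * cmod c" by (intro mult_right_mono) auto
      ultimately show ?thesis by (metis mult.commute)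
    qed
    have yX: "y n \<in> X" for n using ky sub by auto
    have kd: "d * cmod (k m - k n) \<le> (1/2)^m + (1/2)^n" for m n
    proof -
      have "d * cmod (k m - k n) \<le> lim_norm ((k m - k n) \<odot> a + (y m - y n))"
        using ky by (intro dk span_diff)
      also have "(k m - k n) \<odot> a + (y m - y n) = (x - (k n \<odot> a + y n)) - (x - (k m \<odot> a + y m))"
        by (simp add: algebra_simps)
      also have "lim_norm \<dots> \<le> lim_norm (x - (k n \<odot> a + y n)) + lim_norm (x - (k m \<odot> a + y m))"
        using a yX x by (intro lim_norm_diff) simp_all
      finally show ?thesis using ky(2)[of m] ky(2)[of n] by linarith
    qed
    have "Cauchy k"
    proof (rule metric_CauchyI)
      fix e :: real assume e: "0 < e"
      then obtain M where M: "(1/2)^M < e * d / 2"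
        using real_arch_pow_inv[of "e*d/2" "1/2"] d by auto
      have "dist (k m) (k n) < e" if "m \<ge> M" "n \<ge> M" for m n
      proof -
        have "(1/2::real)^m \<le> (1/2)^M" "(1/2::real)^n \<le> (1/2)^M"
          using that by (auto intro!: power_decreasing)
        then have "d * cmod (k m - k n) < e * d" using kd[of m n] M by linarith
        then show ?thesis using d by (simp add: dist_norm)
      qed
      then show "\<exists>M. \<forall>m\<ge>M. \<forall>n\<ge>M. dist (k m) (k n) < e" by blast
    qed
    then obtain c where c: "k \<longlonglongrightarrow> c" using Cauchy_convergent convergent_def by blast
    have lim: "(\<lambda>n. (1/2)^n + cmod (k n - c) * lim_norm a) \<longlonglongrightarrow> 0 + 0 * lim_norm a"
      by (intro tendsto_intros LIMSEQ_power_zero) (use c in \<open>auto simp: LIM_zero_iff tendsto_norm_zero\<close>)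
    have "\<exists>z\<in>span Z. lim_norm ((x - c \<odot> a) - z) < e" if "0 < e" for e
    proof -
      obtain n where n: "(1/2)^n + cmod (k n - c) * lim_norm a < e"
        using order_tendstoD(2)[OF lim, of e] \<open>0 < e\<close> by (auto simp: eventually_sequentially)
      have "(x - c \<odot> a) - y n = (x - (k n \<odot> a + y n)) + (k n - c) \<odot> a"
        by (simp add: algebra_simps)
      also have "lim_norm \<dots> \<le> lim_norm (x - (k n \<odot> a + y n)) + lim_norm ((k n - c) \<odot> a)"
        using a yX x by (intro lim_norm_add) simp_all
      also have "\<dots> < e" using n ky(2)[of n] a by (simp add: lim_norm_scale)
      finally show ?thesis using ky by blast
    qed
    then obtain z where z: "z \<in> span Z" "lim_norm ((x - c \<odot> a) - z) = 0"
      using insert.IH[OF ZX, of "x - c \<odot> a"] a x by auto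
    then have "lim_norm (x - (c \<odot> a + z)) = 0" by (simp add: algebra_simps)
    moreover have "c \<odot> a + z \<in> span (insert a Z)"
      using z span_mono[of Z "insert a Z"] by (auto intro!: span_add span_scale intro: span_base)
    ultimately show ?thesis by blast
  qed
qed

text \<open>Finite dimension of the quotient by \<open>stable\<close>, in terms of generators. It
  yields both the annihilating polynomial and the finite dimension of the eigenspaces.\<close>

lemma finite_codim: "\<exists>Z. finite Z \<and> Z \<subseteq> X \<and> (\<forall>x\<in>X. \<exists>z\<in>span Z. x - z \<in> stable)"
proof -
  obtain Z where Z: "finite Z" "Z \<subseteq> X" "\<And>x e. x \<in> X \<Longrightarrow> 0 < e \<Longrightarrow> \<exists>z\<in>span Z. lim_norm (x - z) < e"
    using lim_norm_dense_span by blast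
  have "\<exists>z\<in>span Z. x - z \<in> stable" if xX: "x \<in> X" for x
  proof -
    obtain z where z: "z \<in> span Z" "lim_norm (x - z) = 0"
      using span_lim_norm_closed[OF Z(1,2) xX Z(3)[OF xX]] by blast
    then have "z \<in> X" using span_minimal[OF Z(2) subspace_X] by auto
    then have "x - z \<in> stable" using that z by (intro XsI) auto
    then show ?thesis using z by blast
  qed
  then show ?thesis using Z by blast
qed

section \<open>Polynomials in H and annihilation modulo the stable space\<close>

definition poly_apply :: "complex poly \<Rightarrow> 'a \<Rightarrow> 'a" where
  "poly_apply q x = (\<Sum>i\<le>degree q. poly.coeff q i \<odot> Hp i x)"

lemma poly_apply_extend: "degree q \<le> n \<Longrightarrow> poly_apply q x = (\<Sum>i\<le>n. poly.coeff q i \<odot> Hp i x)"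
  unfolding poly_apply_def by (rule sum.mono_neutral_left) (auto simp: coeff_eq_0)

lemma poly_apply_X [simp]: "x \<in> X \<Longrightarrow> poly_apply q x \<in> X"
  unfolding poly_apply_def by (intro X_closed Hp_X)

lemma poly_apply_stable [simp]: "x \<in> stable \<Longrightarrow> poly_apply q x \<in> stable"
  unfolding poly_apply_def by (intro stable_closed Hp_stable)

lemma poly_apply_0 [simp]: "poly_apply 0 x = 0"
  by (simp add: poly_apply_def)

text \<open>Horner's recursion; it reduces multiplicativity and the action on eigenvectors to
  inductions over coefficients.\<close>

lemma poly_apply_pCons: "x \<in> X \<Longrightarrow> poly_apply (pCons c q) x = c \<odot> x + H (poly_apply q x)"
proof -
  assume x: "x \<in> X"
  have "poly_apply (pCons c q) x = (\<Sum>i\<le>Suc (degree q). poly.coeff (pCons c q) i \<odot> Hp i x)"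
    by (intro poly_apply_extend degree_pCons_le)
  also have "\<dots> = c \<odot> x + (\<Sum>i\<le>degree q. poly.coeff q i \<odot> H (Hp i x))"
    by (subst sum.atMost_Suc_shift) simp
  also have "(\<Sum>i\<le>degree q. poly.coeff q i \<odot> H (Hp i x)) = H (poly_apply q x)"
    unfolding poly_apply_def by (subst H_sum) (use x in \<open>simp_all add: H_scale\<close>)
  finally show ?thesis .
qed

lemma poly_apply_1 [simp]: "x \<in> X \<Longrightarrow> poly_apply 1 x = x"
  by (simp add: one_pCons poly_apply_pCons)

lemma poly_apply_linear_factor: "x \<in> X \<Longrightarrow> poly_apply [:- c, 1:] x = H x - c \<odot> x"
  by (simp add: poly_apply_pCons)

lemma poly_apply_add_poly: "poly_apply (q + r) x = poly_apply q x + poly_apply r x"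
proof -
  let ?n = "max (degree q) (degree r)"
  have "poly_apply (q + r) x = (\<Sum>i\<le>?n. poly.coeff (q + r) i \<odot> Hp i x)"
    by (intro poly_apply_extend degree_add_le) auto
  then show ?thesis
    by (simp add: poly_apply_extend[of q ?n] poly_apply_extend[of r ?n] scale_left_distrib sum.distrib)
qed

lemma poly_apply_smult: "poly_apply (smult c q) x = c \<odot> poly_apply q x"
proof -
  have "poly_apply (smult c q) x = (\<Sum>i\<le>degree q. poly.coeff (smult c q) i \<odot> Hp i x)"
    by (intro poly_apply_extend degree_smult_le)
  then show ?thesis by (simp add: poly_apply_def scale_sum_right)
qed

lemma poly_apply_sum_poly: "poly_apply (\<Sum>i\<in>A. q i) x = (\<Sum>i\<in>A. poly_apply (q i) x)"
  by (induction A rule: infinite_finite_induct) (auto simp: poly_apply_add_poly)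

lemma poly_apply_add: "x \<in> X \<Longrightarrow> y \<in> X \<Longrightarrow> poly_apply q (x + y) = poly_apply q x + poly_apply q y"
  unfolding poly_apply_def by (simp add: Hp_add scale_right_distrib sum.distrib)

lemma poly_apply_scale: "x \<in> X \<Longrightarrow> poly_apply q (c \<odot> x) = c \<odot> poly_apply q x"
  unfolding poly_apply_def scale_sum_right by (intro sum.cong) (auto simp: Hp_scale mult.commute)

lemma poly_apply_diff: "x \<in> X \<Longrightarrow> y \<in> X \<Longrightarrow> poly_apply q (x - y) = poly_apply q x - poly_apply q y"
  using poly_apply_add[of x "- 1 \<odot> y" q] poly_apply_scale[of y q "- 1"] by simp

lemma poly_apply_H: "x \<in> X \<Longrightarrow> poly_apply q (H x) = H (poly_apply q x)"
  unfolding poly_apply_def by (subst H_sum) (auto simp: H_scale funpow_swap1 intro!: sum.cong)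

lemma poly_apply_mult: "x \<in> X \<Longrightarrow> poly_apply (q * r) x = poly_apply q (poly_apply r x)"
proof (induction q)
  case (pCons c q)
  then show ?case by (simp add: mult_pCons_left poly_apply_add_poly poly_apply_smult poly_apply_pCons)
qed simp

lemma poly_apply_eigenvector: "x \<in> X \<Longrightarrow> H x = c \<odot> x \<Longrightarrow> poly_apply q x = poly q c \<odot> x"
proof (induction q)
  case (pCons d q)
  then show ?case by (simp add: poly_apply_pCons H_scale scale_left_distrib mult.commute)
qed simp

lemma subspace_poly_apply_stable: "subspace {x\<in>X. poly_apply q x \<in> stable}"
proof (rule subspaceI)
  show "0 \<in> {x\<in>X. poly_apply q x \<in> stable}" by (simp)
qed (auto simp: poly_apply_add poly_apply_scale)

text \<open>Dependence of a family rather than of a set: a repeated vector is itself a nontrivial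
  relation and has to be treated apart from the dimension bound.\<close>

lemma span_family_dependent:
  assumes "finite Z" "\<And>i. v i \<in> span Z"
  shows "\<exists>c. (\<exists>i\<le>card Z. c i \<noteq> 0) \<and> (\<Sum>i\<le>card Z. c i \<odot> v i) = 0"
proof (cases "inj_on v {..card Z}")
  case True
  then have card: "card (v ` {..card Z}) = Suc (card Z)" by (simp add: card_image)
  have "v ` {..card Z} \<subseteq> span Z" using assms by auto
  then have "dependent (v ` {..card Z})"
    using independent_span_bound[OF assms(1), of "v ` {..card Z}"] card by auto
  then obtain u where u: "\<exists>y\<in>v ` {..card Z}. u y \<noteq> 0" "(\<Sum>y\<in>v ` {..card Z}. u y \<odot> y) = 0"
    by (subst (asm) dependent_finite) auto
  from u(2) have "(\<Sum>i\<le>card Z. u (v i) \<odot> v i) = 0"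
    by (subst (asm) sum.reindex[OF True]) simp
  then show ?thesis using u(1) by (intro exI[of _ "\<lambda>i. u (v i)"]) auto
next
  case False
  then obtain i j where ij: "i \<le> card Z" "j \<le> card Z" "v i = v j" "i \<noteq> j"
    by (auto simp: inj_on_def)
  let ?c = "\<lambda>k. if k = i then 1 else if k = j then -1 else 0 :: complex"
  have "(\<Sum>k\<le>card Z. ?c k \<odot> v k) = (\<Sum>k\<in>{i, j}. ?c k \<odot> v k)"
    using ij by (intro sum.mono_neutral_right) auto
  also have "\<dots> = 0" using ij by simp
  finally show ?thesis using ij by (intro exI[of _ ?c]) auto
qed

text \<open>Modulo \<open>stable\<close>, the vectors \<open>z, H z, H^2 z, ...\<close> lie in a
  finite-dimensional space, so each generator \<open>z\<close> is annihilated by some polynomial;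
  the product over the generators annihilates everything.\<close>

lemma annihilating_poly: "\<exists>q. q \<noteq> 0 \<and> (\<forall>x\<in>X. poly_apply q x \<in> stable)"
proof -
  obtain Z where Z: "finite Z" "Z \<subseteq> X" "\<And>x. x \<in> X \<Longrightarrow> \<exists>z\<in>span Z. x - z \<in> stable"
    using finite_codim by blast
  have single: "\<exists>q. q \<noteq> 0 \<and> poly_apply q z \<in> stable" if z: "z \<in> X" for z
  proof -
    have "\<exists>y\<in>span Z. Hp i z - y \<in> stable" for i using Z(3) z by simp
    then obtain v where v: "\<And>i. v i \<in> span Z" "\<And>i. Hp i z - v i \<in> stable" by metis
    let ?n = "card Z"
    obtain c where c: "\<exists>i\<le>?n. c i \<noteq> 0" "(\<Sum>i\<le>?n. c i \<odot> v i) = 0"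
      using span_family_dependent[OF Z(1), of v] v(1) by blast
    define q where "q = (\<Sum>i\<le>?n. monom (c i) i)"
    have coeff: "poly.coeff q i = (if i \<le> ?n then c i else 0)" for i
      by (simp add: q_def coeff_sum if_distrib cong: if_cong)
    have "degree q \<le> ?n" by (rule degree_le) (simp add: coeff)
    then have "poly_apply q z = (\<Sum>i\<le>?n. c i \<odot> Hp i z) - (\<Sum>i\<le>?n. c i \<odot> v i)"
      by (subst poly_apply_extend) (auto simp: coeff c(2))
    also have "\<dots> = (\<Sum>i\<le>?n. c i \<odot> (Hp i z - v i))"
      by (simp add: scale_right_diff_distrib sum_subtractf)
    also have "\<dots> \<in> stable" by (intro stable_closed v)
    finally have "poly_apply q z \<in> stable" .
    moreover have "q \<noteq> 0" using c(1) coeff by (metis coeff_0)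
    ultimately show ?thesis by blast
  qed
  have "\<exists>q. q \<noteq> 0 \<and> (\<forall>z\<in>Z. poly_apply q z \<in> stable)"
    using Z(1,2)
  proof (induction Z rule: finite_induct)
    case empty show ?case by (intro exI[of _ 1]) auto
  next
    case (insert z Z)
    then obtain q r where q: "q \<noteq> 0" "\<forall>z\<in>Z. poly_apply q z \<in> stable" and r: "r \<noteq> 0" "poly_apply r z \<in> stable"
      using single by fastforce
    have zX: "z \<in> X" and ZX: "\<And>y. y \<in> Z \<Longrightarrow> y \<in> X" using insert.prems by auto
    have "poly_apply (q * r) z \<in> stable" using r zX by (simp add: poly_apply_mult)
    moreover have "poly_apply (q * r) y \<in> stable" if "y \<in> Z" for y
      \<comment> \<open>The factors are exchanged so that \<open>q\<close>, which annihilates the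
        older generators, acts before \<open>r\<close>.\<close>
      using q that ZX[OF that] by (subst mult.commute) (simp add: poly_apply_mult)
    ultimately show ?case using q r by (intro exI[of _ "q * r"]) auto
  qed
  then obtain q where q: "q \<noteq> 0" "\<forall>z\<in>Z. poly_apply q z \<in> stable" by blast
  have "Z \<subseteq> {x\<in>X. poly_apply q x \<in> stable}" using q(2) Z(2) by auto
  from span_minimal[OF this subspace_poly_apply_stable]
  have sp: "span Z \<subseteq> {x\<in>X. poly_apply q x \<in> stable}" .
  have "poly_apply q x \<in> stable" if x: "x \<in> X" for x
  proof -
    obtain z where z: "z \<in> span Z" "x - z \<in> stable" using Z(3)[OF x] by blast
    then have zX: "z \<in> X" "poly_apply q z \<in> stable" using sp by auto
    have "poly_apply q x = poly_apply q (x - z) + poly_apply q z" using x zX by (simp add: poly_apply_diff)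
    then show ?thesis using z zX by simp
  qed
  then show ?thesis using q(1) by blast
qed

section \<open>Reduction to simple roots of modulus one\<close>

lemma lim_norm_cong: "x - y \<in> stable \<Longrightarrow> x \<in> X \<Longrightarrow> y \<in> X \<Longrightarrow> lim_norm x = lim_norm y"
  using lim_norm_triangle[of x y] lim_norm_triangle[of y x] lim_norm_minus_commute[of x y] lim_norm_stable[of "x - y"] by simp

text \<open>\<open>H\<close> preserves the seminorm while multiplication by \<open>c\<close> scales
  it by \<open>|c|\<close>.\<close>

lemma approximate_eigenvector_modulus:
  assumes "g \<in> X" "H g - c \<odot> g \<in> stable" "cmod c \<noteq> 1"
  shows "g \<in> stable"
proof -
  have "lim_norm g = lim_norm (H g)" using assms by (simp add: lim_norm_H)
  also have "\<dots> = lim_norm (c \<odot> g)" using assms by (intro lim_norm_cong) simp_all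
  finally have "(1 - cmod c) * lim_norm g = 0" using assms by (simp add: lim_norm_scale algebra_simps)
  then show ?thesis using assms by (intro XsI) auto
qed

text \<open>A nontrivial Jordan block for a unimodular eigenvalue would make \<open>lim_norm\<close> grow linearly
  along orbits.\<close>

lemma no_Jordan_block:
  assumes g: "g' \<in> X" "g = H g' - c \<odot> g'" "H g - c \<odot> g \<in> stable" "cmod c = 1"
  shows "g \<in> stable"
proof -
  have gX: "g \<in> X" using g by simp
  \<comment> \<open>Modulo \<open>stable\<close>, \<open>H^n g'\<close> is
    \<open>c^n g' + n c^(n-1) g\<close>. Everything is multiplied by \<open>c\<close> to keep the
    exponents natural at \<open>n = 0\<close>.\<close>
  have J: "c \<odot> Hp n g' - c ^ Suc n \<odot> g' - (of_nat n * c ^ n) \<odot> g \<in> stable" for n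
  proof (induction n)
    case (Suc n)
    let ?s = "H g - c \<odot> g"
    have Hg: "H g' = c \<odot> g' + g" "H g = c \<odot> g + ?s" using g by (simp_all add: algebra_simps)
    have "H (c \<odot> Hp n g' - c ^ Suc n \<odot> g' - (of_nat n * c ^ n) \<odot> g) =
        c \<odot> Hp (Suc n) g' - c ^ Suc n \<odot> H g' - (of_nat n * c ^ n) \<odot> H g"
      using g(1) gX by (simp add: H_diff H_scale)
    also have "\<dots> = (c \<odot> Hp (Suc n) g' - c ^ Suc (Suc n) \<odot> g' - (of_nat (Suc n) * c ^ Suc n) \<odot> g)
        - (of_nat n * c ^ n) \<odot> ?s"
      unfolding Hg(1) by (subst Hg(2)) (simp add: algebra_simps)
    finally have "c \<odot> Hp (Suc n) g' - c ^ Suc (Suc n) \<odot> g' - (of_nat (Suc n) * c ^ Suc n) \<odot> g =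
      H (c \<odot> Hp n g' - c ^ Suc n \<odot> g' - (of_nat n * c ^ n) \<odot> g) + (of_nat n * c ^ n) \<odot> ?s"
      by (simp add: algebra_simps)
    also have "\<dots> \<in> stable" by (intro stable_closed H_stable Suc g)
    finally show ?case .
  qed (use g in simp)
  have "real n * lim_norm g \<le> 2 * lim_norm g'" for n
  proof -
    have "real n * lim_norm g = lim_norm ((of_nat n * c ^ n) \<odot> g)"
      using gX g(4) by (simp add: lim_norm_scale norm_mult norm_power)
    also have "\<dots> = lim_norm (c \<odot> Hp n g' - c ^ Suc n \<odot> g')"
      using J[of n] g(1) gX by (intro lim_norm_cong[symmetric]) auto
    also have "\<dots> \<le> lim_norm (c \<odot> Hp n g') + lim_norm (c ^ Suc n \<odot> g')" using g by (intro lim_norm_diff) auto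
    also have "\<dots> = 2 * lim_norm g'" 
      using lim_norm_scale[of "Hp n g'" c] lim_norm_scale[of g' "c ^ Suc n"] g(1,4) lim_norm_Hp[of g' n]
      by (simp add: norm_mult norm_power)
    finally show ?thesis .
  qed
  then have "lim_norm g = 0" using lim_norm_nonneg[OF gX] reals_Archimedean3[of "lim_norm g"]
    by (metis less_eq_real_def linorder_not_le)
  then show ?thesis using gX by (rule XsI[rotated])
qed

text \<open>Splitting off a root \<open>c\<close> of \<open>q\<close> passes from \<open>Y\<close>
  to the invariant set \<open>(H - c) Y\<close>, hence the general \<open>Y\<close>. A factor with
  \<open>|c| \<noteq> 1\<close> is dropped by \<open>approximate_eigenvector_modulus\<close>, a
  repeated one by \<open>no_Jordan_block\<close>; a new unimodular \<open>c\<close> is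
  inserted.\<close>

lemma annihilating_unimodular:
  assumes "q \<noteq> 0" "Y \<subseteq> X" "H ` Y \<subseteq> Y" "\<And>y. y \<in> Y \<Longrightarrow> poly_apply q y \<in> stable"
  shows "\<exists>\<Lambda>. finite \<Lambda> \<and> (\<forall>c\<in>\<Lambda>. cmod c = 1) \<and> (\<forall>y\<in>Y. poly_apply (\<Prod>c\<in>\<Lambda>. [:- c, 1:]) y \<in> stable)"
  using assms
proof (induction "degree q" arbitrary: q Y)
  case 0
  then obtain c where c: "q = [:c:]" "c \<noteq> 0" by (metis degree_eq_zeroE pCons_0_0)
  have "y \<in> stable" if "y \<in> Y" for y
  proof -
    have "c \<odot> y \<in> stable" using 0(5)[OF that] c that 0(3) by (simp add: poly_apply_pCons subset_iff)
    then have "(1/c) \<odot> (c \<odot> y) \<in> stable" by (rule stable_closed(3))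
    moreover have "(1/c) \<odot> (c \<odot> y) = y" using c by simp
    ultimately show ?thesis by (simp only:)
  qed
  then show ?case using 0(3) by (intro exI[of _ "{}"]) (auto simp: subset_iff)
next
  case (Suc n)
  then have "\<not> constant (poly q)" by (simp add: constant_degree)
  then obtain c where "poly q c = 0" using fundamental_theorem_of_algebra by blast
  then obtain r where r: "q = [:- c, 1:] * r" by (metis poly_eq_0_iff_dvd dvdE)
  have r0: "r \<noteq> 0" using Suc.prems r by auto
  have "degree q = degree [:- c, 1:] + degree r" unfolding r using r0 by (intro degree_mult_eq) auto
  then have dr: "n = degree r" using Suc.hyps(2) by simp
  let ?Y = "(\<lambda>y. H y - c \<odot> y) ` Y"
  have "\<exists>\<Lambda>. finite \<Lambda> \<and> (\<forall>c\<in>\<Lambda>. cmod c = 1) \<and> (\<forall>y\<in>?Y. poly_apply (\<Prod>c\<in>\<Lambda>. [:- c, 1:]) y \<in> stable)"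
  proof (rule Suc.hyps(1)[OF dr r0])
    show "?Y \<subseteq> X" using Suc.prems(2) by (auto simp: subset_iff)
    show "H ` ?Y \<subseteq> ?Y"
    proof (clarsimp simp: image_iff)
      fix y assume "y \<in> Y"
      then show "\<exists>x\<in>Y. H (H y - c \<odot> y) = H x - c \<odot> x"
        using Suc.prems(2,3) by (intro bexI[of _ "H y"]) (auto simp: H_diff H_scale subset_iff)
    qed
    fix y assume "y \<in> ?Y"
    then obtain x where x: "x \<in> Y" "x \<in> X" "y = H x - c \<odot> x" using Suc.prems(2) by auto
    then have "poly_apply r y = poly_apply (r * [:- c, 1:]) x" unfolding poly_apply_mult[OF x(2)] by (simp add: poly_apply_linear_factor)
    also have "\<dots> = poly_apply q x" unfolding r by (simp only: mult.commute)
    finally show "poly_apply r y \<in> stable" using Suc.prems(4) x by simp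
  qed
  then obtain \<Lambda> where L: "finite \<Lambda>" "\<forall>c\<in>\<Lambda>. cmod c = 1"
    "\<And>y. y \<in> Y \<Longrightarrow> poly_apply (\<Prod>c\<in>\<Lambda>. [:- c, 1:]) (H y - c \<odot> y) \<in> stable" by blast
  let ?P = "\<lambda>L. \<Prod>c\<in>L. [:- c, 1:]"
  have YX: "y \<in> X" if "y \<in> Y" for y using Suc.prems(2) that by auto
  have g: "H (poly_apply (?P \<Lambda>) y) - c \<odot> poly_apply (?P \<Lambda>) y \<in> stable" if "y \<in> Y" for y
    using L(3)[OF that] YX[OF that] by (simp add: poly_apply_diff poly_apply_scale poly_apply_H)
  consider "cmod c \<noteq> 1" | "cmod c = 1" "c \<in> \<Lambda>" | "cmod c = 1" "c \<notin> \<Lambda>" by blast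
  then show ?case
  proof cases
    case 1
    then have "poly_apply (?P \<Lambda>) y \<in> stable" if "y \<in> Y" for y
      using approximate_eigenvector_modulus[OF poly_apply_X[OF YX[OF that]] g[OF that]] by blast
    then show ?thesis using L(1,2) by blast
  next
    case 2
    have "poly_apply (?P \<Lambda>) y \<in> stable" if y: "y \<in> Y" for y
    proof (rule no_Jordan_block)
      have "?P \<Lambda> = [:- c, 1:] * ?P (\<Lambda> - {c})" using 2 L by (intro prod.remove)
      then show "poly_apply (?P \<Lambda>) y = H (poly_apply (?P (\<Lambda> - {c})) y) - c \<odot> poly_apply (?P (\<Lambda> - {c})) y"
        using YX[OF y] by (simp only: poly_apply_mult poly_apply_linear_factor poly_apply_X)
    qed (use YX[OF y] g[OF y] 2 in auto)
    then show ?thesis using L by blast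
  next
    case 3
    have "?P (insert c \<Lambda>) = [:- c, 1:] * ?P \<Lambda>" using 3 L by simp
    then have "poly_apply (?P (insert c \<Lambda>)) y \<in> stable" if "y \<in> Y" for y
      using YX[OF that] g[OF that] by (simp only: poly_apply_mult poly_apply_linear_factor poly_apply_X)
    then show ?thesis using L 3 by (intro exI[of _ "insert c \<Lambda>"]) auto
  qed
qed

section \<open>Exponential decay on the stable space\<close>

text \<open>Each orbit in \<open>stable\<close> tends to 0 for \<open>w\<close>; compactness makes
  this uniform on the unit ball, because the finitely many centres are small after a common time and
  \<open>H\<close> does not increase the distance to them. \<open>N_Hp_small\<close> then turns weak
  smallness into strong smallness.\<close>

lemma stable_half: "\<exists>n>0. \<forall>x\<in>stable. N (Hp n x) \<le> 1/2 * N x"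
proof -
  obtain C where C: "C \<ge> 0"
    "\<And>e. e > 0 \<Longrightarrow> \<exists>n0. \<forall>n\<ge>n0. \<forall>x\<in>X. N (Hp n x) \<le> e * N x + C * w x"
    using N_Hp_small by blast
  obtain A where A: "A \<ge> 0" "\<And>n x. x \<in> X \<Longrightarrow> N (Hp n x) \<le> A * N x"
    using N_Hp_bounded by blast
  \<comment> \<open>\<open>e\<close> and the later \<open>e'\<close> are chosen so that weak and
    strong contribution are at most 1/4 each.\<close>
  define e where "e = 1 / (8 * (C + 1))"
  have e: "0 < e" "C * (2 * e) \<le> 1/4" using C by (auto simp: e_def field_simps)
  obtain F where F: "finite F" "{x\<in>X. N x \<le> 1} \<subseteq> \<Union>F"
      "\<And>S x y. S \<in> F \<Longrightarrow> x \<in> S \<Longrightarrow> y \<in> S \<Longrightarrow> w (x - y) < e"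
    using compact_embedding[OF e(1), of 1] by auto
  \<comment> \<open>Only sets that meet \<open>stable\<close> are kept, so that their centres can be
    taken in \<open>stable\<close>, where orbits tend to 0.\<close>
  define F' where "F' = {S\<in>F. S \<inter> stable \<noteq> {}}"
  have "\<exists>x. x \<in> S \<and> x \<in> stable" if "S \<in> F'" for S using that by (auto simp: F'_def)
  then obtain c where c: "\<And>S. S \<in> F' \<Longrightarrow> c S \<in> S" "\<And>S. S \<in> F' \<Longrightarrow> c S \<in> stable" by metis
  have "\<forall>\<^sub>F n in sequentially. w (Hp n (c S)) < e" if "S \<in> F'" for S
    using order_tendstoD(2)[OF lim_norm_tendsto, of "c S" e] c(2)[OF that] e by (simp add: lim_norm_stable)
  then have "\<forall>\<^sub>F n in sequentially. \<forall>S\<in>F'. w (Hp n (c S)) < e"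
    using F(1) by (intro eventually_ball_finite) (simp_all add: F'_def)
  then obtain m where m: "\<And>S. S \<in> F' \<Longrightarrow> w (Hp m (c S)) < e"
    by (auto simp: eventually_sequentially)
  define e' where "e' = 1 / (4 * (A + 1))"
  have e': "0 < e'" "e' * A \<le> 1/4" using A by (auto simp: e'_def field_simps)
  obtain n0 where n0: "\<And>n x. n \<ge> n0 \<Longrightarrow> x \<in> X \<Longrightarrow> N (Hp n x) \<le> e' * N x + C * w x"
    using C(2)[OF e'(1)] by blast
  \<comment> \<open>The successor makes \<open>n\<close> positive.\<close>
  define n where "n = Suc n0 + m"
  have unit: "N (Hp n x) \<le> 1/2" if x: "x \<in> stable" "N x \<le> 1" for x
  proof -
    have xX: "x \<in> X" using x by simp
    obtain S where S: "S \<in> F" "x \<in> S" using F(2) x xX by blast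
    then have S': "S \<in> F'" using x by (auto simp: F'_def)
    let ?c = "c S"
    have cX: "?c \<in> X" using c(2)[OF S'] by simp
    have "w (Hp m x) = w (Hp m (x - ?c) + Hp m ?c)" using xX cX by (simp add: Hp_diff)
    also have "\<dots> \<le> w (Hp m (x - ?c)) + w (Hp m ?c)" using xX cX by (intro w_add) simp_all
    also have "w (Hp m (x - ?c)) \<le> w (x - ?c)" using xX cX by (intro w_Hp) simp_all
    also have "w (x - ?c) < e" using F(3) S c(1)[OF S'] by blast
    finally have wm: "w (Hp m x) \<le> 2 * e" using m[OF S'] by linarith
    have "N (Hp n x) = N (Hp (Suc n0) (Hp m x))" by (simp only: Hp_Hp n_def)
    also have "\<dots> \<le> e' * N (Hp m x) + C * w (Hp m x)" using n0[of "Suc n0" "Hp m x"] xX by simp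
    also have "\<dots> \<le> e' * A + C * (2 * e)"
    proof (intro add_mono mult_left_mono wm)
      show "N (Hp m x) \<le> A" using A(2)[OF xX, of m] mult_left_mono[OF x(2) A(1)] by simp
    qed (use e' C in auto)
    finally show ?thesis using e e' by linarith
  qed
  have "N (Hp n x) \<le> 1/2 * N x" if x: "x \<in> stable" for x
  proof (cases "N x = 0")
    case True
    then have "x = 0" using x w_le_N[of x] w_nonneg[of x] w_eq_0[of x] by simp
    then show ?thesis by simp
  next
    case False
    then have pos: "N x > 0" using N_nonneg[of x] x by simp
    let ?y = "of_real (1 / N x) \<odot> x"
    have "N ?y = 1" "?y \<in> stable" using pos x by (simp_all add: N_scale norm_divide)
    then have "N (Hp n ?y) \<le> 1/2" using unit[of ?y] by linarith
    moreover have "N (Hp n ?y) = N (Hp n x) / N x"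
      using pos x by (simp add: Hp_scale N_scale norm_divide)
    ultimately have "N (Hp n x) / N x \<le> 1/2" by linarith
    then show ?thesis using pos by (simp add: field_simps)
  qed
  then show ?thesis by (intro exI[of _ n]) (simp add: n_def)
qed

text \<open>The constants are carried along as parameters so that all resolvent estimates refer to
  the same \<open>\<rho>\<close> and \<open>B\<close>.\<close>

definition stable_decay :: "real \<Rightarrow> real \<Rightarrow> bool" where
  "stable_decay \<rho> B \<longleftrightarrow> 0 < \<rho> \<and> \<rho> < 1 \<and> 0 \<le> B \<and> (\<forall>n. \<forall>x\<in>stable. N (Hp n x) \<le> B * \<rho> ^ n * N x)"

lemma stable_decay_exists: "\<exists>\<rho> B. stable_decay \<rho> B"
proof -
  obtain n1 where n1: "n1 > 0" "\<And>x. x \<in> stable \<Longrightarrow> N (Hp n1 x) \<le> 1/2 * N x" using stable_half by blast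
  obtain A where A: "A \<ge> 0" "\<And>n x. x \<in> X \<Longrightarrow> N (Hp n x) \<le> A * N x"
    using N_Hp_bounded by blast
  \<comment> \<open>Halving in \<open>n1\<close> steps is decay at this rate. An unfinished block
    loses at most a factor 2, the origin of \<open>2 * A\<close> below.\<close>
  define \<rho> where "\<rho> = root n1 (1/2)"
  have r: "0 < \<rho>" "\<rho> < 1" "\<rho> ^ n1 = 1/2" using n1 by (auto simp: \<rho>_def)
  have k: "N (Hp (n1 * k) x) \<le> (1/2) ^ k * N x" if "x \<in> stable" for k x
  proof (induction k)
    case (Suc k)
    have "N (Hp (n1 * Suc k) x) = N (Hp n1 (Hp (n1 * k) x))" by (simp add: Hp_Hp)
    also have "\<dots> \<le> 1/2 * N (Hp (n1 * k) x)" using that by (intro n1 Hp_stable)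
    finally show ?case using Suc by simp
  qed simp
  have "N (Hp n x) \<le> (2 * A) * \<rho> ^ n * N x" if x: "x \<in> stable" for n x
  proof -
    let ?k = "n div n1"
    have "N (Hp n x) = N (Hp (n1 * ?k) (Hp (n mod n1) x))" by (simp add: Hp_Hp)
    also have "\<dots> \<le> (1/2) ^ ?k * N (Hp (n mod n1) x)" using x by (intro k Hp_stable)
    also have "\<dots> \<le> (2 * \<rho> ^ n) * (A * N x)"
    proof (intro mult_mono)
      have "(1/2) ^ ?k * (1/2) = \<rho> ^ (n1 * ?k) * \<rho> ^ n1" by (simp add: power_mult r(3))
      also have "\<dots> \<le> \<rho> ^ (n1 * ?k) * \<rho> ^ (n mod n1)"
        using r n1(1) by (intro mult_left_mono power_decreasing) auto
      also have "\<dots> = \<rho> ^ n" by (simp flip: power_add)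
      finally show "(1/2) ^ ?k \<le> 2 * \<rho> ^ n" by simp
    qed (use x A N_nonneg r in auto)
    finally show ?thesis by (simp add: mult_ac)
  qed
  then show ?thesis using r A unfolding stable_decay_def by (intro exI[of _ \<rho>] exI[of _ "2 * A"]) auto
qed

section \<open>The resolvent on the stable space\<close>

lemma eq_0_if_N_le_0: "x \<in> X \<Longrightarrow> N x \<le> 0 \<Longrightarrow> x = 0"
  using w_le_N[of x] w_nonneg[of x] w_eq_0[of x] by simp

text \<open>The iterates of such an \<open>x\<close> would grow like \<open>|z|^n\<close>, against
  the decay rate \<open>\<rho>^n\<close>.\<close>

lemma resolvent_unique:
  assumes "stable_decay \<rho> B" "x \<in> stable" "H x = z \<odot> x" "\<rho> < cmod z"
  shows "x = 0"
proof (rule ccontr)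
  assume "x \<noteq> 0"
  then have pos: "N x > 0" using eq_0_if_N_le_0[OF stable_X[OF assms(2)]] by linarith
  have r: "0 < \<rho>" and d: "\<And>n. N (Hp n x) \<le> B * \<rho> ^ n * N x"
    using assms unfolding stable_decay_def by auto
  have "Hp n x = z ^ n \<odot> x" for n
    by (induction n) (use assms in \<open>simp_all add: H_scale mult.commute\<close>)
  then have "cmod z ^ n * N x \<le> B * \<rho> ^ n * N x" for n
    using d[of n] assms(2) by (simp add: N_scale norm_power)
  then have "cmod z ^ n \<le> B * \<rho> ^ n" for n using pos by simp
  then have "(cmod z / \<rho>) ^ n \<le> B" for n using r by (simp add: power_divide pos_divide_le_eq)
  moreover obtain n where "B < (cmod z / \<rho>) ^ n"
    using real_arch_pow[of "cmod z / \<rho>" B] assms(4) r by (auto simp: field_simps)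
  ultimately show False using linorder_not_le by blast
qed

text \<open>The Neumann series \<open>sum z^-(k+1) H^k x\<close> is dominated by a geometric series
  of ratio \<open>\<rho> / |z|\<close>, whose sum gives the bound.\<close>

lemma resolvent_exists:
  assumes dec: "stable_decay \<rho> B" and x: "x \<in> stable" and z: "\<rho> < cmod z"
  shows "\<exists>s\<in>stable. z \<odot> s - H s = x \<and> N s \<le> B / (cmod z - \<rho>) * N x"
proof -
  have r: "0 < \<rho>" "0 \<le> B" and d: "\<And>n. N (Hp n x) \<le> B * \<rho> ^ n * N x"
    using dec x unfolding stable_decay_def by auto
  have xX: "x \<in> X" and Nx: "0 \<le> N x" using x N_nonneg[of x] by simp_all
  have z0: "z \<noteq> 0" "cmod z > 0" using z r by auto
  define q where "q = \<rho> / cmod z"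
  have q: "0 < q" "q < 1" using r z z0 by (simp_all add: q_def)
  define u where "u k = (1 / z ^ Suc k) \<odot> Hp k x" for k
  define S where "S n = (\<Sum>k<n. u k)" for n
  have uX: "u k \<in> stable" for k unfolding u_def using x by simp
  have SX: "S n \<in> stable" for n unfolding S_def using uX by simp
  have Nu: "N (u k) \<le> (B * N x / cmod z) * q ^ k" for k
  proof -
    have "N (u k) = N (Hp k x) / cmod z ^ Suc k"
      using xX by (simp add: u_def N_scale norm_divide norm_mult norm_power)
    also have "\<dots> \<le> (B * \<rho> ^ k * N x) / cmod z ^ Suc k" using d by (intro divide_right_mono) auto
    finally show ?thesis by (simp add: q_def power_divide mult_ac)
  qed
  have sg: "summable (\<lambda>k. (B * N x / cmod z) * q ^ k)" using q by (intro summable_mult summable_geometric) auto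
  have su: "summable (\<lambda>k. N (u k))"
    by (rule summable_comparison_test'[OF sg, of 0]) (use Nu N_nonneg uX in auto)
  have NS: "N (S n) \<le> B / (cmod z - \<rho>) * N x" for n
  proof -
    have "N (S n) \<le> (\<Sum>k<n. N (u k))" unfolding S_def by (intro N_sum) (simp add: uX)
    also have "\<dots> \<le> (\<Sum>k<n. (B * N x / cmod z) * q ^ k)" by (intro sum_mono Nu)
    also have "\<dots> \<le> (\<Sum>k. (B * N x / cmod z) * q ^ k)"
      using sg r Nx q by (intro sum_le_suminf) (auto intro!: divide_nonneg_nonneg mult_nonneg_nonneg)
    also have "\<dots> = (B * N x / cmod z) * (1 / (1 - q))"
      using q by (subst suminf_mult) (auto simp: suminf_geometric summable_geometric)
    also have "\<dots> = B / (cmod z - \<rho>) * N x" using z0 z by (simp add: q_def field_simps)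
    finally show ?thesis .
  qed
  obtain s where s: "s \<in> X" "(\<lambda>n. N (s - S n)) \<longlonglongrightarrow> 0"
    using N_complete[of u, OF stable_X[OF uX] su] unfolding S_def by blast
  \<comment> \<open>Telescoping; the remainder \<open>z^-n H^n x\<close> tends to 0.\<close>
  have tail: "z \<odot> S n - H (S n) = x - (1 / z ^ n) \<odot> Hp n x" for n
  proof (induction n)
    case (Suc n)
    have "z \<odot> S (Suc n) - H (S (Suc n)) = (z \<odot> S n - H (S n)) + (z \<odot> u n - H (u n))"
      using SX[of n] uX[of n] by (simp add: S_def H_add scale_right_distrib)
    also have "z \<odot> u n = (1 / z ^ n) \<odot> Hp n x" using z0 by (simp add: u_def)
    also have "H (u n) = (1 / z ^ Suc n) \<odot> Hp (Suc n) x" using xX by (simp add: u_def H_scale)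
    finally show ?case using Suc by simp
  qed (simp add: S_def)
  \<comment> \<open>\<open>stable\<close> is closed under \<open>N\<close>-limits because
    \<open>lim_norm \<le> w \<le> N\<close>.\<close>
  have "lim_norm s \<le> 0"
  proof (rule LIMSEQ_le_const[OF s(2)], intro exI allI impI)
    fix n
    have "lim_norm s \<le> lim_norm (s - S n) + lim_norm (S n)" using s SX[of n] by (intro lim_norm_triangle) simp_all
    also have "\<dots> \<le> N (s - S n)" using lim_norm_le_w[of "s - S n"] w_le_N[of "s - S n"] s SX[of n] lim_norm_stable[OF SX[of n]] by simp
    finally show "lim_norm s \<le> N (s - S n)" .
  qed
  then have sXs: "s \<in> stable" using lim_norm_nonneg[OF s(1)] s(1) by (intro XsI) simp_all
  have "N s \<le> B / (cmod z - \<rho>) * N x + 0"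
  proof (rule LIMSEQ_le_const[OF tendsto_add[OF tendsto_const s(2)]], intro exI allI impI)
    fix n
    have "N s \<le> N (s - S n) + N (S n)" using N_add[of "s - S n" "S n"] s SX[of n] by simp
    then show "N s \<le> B / (cmod z - \<rho>) * N x + N (s - S n)" using NS[of n] by linarith
  qed
  moreover have "z \<odot> s - H s - x = 0"
  proof (rule eq_0_if_N_le_0)
    show "z \<odot> s - H s - x \<in> X" using s xX by simp
    obtain M where M: "\<And>x. x \<in> X \<Longrightarrow> N (H x) \<le> M * N x" using H_bound by blast
    have lim: "(\<lambda>n. cmod z * N (s - S n) + M * N (s - S n) + (B * N x) * q ^ n) \<longlonglongrightarrow>
        cmod z * 0 + M * 0 + (B * N x) * 0"
      using q by (intro tendsto_intros s(2) LIMSEQ_power_zero) auto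
    have "N (z \<odot> s - H s - x) \<le> cmod z * 0 + M * 0 + (B * N x) * 0"
    proof (rule LIMSEQ_le_const[OF lim], intro exI allI impI)
      fix n
      let ?t = "s - S n" and ?h = "(1 / z ^ n) \<odot> Hp n x"
      have tX: "?t \<in> X" "S n \<in> X" "?h \<in> X" using s SX[of n] xX by simp_all
      have "z \<odot> s - H s - x = (z \<odot> ?t - H ?t) - ?h"
        using tail[of n] tX s by (simp add: H_diff algebra_simps)
      also have "N \<dots> \<le> N (z \<odot> ?t - H ?t) + N ?h" using tX by (intro N_diff) simp_all
      also have "N (z \<odot> ?t - H ?t) \<le> N (z \<odot> ?t) + N (H ?t)" using tX by (intro N_diff) simp_all
      also have "N (z \<odot> ?t) = cmod z * N ?t" using tX by (simp add: N_scale)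
      also have "N (H ?t) \<le> M * N ?t" using tX by (intro M)
      also have "N ?h \<le> (B * N x) * q ^ n"
      proof -
        have "N ?h = N (Hp n x) / cmod z ^ n" using xX by (simp add: N_scale norm_divide norm_power)
        also have "\<dots> \<le> (B * \<rho> ^ n * N x) / cmod z ^ n" using d by (intro divide_right_mono) auto
        finally show ?thesis by (simp add: q_def power_divide mult_ac)
      qed
      finally show "N (z \<odot> s - H s - x) \<le> cmod z * N ?t + M * N ?t + (B * N x) * q ^ n" by simp
    qed
    then show "N (z \<odot> s - H s - x) \<le> 0" by simp
  qed
  ultimately show ?thesis using sXs by (intro bexI[of _ s]) simp_all
qed

text \<open>The inverse of \<open>z - H\<close> on \<open>stable\<close>, meaningful for
  \<open>|z| > \<rho>\<close> and arguments in \<open>stable\<close>. As a definite description it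
  inherits linearity from uniqueness, by \<open>R_eqI\<close>.\<close>

definition R :: "complex \<Rightarrow> 'a \<Rightarrow> 'a" where
  "R z x = (THE s. s \<in> stable \<and> z \<odot> s - H s = x)"

lemma R_eqI:
  assumes "stable_decay \<rho> B" "\<rho> < cmod z" "s \<in> stable" "z \<odot> s - H s = x"
  shows "R z x = s"
  unfolding R_def
proof (rule the_equality)
  fix t assume t: "t \<in> stable \<and> z \<odot> t - H t = x"
  have "z \<odot> (t - s) - H (t - s) = 0"
  proof -
    have "t \<in> X" "s \<in> X" using t assms by simp_all
    then have "z \<odot> (t - s) - H (t - s) = (z \<odot> t - H t) - (z \<odot> s - H s)"
      by (simp add: scale_right_diff_distrib H_diff)
    also have "z \<odot> t - H t = z \<odot> s - H s" using t assms(4) by simp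
    finally show ?thesis by (simp only: diff_self)
  qed
  then have "H (t - s) = z \<odot> (t - s)" by (simp only: right_minus_eq)
  then have "t - s = 0" by (rule resolvent_unique[OF assms(1) _ _ assms(2), rotated]) (use t assms in simp)
  then show "t = s" by simp
qed (use assms in blast)

lemma R_works:
  assumes "stable_decay \<rho> B" "\<rho> < cmod z" "x \<in> stable"
  shows "R z x \<in> stable" "z \<odot> R z x - H (R z x) = x" "N (R z x) \<le> B / (cmod z - \<rho>) * N x"
proof -
  obtain s where s: "s \<in> stable" "z \<odot> s - H s = x" "N s \<le> B / (cmod z - \<rho>) * N x"
    using resolvent_exists[OF assms(1,3,2)] by blast
  have "R z x = s" by (rule R_eqI[OF assms(1,2) s(1,2)])
  then show "R z x \<in> stable" "z \<odot> R z x - H (R z x) = x" "N (R z x) \<le> B / (cmod z - \<rho>) * N x"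
    using s by simp_all
qed

section \<open>Bounded operators\<close>

text \<open>The body has the same shape as that of \<open>bounded_operator\<close>, so that the two
  notions agree literally once the locale is instantiated with BV.\<close>

definition bounded_op :: "('a \<Rightarrow> 'a) \<Rightarrow> bool" where
  "bounded_op A \<longleftrightarrow> (\<forall>x\<in>X. A x \<in> X) \<and> (\<forall>x\<in>X. \<forall>y\<in>X. A (x + y) = A x + A y) \<and>
     (\<forall>c. \<forall>x\<in>X. A (c \<odot> x) = c \<odot> A x) \<and> (\<exists>C. \<forall>x\<in>X. N (A x) \<le> C * N x)"

lemma bounded_opI:
  assumes "\<And>x. x \<in> X \<Longrightarrow> A x \<in> X" "\<And>x y. x \<in> X \<Longrightarrow> y \<in> X \<Longrightarrow> A (x + y) = A x + A y"
    "\<And>c x. x \<in> X \<Longrightarrow> A (c \<odot> x) = c \<odot> A x" "\<And>x. x \<in> X \<Longrightarrow> N (A x) \<le> C * N x"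
  shows "bounded_op A"
  unfolding bounded_op_def by (intro conjI ballI allI exI[of _ C] assms)

lemma bounded_opD:
  assumes "bounded_op A"
  shows "x \<in> X \<Longrightarrow> A x \<in> X" "x \<in> X \<Longrightarrow> y \<in> X \<Longrightarrow> A (x + y) = A x + A y"
    "x \<in> X \<Longrightarrow> A (c \<odot> x) = c \<odot> A x"
  using assms unfolding bounded_op_def by simp_all

lemma bounded_op_bound: "bounded_op A \<Longrightarrow> \<exists>C\<ge>0. \<forall>x\<in>X. N (A x) \<le> C * N x"
proof -
  assume "bounded_op A"
  then obtain C where C: "\<And>x. x \<in> X \<Longrightarrow> N (A x) \<le> C * N x" unfolding bounded_op_def by blast
  have "N (A x) \<le> max 0 C * N x" if "x \<in> X" for x
    using C[OF that] mult_right_mono[OF max.cobounded2[of C 0] N_nonneg[OF that]] by linarith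
  then show ?thesis by (intro exI[of _ "max 0 C"]) auto
qed

lemma bounded_op_id: "bounded_op (\<lambda>x. x)"
  by (rule bounded_opI[where C = 1]) auto

lemma bounded_op_zero: "bounded_op (\<lambda>x. 0)"
  by (rule bounded_opI[where C = 0]) auto

lemma bounded_op_plus: assumes "bounded_op A" "bounded_op B" shows "bounded_op (\<lambda>x. A x + B x)"
proof -
  obtain a where a: "\<And>x. x \<in> X \<Longrightarrow> N (A x) \<le> a * N x" using bounded_op_bound[OF assms(1)] by blast
  obtain b where b: "\<And>x. x \<in> X \<Longrightarrow> N (B x) \<le> b * N x" using bounded_op_bound[OF assms(2)] by blast
  have "N (A x + B x) \<le> (a + b) * N x" if "x \<in> X" for x
    using N_add[OF bounded_opD(1)[OF assms(1) that] bounded_opD(1)[OF assms(2) that]] a[OF that] b[OF that]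
    unfolding distrib_right by linarith
  then show ?thesis
    by (intro bounded_opI[where C = "a + b"]) (auto simp: bounded_opD[OF assms(1)] bounded_opD[OF assms(2)] scale_right_distrib)
qed

lemma bounded_op_scale: assumes "bounded_op A" shows "bounded_op (\<lambda>x. c \<odot> A x)"
proof -
  obtain a where a: "\<And>x. x \<in> X \<Longrightarrow> N (A x) \<le> a * N x" using bounded_op_bound[OF assms] by blast
  have "N (c \<odot> A x) \<le> (cmod c * a) * N x" if "x \<in> X" for x
    using mult_left_mono[OF a[OF that], of "cmod c"] bounded_opD(1)[OF assms that] by (simp add: N_scale mult_ac)
  then show ?thesis
    by (intro bounded_opI[where C = "cmod c * a"]) (auto simp: bounded_opD[OF assms] scale_right_distrib mult.commute)
qed

lemma bounded_op_diff: "bounded_op A \<Longrightarrow> bounded_op B \<Longrightarrow> bounded_op (\<lambda>x. A x - B x)"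
  using bounded_op_plus[OF _ bounded_op_scale, of A B "-1"] by simp

lemma bounded_op_sum: "(\<And>i. i \<in> I \<Longrightarrow> bounded_op (A i)) \<Longrightarrow> bounded_op (\<lambda>x. \<Sum>i\<in>I. A i x)"
  by (induction I rule: infinite_finite_induct) (auto intro!: bounded_op_zero bounded_op_plus)

lemma bounded_op_comp: assumes "bounded_op A" "bounded_op B" shows "bounded_op (\<lambda>x. A (B x))"
proof -
  obtain a where a: "0 \<le> a" "\<And>x. x \<in> X \<Longrightarrow> N (A x) \<le> a * N x"
    using bounded_op_bound[OF assms(1)] by blast
  obtain b where b: "\<And>x. x \<in> X \<Longrightarrow> N (B x) \<le> b * N x" using bounded_op_bound[OF assms(2)] by blast
  have "N (A (B x)) \<le> (a * b) * N x" if "x \<in> X" for x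
    using a(2)[OF bounded_opD(1)[OF assms(2) that]] mult_left_mono[OF b[OF that] a(1)] by (simp add: mult.assoc)
  then show ?thesis
    by (intro bounded_opI[where C = "a * b"]) (auto simp: bounded_opD[OF assms(1)] bounded_opD[OF assms(2)])
qed

lemma bounded_op_H: "bounded_op H"
  unfolding bounded_op_def using H_bound by (simp add: H_add H_scale)

lemma bounded_op_Hp: "bounded_op (Hp n)"
proof (induction n)
  case (Suc n) show ?case using bounded_op_comp[OF bounded_op_H Suc] by (simp add: o_def)
qed (use bounded_op_id in \<open>simp add: id_def\<close>)

lemma bounded_op_poly_apply: "bounded_op (poly_apply q)"
proof -
  have "bounded_op (\<lambda>x. \<Sum>i\<le>degree q. poly.coeff q i \<odot> Hp i x)" by (intro bounded_op_sum bounded_op_scale bounded_op_Hp)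
  then show ?thesis by (simp add: poly_apply_def[abs_def])
qed

text \<open>\<open>R z\<close> is controlled on \<open>stable\<close> only and thus becomes an
  operator on \<open>X\<close> after an operator with values in \<open>stable\<close>.\<close>

lemma bounded_op_R_comp:
  assumes dec: "stable_decay \<rho> B" and z: "\<rho> < cmod z" and A: "bounded_op A" "\<And>x. x \<in> X \<Longrightarrow> A x \<in> stable"
  shows "bounded_op (\<lambda>x. R z (A x))"
proof -
  note Rw = R_works[OF dec z]
  obtain a where a: "0 \<le> a" "\<And>x. x \<in> X \<Longrightarrow> N (A x) \<le> a * N x" using bounded_op_bound[OF A(1)] by blast
  have pos: "0 \<le> B / (cmod z - \<rho>)" using dec z by (simp add: stable_decay_def)
  show ?thesis
  proof (rule bounded_opI[where C = "B / (cmod z - \<rho>) * a"])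
    fix x y assume xy: "x \<in> X" "y \<in> X"
    show "R z (A x) \<in> X" using Rw(1)[OF A(2)[OF xy(1)]] by simp
    show "R z (A (x + y)) = R z (A x) + R z (A y)"
    proof (rule R_eqI[OF dec z])
      have "z \<odot> (R z (A x) + R z (A y)) - H (R z (A x) + R z (A y)) =
          (z \<odot> R z (A x) - H (R z (A x))) + (z \<odot> R z (A y) - H (R z (A y)))"
        using Rw(1)[OF A(2)] xy by (simp add: H_add scale_right_distrib)
      then show "z \<odot> (R z (A x) + R z (A y)) - H (R z (A x) + R z (A y)) = A (x + y)"
        using Rw(2)[OF A(2)] xy by (simp add: bounded_opD[OF A(1)])
    qed (use Rw(1)[OF A(2)] xy in simp)
    have "N (R z (A x)) \<le> B / (cmod z - \<rho>) * N (A x)" using xy by (intro Rw A)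
    also have "\<dots> \<le> B / (cmod z - \<rho>) * (a * N x)" using a xy pos by (intro mult_left_mono) auto
    finally show "N (R z (A x)) \<le> B / (cmod z - \<rho>) * a * N x" by (simp add: mult.assoc)
  next
    fix c x assume x: "x \<in> X"
    show "R z (A (c \<odot> x)) = c \<odot> R z (A x)"
    proof (rule R_eqI[OF dec z])
      have "z \<odot> (c \<odot> R z (A x)) - H (c \<odot> R z (A x)) = c \<odot> (z \<odot> R z (A x) - H (R z (A x)))"
        using Rw(1)[OF A(2)] x by (simp add: H_scale scale_right_diff_distrib mult.commute)
      then show "z \<odot> (c \<odot> R z (A x)) - H (c \<odot> R z (A x)) = A (c \<odot> x)"
        using Rw(2)[OF A(2)] x by (simp add: bounded_opD[OF A(1)])
    qed (use Rw(1)[OF A(2)] x in simp)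
  qed
qed

section \<open>Spectral projections\<close>

text \<open>The interpolation polynomial that is 1 at \<open>c\<close> and 0 on the rest of
  \<open>\<Lambda>\<close>. If the product of the factors \<open>H - d\<close> over
  \<open>\<Lambda>\<close> maps into \<open>stable\<close>, its value at \<open>H\<close> is the
  projection to the eigenvalue \<open>c\<close> modulo \<open>stable\<close>.\<close>

definition Lagrange_poly :: "complex set \<Rightarrow> complex \<Rightarrow> complex poly" where
  "Lagrange_poly \<Lambda> c = smult (1 / (\<Prod>d\<in>\<Lambda> - {c}. c - d)) (\<Prod>d\<in>\<Lambda> - {c}. [:- d, 1:])"

lemma poly_Lagrange:
  assumes "finite \<Lambda>" "c \<in> \<Lambda>" "d \<in> \<Lambda>"
  shows "poly (Lagrange_poly \<Lambda> c) d = (if c = d then 1 else 0)"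
  using assms by (auto simp: Lagrange_poly_def poly_prod prod_zero_iff)

text \<open>Both sides have degree below \<open>card \<Lambda>\<close> and agree on
  \<open>\<Lambda>\<close>.\<close>

lemma sum_Lagrange: "finite \<Lambda> \<Longrightarrow> \<Lambda> \<noteq> {} \<Longrightarrow> (\<Sum>c\<in>\<Lambda>. Lagrange_poly \<Lambda> c) = 1"
proof (rule poly_eqI_degree[where A = \<Lambda>])
  assume L: "finite \<Lambda>" "\<Lambda> \<noteq> {}"
  then have card: "card \<Lambda> > 0" by (simp add: card_gt_0_iff)
  show "poly (\<Sum>c\<in>\<Lambda>. Lagrange_poly \<Lambda> c) d = poly 1 d" if "d \<in> \<Lambda>" for d
    using L that by (simp add: poly_sum poly_Lagrange)
  have "degree (Lagrange_poly \<Lambda> c) < card \<Lambda>" if "c \<in> \<Lambda>" for c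
  proof -
    have "degree (Lagrange_poly \<Lambda> c) \<le> degree (\<Prod>d\<in>\<Lambda> - {c}. [:- d, 1:])"
      unfolding Lagrange_poly_def by (rule degree_smult_le)
    also have "\<dots> \<le> (\<Sum>d\<in>\<Lambda> - {c}. 1)"
      using L degree_prod_sum_le[of "\<Lambda> - {c}" "\<lambda>d. [:- d, 1:]"] by (simp add: o_def)
    also have "\<dots> < card \<Lambda>" using L that card by simp
    finally show ?thesis .
  qed
  then show "degree (\<Sum>c\<in>\<Lambda>. Lagrange_poly \<Lambda> c) < card \<Lambda>"
    using card L by (intro degree_sum_less) auto
  show "degree 1 < card \<Lambda>" using card by simp
qed

text \<open>The projections modulo \<open>stable\<close> are corrected to true projections, and
  \<open>V\<close> is \<open>H\<close> on the remaining part. The spectral bound for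
  \<open>V\<close> is given as existence of resolvents outside a disc of radius
  \<open>r < 1\<close>.\<close>

theorem spectral_decomposition:
  defines "G \<equiv> {z. cmod z = 1 \<and> (\<exists>x\<in>X. x \<noteq> 0 \<and> H x = z \<odot> x)}"
  shows "finite G"
    and "\<forall>z\<in>G. \<exists>Z. finite Z \<and> Z \<subseteq> {x\<in>X. H x = z \<odot> x} \<and> span Z = {x\<in>X. H x = z \<odot> x}"
    and "\<exists>U V r. r < 1 \<and> (\<forall>z\<in>G. bounded_op (U z)) \<and> bounded_op V \<and>
       (\<forall>n\<ge>1. \<forall>x\<in>X. Hp n x = (\<Sum>z\<in>G. z ^ n \<odot> U z x) + (V ^^ n) x) \<and>
       (\<forall>z\<in>G. \<forall>x\<in>X. U z (U z x) = U z x) \<and>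
       (\<forall>z\<in>G. \<forall>y\<in>G. y \<noteq> z \<longrightarrow> (\<forall>x\<in>X. U z (U y x) = 0)) \<and>
       (\<forall>z\<in>G. \<forall>x\<in>X. U z (V x) = 0 \<and> V (U z x) = 0) \<and>
       (\<forall>z\<in>G. U z ` X = {x\<in>X. H x = z \<odot> x}) \<and>
       (\<forall>z. r < cmod z \<longrightarrow> (\<exists>S. bounded_op S \<and> (\<forall>x\<in>X. S (z \<odot> x - V x) = x \<and> z \<odot> S x - V (S x) = x)))"
proof -
  obtain q where q: "q \<noteq> 0" "\<And>x. x \<in> X \<Longrightarrow> poly_apply q x \<in> stable" using annihilating_poly by blast
  have "H ` X \<subseteq> X" by auto
  from annihilating_unimodular[OF q(1) order.refl this q(2)]
  obtain \<Lambda> where L: "finite \<Lambda>" "\<And>c. c \<in> \<Lambda> \<Longrightarrow> cmod c = 1"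
    "\<And>x. x \<in> X \<Longrightarrow> poly_apply (\<Prod>c\<in>\<Lambda>. [:- c, 1:]) x \<in> stable" by blast
  obtain \<rho> B where dec: "stable_decay \<rho> B" using stable_decay_exists by blast
  then have rho: "0 < \<rho>" "\<rho> < 1" by (auto simp: stable_decay_def)
  define E where "E z = {x\<in>X. H x = z \<odot> x}" for z
  define l where "l = Lagrange_poly \<Lambda>"
  \<comment> \<open>\<open>D c x\<close> is the defect of \<open>poly_apply (l c) x\<close> as an
    eigenvector; it lies in \<open>stable\<close>. For \<open>s = R c (D c x)\<close> one has
    \<open>(H - c) s = - D c x\<close>, so adding \<open>s\<close> makes an exact
    eigenvector.\<close>
  define D where "D c x = H (poly_apply (l c) x) - c \<odot> poly_apply (l c) x" for c x
  define U where "U c x = poly_apply (l c) x + R c (D c x)" for c x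
  \<comment> \<open>Unimodular eigenvectors are determined modulo \<open>stable\<close>; identities
    between them need only be checked there.\<close>
  have E_stable: "x = 0" if "x \<in> E c" "x \<in> stable" "cmod c = 1" for x c
    using resolvent_unique[OF dec that(2), of c] that rho by (simp add: E_def)
  have GL: "G \<subseteq> \<Lambda>"
  proof
    fix z assume "z \<in> G"
    then obtain x where x: "x \<in> X" "x \<noteq> 0" "H x = z \<odot> x" "cmod z = 1" by (auto simp: G_def)
    let ?P = "\<Prod>c\<in>\<Lambda>. [:- c, 1:]"
    have "poly ?P z \<odot> x \<in> stable" using L(3)[OF x(1)] x by (simp add: poly_apply_eigenvector)
    moreover have "poly ?P z \<odot> x \<in> E z" using x by (simp add: E_def H_scale mult.commute)
    ultimately have "poly ?P z \<odot> x = 0" using E_stable x by blast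
    then have "poly ?P z = 0" using x by simp
    then show "z \<in> \<Lambda>" using L(1) by (auto simp: poly_prod)
  qed
  show "finite G" using finite_subset[OF GL L(1)] .
  have D_stable: "D c x \<in> stable" if "c \<in> \<Lambda>" "x \<in> X" for c x
  proof -
    have "D c x = poly_apply ([:- c, 1:] * l c) x" using that by (simp only: poly_apply_mult D_def poly_apply_linear_factor poly_apply_X)
    also have "[:- c, 1:] * l c = smult (1 / (\<Prod>d\<in>\<Lambda> - {c}. c - d)) (\<Prod>c\<in>\<Lambda>. [:- c, 1:])"
      using that L(1) by (subst prod.remove[of \<Lambda> c]) (auto simp: l_def Lagrange_poly_def)
    also have "poly_apply \<dots> x \<in> stable" unfolding poly_apply_smult using L(3)[OF that(2)] by (rule stable_closed)
    finally show ?thesis .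
  qed
  have norm_c: "\<rho> < cmod c" if "c \<in> \<Lambda>" for c using L(2)[OF that] rho by simp
  have bounded_op_D: "bounded_op (D c)" for c
    unfolding D_def by (intro bounded_op_diff bounded_op_scale bounded_op_comp[OF bounded_op_H] bounded_op_poly_apply)
  have bounded_op_U: "bounded_op (U c)" if "c \<in> \<Lambda>" for c
    unfolding U_def using that by (intro bounded_op_plus bounded_op_poly_apply bounded_op_R_comp[OF dec norm_c] bounded_op_D D_stable)
  note Rw = R_works[OF dec norm_c D_stable]
  have U_E: "U c x \<in> E c" if c: "c \<in> \<Lambda>" and x: "x \<in> X" for c x
  proof -
    have "H (U c x) = H (poly_apply (l c) x) + H (R c (D c x))"
      using x Rw(1)[OF c c x] by (simp add: U_def H_add)
    also have "H (R c (D c x)) = c \<odot> R c (D c x) - D c x" using Rw(2)[OF c c x] by (simp add: algebra_simps)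
    finally have "H (U c x) = c \<odot> U c x" by (simp add: U_def D_def scale_right_distrib)
    then show ?thesis using bounded_opD(1)[OF bounded_op_U[OF c] x] by (simp add: E_def)
  qed
  have U_X: "U c x \<in> X" if "c \<in> \<Lambda>" "x \<in> X" for c x using U_E[OF that] by (simp add: E_def)
  have U_poly_apply: "U c x - poly_apply (l c) x \<in> stable" if "c \<in> \<Lambda>" "x \<in> X" for c x
    using Rw(1)[OF that(1) that] by (simp add: U_def)
  have U_stable: "U c x = 0" if "c \<in> \<Lambda>" "x \<in> stable" for c x
  proof (rule E_stable)
    show "U c x \<in> E c" using U_E that by simp
    have "(U c x - poly_apply (l c) x) + poly_apply (l c) x \<in> stable" 
      using U_poly_apply[OF that(1) stable_X[OF that(2)]] poly_apply_stable[OF that(2)] by (rule stable_closed(2))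
    then show "U c x \<in> stable" by simp
  qed (use L that in auto)
  have U_on_E: "U c x = (if c = d then x else 0)" if "c \<in> \<Lambda>" "d \<in> \<Lambda>" "x \<in> E d" for c d x
  proof -
    have x: "x \<in> X" "H x = d \<odot> x" using that by (auto simp: E_def)
    have poly_apply: "poly_apply (l c) x = (if c = d then x else 0)"
      using that L(1) by (simp add: poly_apply_eigenvector[OF x] poly_Lagrange l_def)
    then have "D c x = 0" using x by (simp add: D_def)
    then have "R c (D c x) = 0" using R_eqI[OF dec norm_c[OF that(1)], of 0] by simp
    then show ?thesis by (simp add: U_def poly_apply)
  qed
  \<comment> \<open>The complementary projection: it is the identity on \<open>stable\<close>, has
    values in \<open>stable\<close> and vanishes on the eigenspaces.\<close>
  define Q where "Q x = x - (\<Sum>c\<in>\<Lambda>. U c x)" for x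
  have bounded_op_Q: "bounded_op Q" unfolding Q_def by (intro bounded_op_diff bounded_op_id bounded_op_sum bounded_op_U)
  have Q_stable: "Q x \<in> stable" if x: "x \<in> X" for x
  \<comment> \<open>For empty \<open>\<Lambda>\<close> the interpolation polynomials sum to 0
    instead of 1, but the empty product then says that all of \<open>X\<close> is stable.\<close>
  proof (cases "\<Lambda> = {}")
    case True
    then show ?thesis using L(3)[OF x] x by (simp add: Q_def)
  next
    case False
    have "(\<Sum>c\<in>\<Lambda>. poly_apply (l c) x) = poly_apply 1 x"
      unfolding l_def poly_apply_sum_poly[symmetric] sum_Lagrange[OF L(1) False] ..
    then have "Q x = - (\<Sum>c\<in>\<Lambda>. U c x - poly_apply (l c) x)" using x by (simp add: Q_def sum_subtractf)
    also have "\<dots> \<in> stable" by (rule stable_closed(5), rule stable_closed(6), rule U_poly_apply[OF _ x])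
    finally show ?thesis .
  qed
  have Q_id: "Q x = x" if "x \<in> stable" for x using U_stable that by (simp add: Q_def)
  have Q_E: "Q x = 0" if "c \<in> \<Lambda>" "x \<in> E c" for c x
    using U_on_E[OF _ that] L(1) that by (simp add: Q_def)
  define V where "V x = H (Q x)" for x
  have bounded_op_V: "bounded_op V" unfolding V_def by (rule bounded_op_comp[OF bounded_op_H bounded_op_Q])
  have V_stable: "V x \<in> stable" if "x \<in> X" for x using Q_stable[OF that] by (simp add: V_def)
  \<comment> \<open>Only positive powers are covered: \<open>V ^^ 0\<close> is the identity and not
    \<open>Q\<close>, which is why the decomposition starts at \<open>n = 1\<close>.\<close>
  have Vn: "(V ^^ Suc n) x = Hp (Suc n) (Q x)" if x: "x \<in> X" for n x
  proof (induction n)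
    case (Suc n)
    have "(V ^^ Suc (Suc n)) x = V (Hp (Suc n) (Q x))" using Suc by simp
    also have "\<dots> = H (Hp (Suc n) (Q x))"
      using Q_stable[OF x] unfolding V_def by (subst Q_id) (auto simp del: funpow.simps)
    finally show ?case by simp
  qed (simp add: V_def)
  have Hn_E: "Hp n x = c ^ n \<odot> x" if "x \<in> E c" for n c x
    by (induction n) (use that in \<open>simp_all add: E_def H_scale mult.commute\<close>)
  \<comment> \<open>\<open>\<Lambda>\<close> may contain numbers that are not eigenvalues; their
    \<open>U c\<close> vanish because the values are eigenvectors.\<close>
  have sum_LG: "(\<Sum>c\<in>\<Lambda>. c ^ n \<odot> U c x) = (\<Sum>c\<in>G. c ^ n \<odot> U c x)" if x: "x \<in> X" for n x
  proof (rule sum.mono_neutral_right[OF L(1) GL], rule ballI)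
    fix c assume c: "c \<in> \<Lambda> - G"
    then have "U c x = 0" using U_E[of c x] x L(2)[of c] by (auto simp: G_def E_def)
    then show "c ^ n \<odot> U c x = 0" by simp
  qed
  have dec_eq: "Hp n x = (\<Sum>z\<in>G. z ^ n \<odot> U z x) + (V ^^ n) x" if n: "n \<ge> 1" and x: "x \<in> X" for n x
  proof -
    obtain m where m: "n = Suc m" using n by (cases n) auto
    have "Hp n x = Hp n (Q x + (\<Sum>c\<in>\<Lambda>. U c x))" by (simp add: Q_def)
    also have "\<dots> = Hp n (Q x) + (\<Sum>c\<in>\<Lambda>. Hp n (U c x))"
      using x Q_stable[OF x] U_X by (simp add: Hp_add Hp_sum del: funpow.simps)
    also have "(\<Sum>c\<in>\<Lambda>. Hp n (U c x)) = (\<Sum>c\<in>\<Lambda>. c ^ n \<odot> U c x)"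
      using Hn_E U_E x by (intro sum.cong) auto
    finally show ?thesis
      unfolding sum_LG[OF x] Vn[OF x, of m, folded m] by (simp only: add.commute)
  qed
  have image_U: "U c ` X = E c" if "c \<in> \<Lambda>" for c
  proof
    show "U c ` X \<subseteq> E c" using U_E that by auto
    show "E c \<subseteq> U c ` X"
    proof
      fix x assume "x \<in> E c"
      then have "U c x = x" "x \<in> X" using U_on_E[OF that that] by (auto simp: E_def)
      then show "x \<in> U c ` X" by (metis imageI)
    qed
  qed
  have resolvent: "\<exists>S. bounded_op S \<and> (\<forall>x\<in>X. S (z \<odot> x - V x) = x \<and> z \<odot> S x - V (S x) = x)"
    if z: "\<rho> < cmod z" for z
  proof -
    have z0: "z \<noteq> 0" using z rho by auto
    \<comment> \<open>\<open>V\<close> vanishes on the range of \<open>x \<mapsto> x - Q x\<close>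
      and equals \<open>H\<close> on \<open>stable\<close>, so its resolvent is assembled from
      \<open>1 / z\<close> and \<open>R z\<close>.\<close>
    define S where "S x = (1 / z) \<odot> (x - Q x) + R z (Q x)" for x
    note Rz = R_works[OF dec z Q_stable]
    have "bounded_op S" unfolding S_def
      by (intro bounded_op_plus bounded_op_scale bounded_op_diff bounded_op_id bounded_op_Q bounded_op_R_comp[OF dec z] Q_stable)
    moreover have "S (z \<odot> x - V x) = x" if x: "x \<in> X" for x
    proof -
      have QX: "Q x \<in> X" "V x \<in> X" using Q_stable[OF x] V_stable[OF x] by simp_all
      have "Q (z \<odot> x + (- 1) \<odot> V x) = z \<odot> Q x + (- 1) \<odot> Q (V x)"
        using x QX by (simp only: bounded_opD[OF bounded_op_Q] X_closed)
      then have Qz: "Q (z \<odot> x - V x) = z \<odot> Q x - V x" using Q_id[OF V_stable[OF x]] by simp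
      have "R z (z \<odot> Q x - V x) = Q x" using Q_stable[OF x] by (intro R_eqI[OF dec z]) (simp_all add: V_def)
      then show ?thesis unfolding S_def Qz using z0
        by (simp add: scale_right_diff_distrib)
    qed
    moreover have "z \<odot> S x - V (S x) = x" if x: "x \<in> X" for x
    proof -
      have Qx: "Q x \<in> stable" "x - Q x \<in> X" "R z (Q x) \<in> stable" using Q_stable[OF x] Rz(1)[OF x] x by simp_all
      have "Q (x + (- 1) \<odot> Q x) = Q x + (- 1) \<odot> Q (Q x)"
        using x Qx(1) by (simp only: bounded_opD[OF bounded_op_Q] X_closed stable_X)
      then have "Q (x - Q x) = 0" using Q_id[OF Qx(1)] by simp
      then have "Q (S x) = R z (Q x)"
        unfolding S_def using Qx Q_id[OF Qx(3)] by (simp add: bounded_opD[OF bounded_op_Q])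
      then have "z \<odot> S x - V (S x) = z \<odot> S x - H (R z (Q x))" by (simp add: V_def)
      also have "\<dots> = (x - Q x) + (z \<odot> R z (Q x) - H (R z (Q x)))"
        using z0 by (simp add: S_def scale_right_distrib)
      finally show ?thesis using Rz(2)[OF x] by simp
    qed
    ultimately show ?thesis by blast
  qed
  show "\<exists>U V r. r < 1 \<and> (\<forall>z\<in>G. bounded_op (U z)) \<and> bounded_op V \<and>
       (\<forall>n\<ge>1. \<forall>x\<in>X. Hp n x = (\<Sum>z\<in>G. z ^ n \<odot> U z x) + (V ^^ n) x) \<and>
       (\<forall>z\<in>G. \<forall>x\<in>X. U z (U z x) = U z x) \<and>
       (\<forall>z\<in>G. \<forall>y\<in>G. y \<noteq> z \<longrightarrow> (\<forall>x\<in>X. U z (U y x) = 0)) \<and>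
       (\<forall>z\<in>G. \<forall>x\<in>X. U z (V x) = 0 \<and> V (U z x) = 0) \<and>
       (\<forall>z\<in>G. U z ` X = {x\<in>X. H x = z \<odot> x}) \<and>
       (\<forall>z. r < cmod z \<longrightarrow> (\<exists>S. bounded_op S \<and> (\<forall>x\<in>X. S (z \<odot> x - V x) = x \<and> z \<odot> S x - V (S x) = x)))"
  proof (rule exI[of _ U], rule exI[of _ V], rule exI[of _ \<rho>], intro conjI ballI allI impI)
    show "\<rho> < 1" by (rule rho)
    show "bounded_op V" by (rule bounded_op_V)
    fix z assume z: "z \<in> G"
    then have zL: "z \<in> \<Lambda>" using GL by auto
    show "bounded_op (U z)" using bounded_op_U[OF zL] .
    show "U z ` X = {x \<in> X. H x = z \<odot> x}" using image_U[OF zL] by (simp add: E_def)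
    fix x assume x: "x \<in> X"
    show "U z (U z x) = U z x" using U_on_E[OF zL zL U_E[OF zL x]] by simp
    show "U z (V x) = 0" by (rule U_stable[OF zL V_stable[OF x]])
    show "V (U z x) = 0" using Q_E[OF zL U_E[OF zL x]] by (simp add: V_def)
  next
    fix z y x assume "z \<in> G" "y \<in> G" "y \<noteq> z" "x \<in> X"
    then show "U z (U y x) = 0" using U_on_E[of z y "U y x"] U_E[of y x] GL by auto
  next
    fix n :: nat and x assume "1 \<le> n" "x \<in> X"
    then show "Hp n x = (\<Sum>z\<in>G. z ^ n \<odot> U z x) + (V ^^ n) x" by (rule dec_eq)
  next
    fix z assume "\<rho> < cmod z"
    then show "\<exists>S. bounded_op S \<and> (\<forall>x\<in>X. S (z \<odot> x - V x) = x \<and> z \<odot> S x - V (S x) = x)"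
      by (rule resolvent)
  qed
  show "\<forall>z\<in>G. \<exists>Z. finite Z \<and> Z \<subseteq> {x\<in>X. H x = z \<odot> x} \<and> span Z = {x\<in>X. H x = z \<odot> x}"
  proof
    fix z assume "z \<in> G"
    then have z: "z \<in> \<Lambda>" using GL by auto
    obtain Z where Z: "finite Z" "Z \<subseteq> X" "\<And>x. x \<in> X \<Longrightarrow> \<exists>y\<in>span Z. x - y \<in> stable"
      using finite_codim by blast
    have sE: "subspace (E z)"
      by (rule subspaceI) (auto simp: E_def H_add H_scale scale_right_distrib mult.commute)
    have sub: "U z ` Z \<subseteq> E z" using U_E[OF z] Z(2) by auto
    \<comment> \<open>\<open>U z\<close> kills \<open>stable\<close> and is the identity on
      \<open>E z\<close>; hence \<open>E z\<close> is already the image of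
      \<open>span Z\<close>.\<close>
    have "{y\<in>X. U z y \<in> span (U z ` Z)} \<supseteq> span Z"
    proof (rule span_minimal)
      show "Z \<subseteq> {y \<in> X. U z y \<in> span (U z ` Z)}" using Z(2) by (auto intro: span_base)
      have "U z 0 = 0" using bounded_opD(3)[OF bounded_op_U[OF z], of 0 0] by simp
      then show "subspace {y \<in> X. U z y \<in> span (U z ` Z)}"
        by (intro subspaceI) (auto simp: bounded_opD[OF bounded_op_U[OF z]] intro: span_add span_scale span_zero)
    qed
    note sp = this
    have "E z \<subseteq> span (U z ` Z)"
    proof
      fix x assume x: "x \<in> E z"
      then have xX: "x \<in> X" by (simp add: E_def)
      obtain y where y: "y \<in> span Z" "x - y \<in> stable" using Z(3)[OF xX] by blast
      then have yX: "y \<in> X" "U z y \<in> span (U z ` Z)" using sp by auto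
      have "U z ((x - y) + y) = U z (x - y) + U z y"
        using yX xX by (intro bounded_opD(2)[OF bounded_op_U[OF z]]) simp_all
      then have "U z x = U z y" using U_stable[OF z y(2)] by simp
      moreover have "U z x = x" using U_on_E[OF z z x] by simp
      ultimately show "x \<in> span (U z ` Z)" using yX by simp
    qed
    then have "span (U z ` Z) = E z" using span_minimal[OF sub sE] by blast
    then show "\<exists>Z. finite Z \<and> Z \<subseteq> {x\<in>X. H x = z \<odot> x} \<and> span Z = {x\<in>X. H x = z \<odot> x}"
      using Z(1) sub unfolding E_def by blast
  qed
qed

end

section \<open>Functions of bounded variation on an interval\<close>

lemma rep_l1_rel: "l1_rel (rep_l1 u) (rep_l1 u)"
  by (rule Quotient3_rep_reflp[OF Quotient3_l1])

lemma integrable_rep_l1 [simp]: "integrable lborel (rep_l1 u)"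
  using rep_l1_rel[of u] by (simp add: l1_rel_def)

lemma borel_rep_l1 [measurable]: "rep_l1 u \<in> borel_measurable borel"
  using borel_measurable_integrable[OF integrable_rep_l1[of u]] by simp

lemma rep_abs_l1: "integrable lborel f \<Longrightarrow> AE x in lborel. rep_l1 (abs_l1 f) x = f x"
  using Quotient3_rep_abs[OF Quotient3_l1, of f] by (simp add: l1_rel_def)

lemma l1_eqI: "AE x in lborel. rep_l1 u x = rep_l1 v x \<Longrightarrow> u = v"
  using Quotient3_rel_rep[OF Quotient3_l1, of u v] by (simp add: l1_rel_def)

lemma rep_plus_l1: "AE x in lborel. rep_l1 (u + v) x = rep_l1 u x + rep_l1 v x"
  unfolding plus_l1_def by (simp add: rep_abs_l1)

lemma rep_minus_l1: "AE x in lborel. rep_l1 (u - v) x = rep_l1 u x - rep_l1 v x"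
  unfolding minus_l1_def by (simp add: rep_abs_l1)

lemma rep_scale_l1: "AE x in lborel. rep_l1 (k *\<^sub>C u) x = k * rep_l1 u x"
  unfolding scale_l1_def by (simp add: rep_abs_l1)

lemma rep_zero_l1: "AE x in lborel. rep_l1 0 x = 0"
  unfolding zero_l1_def by (simp add: rep_abs_l1)

lemma rep_sum_l1: "AE x in lborel. rep_l1 (\<Sum>i\<in>I. u i) x = (\<Sum>i\<in>I. rep_l1 (u i) x)"
proof (induction I rule: infinite_finite_induct)
  case (insert i I)
  show ?case using insert.IH rep_plus_l1[of "u i" "\<Sum>i\<in>I. u i"]
    by eventually_elim (use insert.hyps in simp)
qed (simp_all add: rep_zero_l1)

lemma norm_l1_eq: "norm_l1 u = (LINT x|lborel. norm (rep_l1 u x))"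
  by (simp add: norm_l1_def)

lemma norm_l1_nonneg: "0 \<le> norm_l1 u"
  by (simp add: norm_l1_eq)

lemma norm_l1_add: "norm_l1 (u + v) \<le> norm_l1 u + norm_l1 v"
proof -
  have "norm_l1 (u + v) \<le> (LINT x|lborel. norm (rep_l1 u x) + norm (rep_l1 v x))"
    unfolding norm_l1_eq
  proof (rule integral_mono_AE)
    show "AE x in lborel. norm (rep_l1 (u + v) x) \<le> norm (rep_l1 u x) + norm (rep_l1 v x)"
      using rep_plus_l1[of u v] by eventually_elim (simp add: norm_triangle_ineq)
  qed auto
  then show ?thesis by (simp add: norm_l1_eq)
qed

lemma norm_l1_scale: "norm_l1 (k *\<^sub>C u) = cmod k * norm_l1 u"
proof -
  have "norm_l1 (k *\<^sub>C u) = (LINT x|lborel. cmod k * norm (rep_l1 u x))"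
    unfolding norm_l1_eq
  proof (rule integral_cong_AE)
    show "AE x in lborel. norm (rep_l1 (k *\<^sub>C u) x) = cmod k * norm (rep_l1 u x)"
      using rep_scale_l1[of k u] by eventually_elim (simp add: norm_mult)
  qed auto
  then show ?thesis by (simp add: norm_l1_eq)
qed

lemma norm_l1_eq_0: "norm_l1 u = 0 \<Longrightarrow> u = 0"
proof -
  assume "norm_l1 u = 0"
  then have "AE x in lborel. norm (rep_l1 u x) = 0"
    unfolding norm_l1_eq by (subst (asm) integral_nonneg_eq_0_iff_AE) auto
  with rep_zero_l1 have "AE x in lborel. rep_l1 u x = rep_l1 0 x" by eventually_elim simp
  then show ?thesis by (rule l1_eqI)
qed

section \<open>Variation and monotone dominating functions\<close>

text \<open>The sum inside \<open>variation\<close>, named so that it can be split off at either end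
  of the list.\<close>

definition list_variation :: "(real \<Rightarrow> complex) \<Rightarrow> real list \<Rightarrow> real" where
  "list_variation g xs = (\<Sum>i<length xs - 1. norm (g (xs ! Suc i) - g (xs ! i)))"

lemma list_variation_Cons:
  "list_variation g (x # y # zs) = norm (g y - g x) + list_variation g (y # zs)"
  by (simp add: list_variation_def sum.lessThan_Suc_shift del: sum.lessThan_Suc)

lemma list_variation_snoc:
  assumes "xs \<noteq> []"
  shows "list_variation g (xs @ [y]) = list_variation g xs + norm (g y - g (last xs))"
proof -
  obtain n where n: "length xs = Suc n" using assms by (cases xs) auto
  have "list_variation g (xs @ [y]) = (\<Sum>i<Suc n. norm (g ((xs @ [y]) ! Suc i) - g ((xs @ [y]) ! i)))"
    by (simp add: list_variation_def n)
  also have "\<dots> = (\<Sum>i<n. norm (g (xs ! Suc i) - g (xs ! i))) + norm (g y - g (xs ! n))"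
    by (simp add: n nth_append)
  also have "xs ! n = last xs" using assms n by (simp add: last_conv_nth)
  finally show ?thesis by (simp add: list_variation_def n)
qed

lemma interval_grid_cell:
  fixes t :: "nat \<Rightarrow> real"
  assumes "0 < k" "t 0 \<le> x" "x \<le> t k"
  shows "\<exists>i<k. t i \<le> x \<and> x \<le> t (Suc i)"
  using assms(1,3)
proof (induction k)
  case (Suc k)
  show ?case
  proof (cases "0 < k \<and> x \<le> t k")
    case True
    then show ?thesis using Suc.IH less_SucI by blast
  next
    case False
    then have "t k \<le> x" using assms(2) by (cases k) auto
    then show ?thesis using Suc.prems by blast
  qed
qed simp

locale interval =
  fixes a b :: real
  assumes a_less_b: "a < b"
begin

text \<open>\<open>dominated f V\<close> says that \<open>f\<close> has variation at most \<open>V b - V a\<close> on the open interval.\<close>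

definition dominated :: "(real \<Rightarrow> 'v::banach) \<Rightarrow> (real \<Rightarrow> real) \<Rightarrow> bool" where
  "dominated f V \<longleftrightarrow> mono_on {a..b} V \<and>
     (\<forall>x y. a < x \<and> x \<le> y \<and> y < b \<longrightarrow> norm (f y - f x) \<le> V y - V x)"

lemma dominated_mono: "dominated f V \<Longrightarrow> a \<le> x \<Longrightarrow> x \<le> y \<Longrightarrow> y \<le> b \<Longrightarrow> V x \<le> V y"
  unfolding dominated_def by (auto elim!: mono_onD)

lemma dominated_le: "dominated f V \<Longrightarrow> a < x \<Longrightarrow> x \<le> y \<Longrightarrow> y < b \<Longrightarrow> norm (f y - f x) \<le> V y - V x"
  unfolding dominated_def by blast

lemma dominated_osc:
  assumes "dominated f V" "x \<in> {u..v}" "y \<in> {u..v}" "a < x" "x < b" "a < y" "y < b" "a \<le> u" "v \<le> b"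
  shows "norm (f y - f x) \<le> V v - V u"
proof -
  have *: "norm (f y - f x) \<le> V v - V u"
    if "x \<in> {u..v}" "y \<in> {u..v}" "a < x" "x \<le> y" "y < b" for x y
    using dominated_le[OF assms(1), of x y] dominated_mono[OF assms(1), of u x]
      dominated_mono[OF assms(1), of y v] that assms(8,9) by simp
  show ?thesis
  proof (cases "x \<le> y")
    case True
    then show ?thesis using * assms by simp
  next
    case False
    then show ?thesis using *[of y x] assms by (simp add: norm_minus_commute)
  qed
qed

lemma dominated_bounded:
  assumes "dominated f V"
  shows "\<exists>s\<ge>0. \<forall>x. a < x \<and> x < b \<longrightarrow> norm (f x) \<le> s"
proof (intro exI conjI allI impI)
  let ?x = "(a + b) / 2"
  have V: "V a \<le> V b" using dominated_mono[OF assms, of a b] a_less_b by simp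
  then show "0 \<le> norm (f ?x) + (V b - V a)" by simp
  fix x assume x: "a < x \<and> x < b"
  then have "norm (f x - f ?x) \<le> V b - V a" using assms a_less_b by (intro dominated_osc) auto
  then show "norm (f x) \<le> norm (f ?x) + (V b - V a)" using norm_triangle_sub[of "f x" "f ?x"] by linarith
qed

text \<open>Integrate \<open>|f t| \<le> |f x| + (V v - V u)\<close> over \<open>x\<close> in
  \<open>{u..v}\<close>. This is the only way in which the L^1 norm enters pointwise
  estimates.\<close>

lemma average_bound:
  fixes f F :: "real \<Rightarrow> complex"
  assumes dom: "dominated f V" and F: "integrable lborel F"
    and fF: "AE x in lborel. x \<in> {a..b} \<longrightarrow> f x = F x"
    and uv: "a \<le> u" "u < v" "v \<le> b" and t: "t \<in> {u..v}" "a < t" "t < b"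
  shows "(v - u) * norm (f t) \<le> (v - u) * (V v - V u) + (LINT x|lborel. norm (F x))"
proof -
  let ?I = "\<lambda>k::real. LINT x|lborel. indicator {u..v} x * k"
  have I: "?I k = (v - u) * k" for k using uv by simp
  have int: "integrable lborel (\<lambda>x. indicator {u..v} x * k)" for k :: real
    by (intro integrable_mult_left integrable_real_indicator) (auto simp: emeasure_lborel_Icc_eq)
  have "?I (norm (f t)) \<le> (LINT x|lborel. indicator {u..v} x * (V v - V u) + norm (F x))"
  proof (rule integral_mono_AE)
    show "AE x in lborel. indicator {u..v} x * norm (f t) \<le> indicator {u..v} x * (V v - V u) + norm (F x)"
      using fF AE_lborel_singleton[of a] AE_lborel_singleton[of b]
    proof eventually_elim
      case (elim x)
      show ?case
      proof (cases "x \<in> {u..v}")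
        case True
        then have "norm (f t - f x) \<le> V v - V u" using dominated_osc[OF dom True t(1)] elim uv t by simp
        then have "norm (f t) \<le> V v - V u + norm (F x)"
          using norm_triangle_sub[of "f t" "f x"] elim True uv by simp
        then show ?thesis using True by simp
      qed simp
    qed
  qed (intro int Bochner_Integration.integrable_add integrable_norm F)+
  also have "\<dots> = ?I (V v - V u) + (LINT x|lborel. norm (F x))"
    using F int by (intro Bochner_Integration.integral_add) auto
  finally show ?thesis by (simp only: I)
qed

text \<open>Pointwise control and integrability are carried by different functions: \<open>f\<close>
  is a version with controlled increments, \<open>F\<close> an integrable representative that
  supplies the L^1 norm.\<close>

definition admissible :: "(real \<Rightarrow> complex) \<Rightarrow> (real \<Rightarrow> real) \<Rightarrow> (real \<Rightarrow> complex) \<Rightarrow> bool" where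
  "admissible f V F \<longleftrightarrow> dominated f V \<and> integrable lborel F \<and>
     (AE x in lborel. x \<in> {a..b} \<longrightarrow> f x = F x)"

abbreviation L1 :: "(real \<Rightarrow> complex) \<Rightarrow> real" where "L1 F \<equiv> LINT x|lborel. norm (F x)"

text \<open>The counterpart of \<open>dominated\<close> that includes the endpoints, as required for
  \<open>variation\<close>, whose lists may contain \<open>a\<close> and \<open>b\<close>.
  Monotonicity of \<open>V\<close> is a consequence here.\<close>

definition closed_dominated :: "(real \<Rightarrow> complex) \<Rightarrow> (real \<Rightarrow> real) \<Rightarrow> bool" where
  "closed_dominated g V \<longleftrightarrow> (\<forall>x y. a \<le> x \<and> x \<le> y \<and> y \<le> b \<longrightarrow> norm (g y - g x) \<le> V y - V x)"

lemma closed_dominatedD: "closed_dominated g V \<Longrightarrow> a \<le> x \<Longrightarrow> x \<le> y \<Longrightarrow> y \<le> b \<Longrightarrow> norm (g y - g x) \<le> V y - V x"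
  unfolding closed_dominated_def by blast

lemma closed_dominated_mono: "closed_dominated g V \<Longrightarrow> a \<le> x \<Longrightarrow> x \<le> y \<Longrightarrow> y \<le> b \<Longrightarrow> V x \<le> V y"
  using closed_dominatedD[of g V x y] norm_ge_zero[of "g y - g x"] by linarith

lemma closed_dominated_dominated: "closed_dominated g V \<Longrightarrow> dominated g V"
  unfolding dominated_def by (auto intro!: mono_onI closed_dominated_mono[of g V] closed_dominatedD[of g V])

lemma closed_dominated_osc: "closed_dominated g V \<Longrightarrow> x \<in> {a..b} \<Longrightarrow> y \<in> {a..b} \<Longrightarrow> norm (g y - g x) \<le> V b - V a"
proof -
  assume g: "closed_dominated g V" and xy: "x \<in> {a..b}" "y \<in> {a..b}"
  have *: "norm (g y - g x) \<le> V b - V a" if "a \<le> x" "x \<le> y" "y \<le> b" for x y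
    using closed_dominatedD[OF g that] closed_dominated_mono[OF g, of a x] closed_dominated_mono[OF g, of y b] that by simp
  show ?thesis
  proof (cases "x \<le> y")
    case False
    then show ?thesis using *[of y x] xy by (simp add: norm_minus_commute)
  qed (use * xy in simp)
qed

lemma list_variation_le:
  assumes "closed_dominated g V" "sorted xs" "set xs \<subseteq> {a..b}" "xs \<noteq> []"
  shows "list_variation g xs \<le> V (last xs) - V (hd xs)"
  using assms(2-4)
proof (induction xs rule: induct_list012)
  case (3 x y zs)
  have "norm (g y - g x) \<le> V y - V x" using 3 by (intro closed_dominatedD[OF assms(1)]) auto
  moreover have "list_variation g (y # zs) \<le> V (last (y # zs)) - V y" using 3 by simp
  ultimately show ?case by (simp add: list_variation_Cons)
qed (auto simp: list_variation_def)

lemma variation_le: "closed_dominated g V \<Longrightarrow> variation a b g \<le> ennreal (V b - V a)"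
  unfolding variation_def list_variation_def[symmetric]
proof (rule SUP_least)
  fix xs assume g: "closed_dominated g V" and xs: "xs \<in> {xs. sorted xs \<and> set xs \<subseteq> {a..b}}"
  show "ennreal (list_variation g xs) \<le> ennreal (V b - V a)"
  proof (cases "xs = []")
    case False
    then have "hd xs \<in> {a..b}" "last xs \<in> {a..b}"
      using xs hd_in_set[of xs] last_in_set[of xs] by blast+
    then show ?thesis
      using list_variation_le[OF g, of xs] False xs closed_dominated_mono[OF g, of a "hd xs"] closed_dominated_mono[OF g, of "last xs" b]
      by (intro ennreal_leI) auto
  qed (simp add: list_variation_def)
qed

text \<open>Append \<open>x\<close> and \<open>y\<close> to a list in \<open>{a..x}\<close>: the
  former does not decrease the sum and the latter adds the increment.\<close>

lemma variation_step:
  assumes "a \<le> x" "x \<le> y"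
  shows "variation a x g + ennreal (norm (g y - g x)) \<le> variation a y g"
proof -
  let ?A = "\<lambda>x. {xs. sorted xs \<and> set xs \<subseteq> {a..x}}"
  have "variation a x g + ennreal (norm (g y - g x)) =
      (SUP xs\<in>?A x. ennreal (list_variation g xs) + ennreal (norm (g y - g x)))"
    unfolding variation_def list_variation_def[symmetric]
    by (rule ennreal_SUP_add_left[symmetric]) (auto intro!: exI[of _ "[]"])
  also have "\<dots> \<le> variation a y g"
  proof (rule SUP_least)
    fix xs assume xs: "xs \<in> ?A x"
    have "list_variation g xs \<le> list_variation g (xs @ [x])"
    proof (cases "xs = []")
      case False
      then show ?thesis by (simp add: list_variation_snoc)
    qed (simp add: list_variation_def)
    then have "ennreal (list_variation g xs) + ennreal (norm (g y - g x)) \<le> ennreal (list_variation g ((xs @ [x]) @ [y]))"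
      by (subst list_variation_snoc) (auto simp: ennreal_plus[symmetric] list_variation_def sum_nonneg simp del: ennreal_plus intro!: ennreal_leI)
    also have "\<dots> \<le> variation a y g"
      unfolding variation_def list_variation_def[symmetric]
      using xs assms by (intro SUP_upper) (auto simp: sorted_append intro: order_trans)
    finally show "ennreal (list_variation g xs) + ennreal (norm (g y - g x)) \<le> variation a y g" .
  qed
  finally show ?thesis .
qed

text \<open>The variation over \<open>{a..x}\<close>, as a function of \<open>x\<close>, is the
  classical dominating function.\<close>

lemma variation_closed_dominated:
  assumes "variation a b g < \<infinity>"
  shows "\<exists>V. closed_dominated g V \<and> V b - V a \<le> enn2real (variation a b g)"
proof (intro exI conjI)
  let ?V = "\<lambda>x. enn2real (variation a x g)"
  show "?V b - ?V a \<le> enn2real (variation a b g)" by simp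
  show "closed_dominated g ?V"
    unfolding closed_dominated_def
  proof (intro allI impI)
    fix x y assume xy: "a \<le> x \<and> x \<le> y \<and> y \<le> b"
    have "variation a y g \<le> variation a b g"
      using variation_step[of y b g] xy order_trans[OF le_add_same_cancel1[THEN iffD2], of 0] 
      by (metis add.right_neutral add_left_mono order_trans zero_le)
    then have fin: "variation a y g < \<infinity>" using assms by (simp add: order.strict_trans1)
    have step: "variation a x g + ennreal (norm (g y - g x)) \<le> variation a y g" using variation_step xy by simp
    have finx: "variation a x g < \<infinity>"
      using step fin by (metis add.right_neutral add_left_mono order.strict_trans1 order_trans zero_le)
    have "enn2real (variation a x g + ennreal (norm (g y - g x))) \<le> enn2real (variation a y g)"
      using step fin by (intro enn2real_mono) auto
    then show "norm (g y - g x) \<le> ?V y - ?V x" using finx by (simp add: enn2real_plus)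
  qed
qed

section \<open>Elements of BV through dominated versions\<close>

text \<open>The monotone \<open>V\<close> replaces a supremum over lists by a function that can be
  added, scaled, localized and summed in series.\<close>

definition represents :: "l1 \<Rightarrow> (real \<Rightarrow> complex) \<Rightarrow> (real \<Rightarrow> real) \<Rightarrow> bool" where
  "represents u g V \<longleftrightarrow> closed_dominated g V \<and> (AE x in lborel. x \<in> {a..b} \<longrightarrow> g x = rep_l1 u x)"

abbreviation ess_var :: "l1 \<Rightarrow> real" where "ess_var u \<equiv> enn2real (ess_variation a b u)"

lemma represents_ess_var_le: "represents u g V \<Longrightarrow> ess_variation a b u < \<infinity> \<and> ess_var u \<le> V b - V a"
proof -
  assume r: "represents u g V"
  then have V: "0 \<le> V b - V a" using closed_dominated_mono[of g V a b] a_less_b by (simp add: represents_def)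
  have "ess_variation a b u \<le> variation a b g"
    unfolding ess_variation_def using r by (intro INF_lower) (simp add: represents_def)
  also have "\<dots> \<le> ennreal (V b - V a)" using r by (intro variation_le) (simp add: represents_def)
  finally have le: "ess_variation a b u \<le> ennreal (V b - V a)" .
  then have "ess_var u \<le> enn2real (ennreal (V b - V a))" by (intro enn2real_mono) auto
  then show ?thesis using V le by (auto intro: order.strict_trans1)
qed

lemma represents_BV: "represents u g V \<Longrightarrow> u \<in> L1_on a b \<Longrightarrow> u \<in> BV a b"
  using represents_ess_var_le by (simp add: BV_def)

lemma BV_represents:
  assumes "u \<in> BV a b" "0 < e"
  shows "\<exists>g V. represents u g V \<and> V b - V a \<le> ess_var u + e"
proof -
  have fin: "ess_variation a b u < \<infinity>" using assms by (simp add: BV_def)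
  then have "ess_variation a b u = ennreal (ess_var u)" by simp
  also have "\<dots> < ennreal (ess_var u + e)" using assms by (intro ennreal_lessI) (auto simp: add_nonneg_pos)
  finally obtain g where g: "AE x in lborel. x \<in> {a..b} \<longrightarrow> g x = rep_l1 u x"
    "variation a b g < ennreal (ess_var u + e)"
    unfolding ess_variation_def by (auto simp: INF_less_iff)
  have "variation a b g < \<infinity>" using g(2) by (auto intro: order.strict_trans)
  then obtain V where V: "closed_dominated g V" "V b - V a \<le> enn2real (variation a b g)"
    using variation_closed_dominated by blast
  have "enn2real (variation a b g) \<le> enn2real (ennreal (ess_var u + e))"
    using g(2) by (intro enn2real_mono) auto
  also have "\<dots> = ess_var u + e" using assms by (intro enn2real_ennreal) simp
  finally show ?thesis using V g by (intro exI[of _ g] exI[of _ V]) (auto simp: represents_def)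
qed

lemma BV_represents_1: "u \<in> BV a b \<Longrightarrow> \<exists>g V. represents u g V \<and> V b - V a \<le> ess_var u + 1"
  by (rule BV_represents) simp_all

lemma BV_L1_on: "u \<in> BV a b \<Longrightarrow> u \<in> L1_on a b"
  by (simp add: BV_def)

lemma represents_add:
  assumes "represents u g V" "represents v g' V'"
  shows "represents (u + v) (\<lambda>x. g x + g' x) (\<lambda>x. V x + V' x)"
  unfolding represents_def
proof
  show "closed_dominated (\<lambda>x. g x + g' x) (\<lambda>x. V x + V' x)"
    unfolding closed_dominated_def
  proof (intro allI impI)
    fix x y assume xy: "a \<le> x \<and> x \<le> y \<and> y \<le> b"
    have "norm ((g y + g' y) - (g x + g' x)) \<le> norm (g y - g x) + norm (g' y - g' x)"
      by (metis add_diff_add norm_triangle_ineq)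
    then show "norm ((g y + g' y) - (g x + g' x)) \<le> V y + V' y - (V x + V' x)"
      using closed_dominatedD[of g V x y] closed_dominatedD[of g' V' x y] xy assms by (simp add: represents_def)
  qed
  have "AE x in lborel. x \<in> {a..b} \<longrightarrow> g x = rep_l1 u x" "AE x in lborel. x \<in> {a..b} \<longrightarrow> g' x = rep_l1 v x"
    using assms by (simp_all add: represents_def)
  then show "AE x in lborel. x \<in> {a..b} \<longrightarrow> g x + g' x = rep_l1 (u + v) x"
    using rep_plus_l1[of u v] by eventually_elim simp
qed

lemma represents_scale:
  assumes "represents u g V"
  shows "represents (k *\<^sub>C u) (\<lambda>x. k * g x) (\<lambda>x. cmod k * V x)"
  unfolding represents_def
proof
  show "closed_dominated (\<lambda>x. k * g x) (\<lambda>x. cmod k * V x)"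
    unfolding closed_dominated_def
  proof (intro allI impI)
    fix x y assume xy: "a \<le> x \<and> x \<le> y \<and> y \<le> b"
    have "norm (k * g y - k * g x) = cmod k * norm (g y - g x)"
      by (simp add: norm_mult[symmetric] right_diff_distrib)
    also have "\<dots> \<le> cmod k * (V y - V x)"
      using closed_dominatedD[of g V x y] xy assms by (intro mult_left_mono) (auto simp: represents_def)
    finally show "norm (k * g y - k * g x) \<le> cmod k * V y - cmod k * V x" by (simp add: right_diff_distrib)
  qed
  have "AE x in lborel. x \<in> {a..b} \<longrightarrow> g x = rep_l1 u x" using assms by (simp add: represents_def)
  then show "AE x in lborel. x \<in> {a..b} \<longrightarrow> k * g x = rep_l1 (k *\<^sub>C u) x"
    using rep_scale_l1[of k u] by eventually_elim simp
qed

lemma L1_on_add: "u \<in> L1_on a b \<Longrightarrow> v \<in> L1_on a b \<Longrightarrow> u + v \<in> L1_on a b"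
  unfolding L1_on_def mem_Collect_eq
proof -
  assume "AE x in lborel. x \<notin> {a..b} \<longrightarrow> rep_l1 u x = 0" "AE x in lborel. x \<notin> {a..b} \<longrightarrow> rep_l1 v x = 0"
  then show "AE x in lborel. x \<notin> {a..b} \<longrightarrow> rep_l1 (u + v) x = 0"
    using rep_plus_l1[of u v] by eventually_elim simp
qed

lemma L1_on_scale: "u \<in> L1_on a b \<Longrightarrow> k *\<^sub>C u \<in> L1_on a b"
  unfolding L1_on_def mem_Collect_eq
proof -
  assume "AE x in lborel. x \<notin> {a..b} \<longrightarrow> rep_l1 u x = 0"
  then show "AE x in lborel. x \<notin> {a..b} \<longrightarrow> rep_l1 (k *\<^sub>C u) x = 0"
    using rep_scale_l1[of k u] by eventually_elim simp
qed

lemma L1_on_zero: "0 \<in> L1_on a b"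
  unfolding L1_on_def mem_Collect_eq using rep_zero_l1 by eventually_elim simp

lemma represents_zero: "represents 0 (\<lambda>_. 0) (\<lambda>_. 0)"
  unfolding represents_def closed_dominated_def
proof
  show "AE x in lborel. x \<in> {a..b} \<longrightarrow> 0 = rep_l1 0 x" using rep_zero_l1 by eventually_elim simp
qed simp

lemma BV_add: "u \<in> BV a b \<Longrightarrow> v \<in> BV a b \<Longrightarrow> u + v \<in> BV a b \<and> ess_var (u + v) \<le> ess_var u + ess_var v"
proof
  assume uv: "u \<in> BV a b" "v \<in> BV a b"
  have *: "\<exists>g V. represents (u + v) g V \<and> V b - V a \<le> ess_var u + ess_var v + e" if e: "0 < e" for e
  proof -
    obtain g V where 1: "represents u g V" "V b - V a \<le> ess_var u + e / 2"
      using BV_represents[OF uv(1), of "e/2"] e by auto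
    obtain g' V' where 2: "represents v g' V'" "V' b - V' a \<le> ess_var v + e / 2"
      using BV_represents[OF uv(2), of "e/2"] e by auto
    show ?thesis using represents_add[OF 1(1) 2(1)] 1(2) 2(2) by (intro exI conjI) auto
  qed
  show "u + v \<in> BV a b" using *[of 1] represents_BV L1_on_add BV_L1_on uv by (metis zero_less_one)
  show "ess_var (u + v) \<le> ess_var u + ess_var v"
  proof (rule field_le_epsilon)
    fix e :: real assume "0 < e"
    then obtain g V where "represents (u + v) g V" "V b - V a \<le> ess_var u + ess_var v + e" using * by blast
    then show "ess_var (u + v) \<le> ess_var u + ess_var v + e" using represents_ess_var_le[of "u + v" g V] by simp
  qed
qed

lemma BV_zero: "0 \<in> BV a b" and ess_var_zero: "ess_var 0 = 0"
  using represents_BV[OF represents_zero L1_on_zero] represents_ess_var_le[OF represents_zero]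
  by (auto intro: antisym)

lemma BV_scale_le: "u \<in> BV a b \<Longrightarrow> k *\<^sub>C u \<in> BV a b \<and> ess_var (k *\<^sub>C u) \<le> cmod k * ess_var u"
proof
  assume u: "u \<in> BV a b"
  obtain g V where "represents u g V" using BV_represents_1[OF u] by blast
  then show "k *\<^sub>C u \<in> BV a b" using represents_BV represents_scale L1_on_scale BV_L1_on u by blast
  have *: "ess_var (k *\<^sub>C u) \<le> cmod k * (ess_var u + e)" if e: "0 < e" for e
  proof -
    obtain g V where 1: "represents u g V" "V b - V a \<le> ess_var u + e" using BV_represents[OF u e] by blast
    then have "ess_var (k *\<^sub>C u) \<le> cmod k * (V b - V a)"
      using represents_ess_var_le[OF represents_scale[OF 1(1), of k]] by (simp add: right_diff_distrib)
    then show ?thesis using mult_left_mono[OF 1(2), of "cmod k"] by simp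
  qed
  show "ess_var (k *\<^sub>C u) \<le> cmod k * ess_var u"
  proof (rule field_le_epsilon)
    fix e :: real assume e: "0 < e"
    have "e * (cmod k / (cmod k + 1)) \<le> e * 1"
      using e by (intro mult_left_mono) (simp_all add: divide_le_eq add_nonneg_pos)
    then have "cmod k * (e / (cmod k + 1)) \<le> e" by (simp add: mult.commute)
    then show "ess_var (k *\<^sub>C u) \<le> cmod k * ess_var u + e"
      using *[of "e / (cmod k + 1)"] e by (simp add: distrib_left add_nonneg_pos)
  qed
qed

text \<open>The inequality \<open>BV_scale_le\<close> is used for \<open>k\<close> and for
  \<open>1 / k\<close>.\<close>

lemma ess_var_scale: "u \<in> BV a b \<Longrightarrow> ess_var (k *\<^sub>C u) = cmod k * ess_var u"
proof (cases "k = 0")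
  case True
  then show ?thesis by (simp add: ess_var_zero)
next
  case False
  assume u: "u \<in> BV a b"
  have "ess_var ((1/k) *\<^sub>C (k *\<^sub>C u)) \<le> cmod (1/k) * ess_var (k *\<^sub>C u)" using BV_scale_le u by blast
  then have "ess_var u \<le> ess_var (k *\<^sub>C u) / cmod k" using False by (simp add: norm_divide)
  then have "cmod k * ess_var u \<le> ess_var (k *\<^sub>C u)" using False by (simp add: field_simps)
  then show ?thesis using BV_scale_le[OF u, of k] by simp
qed

lemma subspace_BV: "l1.subspace (BV a b)"
  by (rule l1.subspaceI) (use BV_zero BV_add BV_scale_le in blast)+

lemma norm_BV_eq: "norm_BV a b u = norm_l1 u + ess_var u"
  by (simp add: norm_BV_def)

text \<open>\<open>average_bound\<close> is applied at the midpoint, an interior point; passing from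
  there to \<open>x\<close> costs a second oscillation, hence the factor 2.\<close>

lemma represents_sup:
  assumes "represents u g V" "x \<in> {a..b}"
  shows "norm (g x) \<le> 2 * (V b - V a) + norm_l1 u / (b - a)"
proof -
  have g: "closed_dominated g V" "AE x in lborel. x \<in> {a..b} \<longrightarrow> g x = rep_l1 u x"
    using assms by (simp_all add: represents_def)
  let ?t = "(a + b) / 2"
  have t: "?t \<in> {a..b}" "a < ?t" "?t < b" using a_less_b by auto
  have "(b - a) * norm (g ?t) \<le> (b - a) * (V b - V a) + norm_l1 u"
    unfolding norm_l1_eq
    by (rule average_bound[OF closed_dominated_dominated[OF g(1)] _ g(2)]) (use t a_less_b in auto)
  also have "\<dots> = (b - a) * (V b - V a + norm_l1 u / (b - a))" using a_less_b by (simp add: field_simps)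
  finally have "norm (g ?t) \<le> V b - V a + norm_l1 u / (b - a)" using a_less_b by simp
  moreover have "norm (g x - g ?t) \<le> V b - V a" using closed_dominated_osc[OF g(1) t(1) assms(2)] .
  ultimately have "norm (g x) \<le> (V b - V a + norm_l1 u / (b - a)) + (V b - V a)"
    by (meson add_mono norm_triangle_sub order_trans)
  then show ?thesis by (simp add: algebra_simps)
qed

lemma norm_l1_le_sup:
  assumes "u \<in> L1_on a b" "AE x in lborel. x \<in> {a..b} \<longrightarrow> norm (rep_l1 u x) \<le> B"
  shows "norm_l1 u \<le> (b - a) * B"
proof -
  have "norm_l1 u \<le> (LINT x|lborel. indicator {a..b} x * B)"
    unfolding norm_l1_eq
  proof (rule integral_mono_AE)
    show "AE x in lborel. norm (rep_l1 u x) \<le> indicator {a..b} x * B"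
      using assms unfolding L1_on_def mem_Collect_eq
      by (auto elim!: AE_mp simp: indicator_def intro!: AE_I2)
    show "integrable lborel (\<lambda>x. indicator {a..b} x * B)"
      by (intro integrable_mult_left integrable_real_indicator) (auto simp: emeasure_lborel_Icc_eq)
  qed simp
  then show ?thesis using a_less_b by simp
qed

lemma L1_on_diff: "u \<in> L1_on a b \<Longrightarrow> v \<in> L1_on a b \<Longrightarrow> u - v \<in> L1_on a b"
  using L1_on_add[of u "(- 1) *\<^sub>C v"] L1_on_scale[of v "- 1"] by simp

section \<open>Compact embedding and completeness\<close>

text \<open>A function is coded by its values at the left ends of \<open>k\<close> equal cells,
  rounded to a finite net of a disc. Two functions with the same code differ on a cell by at most
  \<open>2 * \<delta>\<close> plus their variations there; in the integral these variations add up
  to the total ones times the mesh. Rounding contributes \<open>e / 4\<close>, the mesh less than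
  \<open>e / 2\<close>.\<close>

lemma BV_totally_bounded:
  assumes e: "0 < e"
  shows "\<exists>F. finite F \<and> {u \<in> BV a b. norm_BV a b u \<le> R} \<subseteq> \<Union>F \<and>
     (\<forall>S\<in>F. \<forall>u\<in>S. \<forall>v\<in>S. norm_l1 (u - v) < e)"
proof -
  have ba: "0 < b - a" using a_less_b by simp
  \<comment> \<open>The bound of \<open>represents_sup\<close> for versions whose variation exceeds
    the essential one by at most 1.\<close>
  define B where "B = 2 * (R + 1) + R / (b - a)"
  define \<delta> where "\<delta> = e / (8 * (b - a))"
  have \<delta>: "0 < \<delta>" "2 * \<delta> * (b - a) = e / 4" using e ba by (auto simp: \<delta>_def field_simps)
  obtain k0 :: nat where k0: "(b - a) * (2 * (R + 1)) * 2 / e < real k0" using reals_Archimedean2 by blast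
  define k where "k = Suc k0"
  have k: "0 < k" "(b - a) * (2 * (R + 1)) / real k < e / 2"
  proof -
    have "(b - a) * (2 * (R + 1)) * 2 / e < real k" using k0 by (simp add: k_def)
    then have "(b - a) * (2 * (R + 1)) * 2 < real k * e" using e by (simp add: pos_divide_less_eq)
    then show "(b - a) * (2 * (R + 1)) / real k < e / 2" by (simp add: k_def pos_divide_less_eq mult.commute)
  qed (simp add: k_def)
  have "\<forall>u\<in>BV a b. \<exists>gV. represents u (fst gV) (snd gV) \<and> snd gV b - snd gV a \<le> ess_var u + 1"
    using BV_represents_1 by fastforce
  then obtain gV where gV: "\<And>u. u \<in> BV a b \<Longrightarrow> represents u (fst (gV u)) (snd (gV u))"
    "\<And>u. u \<in> BV a b \<Longrightarrow> snd (gV u) b - snd (gV u) a \<le> ess_var u + 1" by metis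
  define g V where "g u = fst (gV u)" and "V u = snd (gV u)" for u
  have rep: "represents u (g u) (V u)" "V u b - V u a \<le> ess_var u + 1" if "u \<in> BV a b" for u
    using gV that by (simp_all add: g_def V_def)
  have "compact (cball (0::complex) B)" by simp
  then obtain N0 where N0: "finite N0" "cball (0::complex) B \<subseteq> (\<Union>z\<in>N0. ball z \<delta>)"
    using \<delta>(1) unfolding compact_eq_totally_bounded by blast
  then have "\<exists>w. w \<in> N0 \<and> dist w z < \<delta>" if "norm z \<le> B" for z
    using that by (force simp: subset_iff)
  then obtain \<iota> where \<iota>: "\<And>z. norm z \<le> B \<Longrightarrow> \<iota> z \<in> N0 \<and> dist (\<iota> z) z < \<delta>"
    by metis
  define t where "t i = a + real i * ((b - a) / real k)" for i
  have t: "t 0 = a" "t k = b" "\<And>i. t (Suc i) - t i = (b - a) / real k"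
    using k(1) by (simp_all add: t_def distrib_right add_divide_distrib)
  have t_mono: "t i \<le> t j" if "i \<le> j" for i j
    unfolding t_def using that ba by (intro add_left_mono mult_right_mono) auto
  have t_in: "t i \<in> {a..b}" if "i \<le> k" for i using t_mono[of 0 i] t_mono[OF that] t by simp
  define code where "code u = restrict (\<lambda>i. \<iota> (g u (t i))) {..<k}" for u
  define Bl where "Bl = {u \<in> BV a b. norm_BV a b u \<le> R}"
  have Bl: "u \<in> BV a b" "norm_l1 u \<le> R" "ess_var u \<le> R" if "u \<in> Bl" for u
    using that norm_l1_nonneg[of u] enn2real_nonneg[of "ess_variation a b u"] unfolding Bl_def norm_BV_eq by (simp_all del: enn2real_nonneg)
  have g_le: "norm (g u x) \<le> B" if "u \<in> Bl" "x \<in> {a..b}" for u x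
  proof -
    have "norm (g u x) \<le> 2 * (V u b - V u a) + norm_l1 u / (b - a)"
      using represents_sup[OF rep(1)[OF Bl(1)[OF that(1)]] that(2)] .
    also have "\<dots> \<le> B" unfolding B_def
      using rep(2)[OF Bl(1)[OF that(1)]] Bl[OF that(1)] ba by (intro add_mono divide_right_mono) auto
    finally show ?thesis .
  qed
  have close: "norm_l1 (u - v) < e" if u: "u \<in> Bl" and v: "v \<in> Bl" and c: "code u = code v" for u v
  proof -
    have cu: "closed_dominated (g u) (V u)" and cv: "closed_dominated (g v) (V v)"
      using rep(1) Bl(1) u v by (auto simp: represents_def)
    define d where "d i = 2 * \<delta> + (V u (t (Suc i)) - V u (t i)) + (V v (t (Suc i)) - V v (t i))" for i
    have d0: "0 \<le> d i" if "i < k" for i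
      using closed_dominated_mono[OF cu, of "t i" "t (Suc i)"] closed_dominated_mono[OF cv, of "t i" "t (Suc i)"]
        t_in[of i] t_in[of "Suc i"] t_mono[of i "Suc i"] that \<delta>(1) by (simp add: d_def)
    let ?q = "\<lambda>x. \<Sum>i<k. indicator {t i..t (Suc i)} x * d i"
    have bound: "norm (g u x - g v x) \<le> d i" if i: "i < k" "t i \<le> x" "x \<le> t (Suc i)" for x i
    proof -
      have x: "a \<le> t i" "t i \<le> b" "t (Suc i) \<le> b" using i t_in[of i] t_in[of "Suc i"] by auto
      have "\<iota> (g u (t i)) = \<iota> (g v (t i))" using fun_cong[OF c, of i] i by (simp add: code_def)
      moreover have "dist (\<iota> (g u (t i))) (g u (t i)) < \<delta>" "dist (\<iota> (g v (t i))) (g v (t i)) < \<delta>"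
        using \<iota> g_le u v x by auto
      ultimately have 1: "norm (g u (t i) - g v (t i)) \<le> 2 * \<delta>"
        using dist_triangle_half_r[of "\<iota> (g v (t i))" "g u (t i)" "2 * \<delta>" "g v (t i)"] by (simp add: dist_norm[symmetric])
      have 2: "norm (g u x - g u (t i)) \<le> V u (t (Suc i)) - V u (t i)"
        using closed_dominatedD[OF cu x(1) i(2)] closed_dominated_mono[OF cu, of x "t (Suc i)"] i x by simp
      have 3: "norm (g v x - g v (t i)) \<le> V v (t (Suc i)) - V v (t i)"
        using closed_dominatedD[OF cv x(1) i(2)] closed_dominated_mono[OF cv, of x "t (Suc i)"] i x by simp
      have "g u x - g v x = (g u (t i) - g v (t i)) + (g u x - g u (t i)) - (g v x - g v (t i))" by simp
      also have "norm \<dots> \<le> norm (g u (t i) - g v (t i)) + norm (g u x - g u (t i)) + norm (g v x - g v (t i))"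
        by (meson add_right_mono norm_triangle_ineq norm_triangle_ineq4 order_trans)
      finally show ?thesis using 1 2 3 by (simp add: d_def)
    qed
    have "norm_l1 (u - v) \<le> (LINT x|lborel. ?q x)"
      unfolding norm_l1_eq
    proof (rule integral_mono_AE)
      have "u - v \<in> L1_on a b" using Bl(1) u v by (intro L1_on_diff BV_L1_on) auto
      then have off: "AE x in lborel. x \<notin> {a..b} \<longrightarrow> rep_l1 (u - v) x = 0" by (simp add: L1_on_def)
      have "AE x in lborel. x \<in> {a..b} \<longrightarrow> g u x = rep_l1 u x" "AE x in lborel. x \<in> {a..b} \<longrightarrow> g v x = rep_l1 v x"
        using rep(1) Bl(1) u v by (auto simp: represents_def)
      then show "AE x in lborel. norm (rep_l1 (u - v) x) \<le> ?q x"
        using off rep_minus_l1[of u v]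
      proof eventually_elim
        case (elim x)
        have q0: "0 \<le> ?q x" using d0 by (intro sum_nonneg) auto
        show ?case
        proof (cases "x \<in> {a..b}")
          case True
          then obtain i where i: "i < k" "t i \<le> x" "x \<le> t (Suc i)"
            using interval_grid_cell[OF k(1), of t x] t by auto
          have "norm (rep_l1 (u - v) x) \<le> d i" using bound[OF i] elim True by simp
          also have "d i = indicator {t i..t (Suc i)} x * d i" using i by simp
          also have "\<dots> \<le> ?q x" using i d0 by (intro member_le_sum) auto
          finally show ?thesis .
        next
          case False
          then show ?thesis using elim q0 by simp
        qed
      qed
      show "integrable lborel ?q"
        by (intro Bochner_Integration.integrable_sum integrable_mult_left integrable_real_indicator)
          (auto simp: emeasure_lborel_Icc_eq)
    qed simp
    also have "(LINT x|lborel. ?q x) = (\<Sum>i<k. (LINT x|lborel. indicator {t i..t (Suc i)} x * d i))"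
      by (intro Bochner_Integration.integral_sum integrable_mult_left integrable_real_indicator)
        (auto simp: emeasure_lborel_Icc_eq)
    also have "\<dots> = (\<Sum>i<k. (b - a) / real k * d i)"
      using t_mono t(3) by (intro sum.cong) auto
    also have "\<dots> = (b - a) / real k * (\<Sum>i<k. d i)" by (simp only: sum_distrib_left)
    also have "(\<Sum>i<k. d i) = 2 * \<delta> * real k + (V u b - V u a) + (V v b - V v a)"
      unfolding d_def sum.distrib using sum_lessThan_telescope[of "\<lambda>i. V u (t i)" k]
        sum_lessThan_telescope[of "\<lambda>i. V v (t i)" k] t by simp
    also have "(b - a) / real k * \<dots> \<le> (b - a) / real k * (2 * \<delta> * real k + 2 * (R + 1))"
      using rep(2)[OF Bl(1)[OF u]] rep(2)[OF Bl(1)[OF v]] Bl(3)[OF u] Bl(3)[OF v] ba k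
      by (intro mult_left_mono) auto
    also have "\<dots> = 2 * \<delta> * (b - a) + (b - a) * (2 * (R + 1)) / real k" using k by (simp add: field_simps)
    also have "\<dots> < e" using \<delta>(2) k(2) e by linarith
    finally show ?thesis .
  qed
  let ?F = "(\<lambda>cd. {u \<in> Bl. code u = cd}) ` (PiE {..<k} (\<lambda>_. N0))"
  have "finite ?F" using N0(1) by (intro finite_imageI finite_PiE) auto
  moreover have "Bl \<subseteq> \<Union>?F"
  proof
    fix u assume u: "u \<in> Bl"
    have "code u \<in> PiE {..<k} (\<lambda>_. N0)"
      unfolding code_def using \<iota> g_le[OF u] t_in by (intro restrict_PiE_iff[THEN iffD2]) auto
    then show "u \<in> \<Union>?F" using u by auto
  qed
  moreover have "\<forall>S\<in>?F. \<forall>u\<in>S. \<forall>v\<in>S. norm_l1 (u - v) < e" using close by auto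
  ultimately show ?thesis unfolding Bl_def by blast
qed

text \<open>The suprema of suitable versions are summable, so the series converges pointwise; its
  tails have versions dominated by the tails of the dominating functions.\<close>

lemma BV_complete:
  assumes u: "\<And>n. u n \<in> BV a b" and sm: "summable (\<lambda>n. norm_BV a b (u n))"
  shows "\<exists>s\<in>BV a b. (\<lambda>n. norm_BV a b (s - (\<Sum>k<n. u k))) \<longlonglongrightarrow> 0"
proof -
  have ba: "0 < b - a" using a_less_b by simp
  \<comment> \<open>The slack \<open>(1/2)^n\<close> keeps the variations of the chosen versions
    summable.\<close>
  have "\<exists>gV. represents (u n) (fst gV) (snd gV) \<and> snd gV b - snd gV a \<le> ess_var (u n) + (1/2)^n" for n
    using BV_represents[OF u, of "(1/2)^n" n] by fastforce
  then obtain gV where gV: "\<And>n. represents (u n) (fst (gV n)) (snd (gV n))"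
    "\<And>n. snd (gV n) b - snd (gV n) a \<le> ess_var (u n) + (1/2)^n" by metis
  define g V where "g n = fst (gV n)" and "V n = snd (gV n)" for n
  have rep: "represents (u n) (g n) (V n)" "V n b - V n a \<le> ess_var (u n) + (1/2)^n" for n
    using gV by (simp_all add: g_def V_def)
  have cd: "closed_dominated (g n) (V n)" for n using rep(1) by (simp add: represents_def)
  define d where "d n = V n b - V n a" for n
  define B where "B n = 2 * d n + norm_l1 (u n) / (b - a)" for n
  have d0: "0 \<le> d n" for n using closed_dominated_mono[OF cd, of a b n] ba by (simp add: d_def)
  have B0: "0 \<le> B n" for n using d0 norm_l1_nonneg ba by (simp add: B_def)
  have ns: "norm_l1 (u n) \<le> norm_BV a b (u n)" "ess_var (u n) \<le> norm_BV a b (u n)" for n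
    using norm_l1_nonneg[of "u n"] by (auto simp: norm_BV_eq)
  have sd: "summable d"
  proof (rule summable_comparison_test')
    show "summable (\<lambda>n. norm_BV a b (u n) + (1/2)^n)" by (intro summable_add sm summable_geometric) simp
    show "norm (d n) \<le> norm_BV a b (u n) + (1/2)^n" for n
      using rep(2)[of n] d0[of n] ns(2)[of n] by (simp add: d_def)
  qed
  have "summable (\<lambda>n. norm_l1 (u n))"
    by (rule summable_comparison_test'[OF sm]) (use ns norm_l1_nonneg in auto)
  then have sB: "summable B" unfolding B_def by (intro summable_add summable_mult summable_divide sd)
  have g_le: "norm (g n x) \<le> B n" if "x \<in> {a..b}" for n x
    using represents_sup[OF rep(1) that, of n] by (simp add: B_def d_def)
  have V_le: "0 \<le> V n x - V n a" "V n x - V n a \<le> d n" if "x \<in> {a..b}" for n x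
    using closed_dominated_mono[OF cd, of a x n] closed_dominated_mono[OF cd, of x b n] that by (simp_all add: d_def)
  have sg: "summable (\<lambda>k. g (k + n) x)" if "x \<in> {a..b}" for n x
    by (rule summable_comparison_test'[OF summable_ignore_initial_segment[OF sB, of n]]) (use g_le that in auto)
  have sV: "summable (\<lambda>k. V (k + n) x - V (k + n) a)" if "x \<in> {a..b}" for n x
    by (rule summable_comparison_test'[OF summable_ignore_initial_segment[OF sd, of n]]) (use V_le that in auto)
  \<comment> \<open>The limit is formed from the measurable representatives; on the interval it
    agrees almost everywhere with the sum of the chosen versions.\<close>
  define F where "F x = (\<Sum>n. indicator {a..b} x *\<^sub>R rep_l1 (u n) x)" for x
  have AE_g: "AE x in lborel. \<forall>n. x \<in> {a..b} \<longrightarrow> g n x = rep_l1 (u n) x"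
    unfolding AE_all_countable using rep(1) by (simp add: represents_def)
  have F_eq: "F x = (\<Sum>n. g n x)" if "x \<in> {a..b}" "\<forall>n. x \<in> {a..b} \<longrightarrow> g n x = rep_l1 (u n) x" for x
    using that by (simp add: F_def)
  have F_off: "F x = 0" if "x \<notin> {a..b}" for x using that by (simp add: F_def)
  have "integrable lborel F"
  proof (rule Bochner_Integration.integrable_bound)
    show "integrable lborel (\<lambda>x. indicator {a..b} x * suminf B)"
      by (intro integrable_mult_left integrable_real_indicator) (auto simp: emeasure_lborel_Icc_eq)
    show "F \<in> borel_measurable lborel" unfolding F_def by measurable
    show "AE x in lborel. norm (F x) \<le> norm (indicator {a..b} x * suminf B)"
      using AE_g
    proof eventually_elim
      case (elim x)
      show ?case
      proof (cases "x \<in> {a..b}")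
        case True
        have "norm (\<Sum>n. g n x) \<le> suminf B" by (rule norm_suminf_le[OF g_le[OF True] sB])
        then show ?thesis using F_eq[OF True elim] True by simp
      qed (simp add: F_off)
    qed
  qed
  define s where "s = abs_l1 F"
  have rep_s: "AE x in lborel. rep_l1 s x = F x" unfolding s_def by (rule rep_abs_l1) fact
  have s_on: "s \<in> L1_on a b"
    unfolding L1_on_def mem_Collect_eq using rep_s by eventually_elim (simp add: F_off)
  let ?S = "\<lambda>n. \<Sum>k<n. u k"
  have S_on: "?S n \<in> L1_on a b" for n
    by (intro BV_L1_on l1.subspace_sum[OF subspace_BV] u)
  have tail: "AE x in lborel. x \<in> {a..b} \<longrightarrow> (\<Sum>k. g (k + n) x) = rep_l1 (s - ?S n) x" for n
    using AE_g rep_s rep_minus_l1[of s "?S n"] rep_sum_l1[of u "{..<n}"]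
  proof eventually_elim
    case (elim x)
    show ?case
    proof
      assume x: "x \<in> {a..b}"
      have "rep_l1 (s - ?S n) x = (\<Sum>k. g k x) - (\<Sum>k<n. g k x)" using elim x F_eq[OF x] by simp
      then show "(\<Sum>k. g (k + n) x) = rep_l1 (s - ?S n) x"
        using suminf_minus_initial_segment[OF sg[OF x, of 0, simplified], of n] by simp
    qed
  qed
  \<comment> \<open>Subtracting the values at \<open>a\<close> makes the sum of the dominating
    functions converge and leaves their increments unchanged. The case \<open>n = 0\<close> also
    places \<open>s\<close> itself in BV.\<close>
  have rep_tail: "represents (s - ?S n) (\<lambda>x. \<Sum>k. g (k + n) x) (\<lambda>x. \<Sum>k. V (k + n) x - V (k + n) a)" for n
    unfolding represents_def
  proof
    show "closed_dominated (\<lambda>x. \<Sum>k. g (k + n) x) (\<lambda>x. \<Sum>k. V (k + n) x - V (k + n) a)"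
      unfolding closed_dominated_def
    proof (intro allI impI)
      fix x y assume xy: "a \<le> x \<and> x \<le> y \<and> y \<le> b"
      then have x: "x \<in> {a..b}" and y: "y \<in> {a..b}" by auto
      have Veq: "(\<lambda>k. V (k + n) y - V (k + n) x) = (\<lambda>k. (V (k + n) y - V (k + n) a) - (V (k + n) x - V (k + n) a))"
        by auto
      have sVd: "summable (\<lambda>k. V (k + n) y - V (k + n) x)"
        unfolding Veq by (intro summable_diff sV x y)
      have le: "norm (g (k + n) y - g (k + n) x) \<le> V (k + n) y - V (k + n) x" for k
        using closed_dominatedD[OF cd] xy by simp
      have sn: "summable (\<lambda>k. norm (g (k + n) y - g (k + n) x))"
        by (rule summable_comparison_test'[OF sVd]) (use le in auto)
      have "(\<Sum>k. g (k + n) y) - (\<Sum>k. g (k + n) x) = (\<Sum>k. g (k + n) y - g (k + n) x)"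
        by (rule suminf_diff[OF sg[OF y] sg[OF x]])
      also have "norm \<dots> \<le> (\<Sum>k. norm (g (k + n) y - g (k + n) x))" by (rule summable_norm[OF sn])
      also have "\<dots> \<le> (\<Sum>k. V (k + n) y - V (k + n) x)" by (rule suminf_le[OF le sn sVd])
      also have "\<dots> = (\<Sum>k. V (k + n) y - V (k + n) a) - (\<Sum>k. V (k + n) x - V (k + n) a)"
        unfolding Veq by (rule suminf_diff[OF sV[OF y] sV[OF x], symmetric])
      finally show "norm ((\<Sum>k. g (k + n) y) - (\<Sum>k. g (k + n) x)) \<le>
          (\<Sum>k. V (k + n) y - V (k + n) a) - (\<Sum>k. V (k + n) x - V (k + n) a)" .
    qed
  qed (rule tail)
  have "s \<in> BV a b" using represents_BV[OF rep_tail[of 0]] s_on by simp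
  moreover have "(\<lambda>n. norm_BV a b (s - ?S n)) \<longlonglongrightarrow> 0"
  proof (rule Lim_null_comparison)
    have tl: "(\<lambda>n. \<Sum>k. f (k + n)) \<longlonglongrightarrow> 0" if f: "summable f" for f :: "nat \<Rightarrow> real"
    proof -
      have "(\<lambda>n. suminf f - sum f {..<n}) \<longlonglongrightarrow> suminf f - suminf f"
        by (intro tendsto_diff tendsto_const summable_LIMSEQ f)
      then show ?thesis by (simp add: suminf_minus_initial_segment[OF f])
    qed
    show "(\<lambda>n. (b - a) * (\<Sum>k. B (k + n)) + (\<Sum>k. d (k + n))) \<longlonglongrightarrow> 0"
      by (rule tendsto_eq_intros tl sB sd refl | simp)+
    show "\<forall>\<^sub>F n in sequentially. norm (norm_BV a b (s - ?S n)) \<le> (b - a) * (\<Sum>k. B (k + n)) + (\<Sum>k. d (k + n))"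
    proof (intro always_eventually allI)
      fix n
      have "norm_l1 (s - ?S n) \<le> (b - a) * (\<Sum>k. B (k + n))"
      proof (rule norm_l1_le_sup[OF L1_on_diff[OF s_on S_on]])
        show "AE x in lborel. x \<in> {a..b} \<longrightarrow> norm (rep_l1 (s - ?S n) x) \<le> (\<Sum>k. B (k + n))"
          using tail[of n]
        proof eventually_elim
          case (elim x)
          show ?case
          proof
            assume x: "x \<in> {a..b}"
            have sB': "summable (\<lambda>k. B (k + n))" using sB by (rule summable_ignore_initial_segment)
            have "norm (\<Sum>k. g (k + n) x) \<le> (\<Sum>k. B (k + n))"
              by (rule norm_suminf_le[OF g_le[OF x] sB'])
            then show "norm (rep_l1 (s - ?S n) x) \<le> (\<Sum>k. B (k + n))" using elim x by simp
          qed
        qed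
      qed
      moreover have "ess_var (s - ?S n) \<le> (\<Sum>k. d (k + n))"
        using represents_ess_var_le[OF rep_tail[of n]] by (simp add: d_def)
      ultimately show "norm (norm_BV a b (s - ?S n)) \<le> (b - a) * (\<Sum>k. B (k + n)) + (\<Sum>k. d (k + n))"
        using norm_l1_nonneg[of "s - ?S n"] by (simp add: norm_BV_eq)
    qed
  qed
  ultimately show ?thesis by blast
qed

end

section \<open>Transfer operators of inversion branches\<close>

text \<open>The interval with the greatest right endpoint lies to the right of all others, which
  therefore fit into \<open>{a..l K}\<close>; hence the induction over arbitrary
  \<open>b\<close>.\<close>

lemma sum_disjoint_increments_le:
  fixes l r :: "'i \<Rightarrow> real" and W :: "real \<Rightarrow> real"
  assumes "finite F" "mono_on {a..b} W" "a \<le> b"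
    "\<And>J. J \<in> F \<Longrightarrow> a \<le> l J \<and> l J < r J \<and> r J \<le> b"
    "\<And>J K. J \<in> F \<Longrightarrow> K \<in> F \<Longrightarrow> J \<noteq> K \<Longrightarrow> {l J<..<r J} \<inter> {l K<..<r K} = {}"
  shows "(\<Sum>J\<in>F. W (r J) - W (l J)) \<le> W b - W a"
  using assms
proof (induction F arbitrary: b rule: finite_ranking_induct[where f = r])
  case empty
  then show ?case by (auto dest: mono_onD)
next
  case (insert K F)
  show ?case
  proof (cases "K \<in> F")
    case True
    then show ?thesis using insert by (simp add: insert_absorb)
  next
    case False
    have K: "a \<le> l K" "l K < r K" "r K \<le> b" using insert.prems(3) by auto
    have left: "r J \<le> l K" if J: "J \<in> F" for J
    proof (rule ccontr)
      assume n: "\<not> r J \<le> l K"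
      have lJ: "l J < r J" using insert.prems(3) J by auto
      let ?x = "(max (l J) (l K) + r J) / 2"
      have "r J \<le> r K" using insert.hyps J by auto
      then have "?x \<in> {l J<..<r J} \<inter> {l K<..<r K}" using n lJ by (auto simp: max_def)
      moreover have "J \<noteq> K" using J False by auto
      ultimately show False using insert.prems(4)[OF insertI2[OF J] insertI1] by blast
    qed
    have "(\<Sum>J\<in>F. W (r J) - W (l J)) \<le> W (l K) - W a"
    proof (rule insert.IH)
      show "mono_on {a..l K} W" using K by (intro mono_on_subset[OF insert.prems(1)]) auto
      show "a \<le> l J \<and> l J < r J \<and> r J \<le> l K" if "J \<in> F" for J
        using insert.prems(3)[of J] left[OF that] that by auto
      show "{l J<..<r J} \<inter> {l K<..<r K} = {}" if "J \<in> F" "K \<in> F" "J \<noteq> K" for J K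
        using insert.prems(4)[of J K] that by auto
    qed (use K in auto)
    moreover have "W (r K) \<le> W b" using mono_onD[OF insert.prems(1), of "r K" b] K by simp
    ultimately show ?thesis using insert.hyps False by simp
  qed
qed

text \<open>At \<open>u = 0\<close> both sides are false, since \<open>1 / 0 = 0\<close> lies
  outside the interval; the pole of an inverse branch thus makes no exception later.\<close>

lemma inverse_mem_interval_iff:
  fixes l r u :: real
  assumes "l < r" "0 < l \<or> r < 0"
  shows "1 / u \<in> {l<..<r} \<longleftrightarrow> 1 / r < u \<and> u < 1 / l"
proof (cases "0 < l")
  case True
  show ?thesis
  proof (cases "u > 0")
    case True
    with \<open>0 < l\<close> assms show ?thesis by (auto simp: field_simps)
  next
    case False
    then have "1 / u \<le> 0" "0 < 1 / r" using \<open>0 < l\<close> assms by auto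
    then have "\<not> l < 1 / u" "\<not> 1 / r < u" using False \<open>0 < l\<close> by linarith+
    then show ?thesis by simp
  qed
next
  case False
  then have n: "l < 0" "r < 0" using assms by auto
  show ?thesis
  proof (cases "u < 0")
    case True
    with n show ?thesis by (auto simp: field_simps)
  next
    case False
    then have "0 \<le> 1 / u" "1 / l < 0" using n by auto
    then have "\<not> 1 / u < r" "\<not> u < 1 / l" using False n by linarith+
    then show ?thesis by simp
  qed
qed

lemma has_sum_diff:
  fixes f f' :: "'i \<Rightarrow> 'v::real_normed_vector"
  assumes "(f has_sum x) A" "(f' has_sum y) A"
  shows "((\<lambda>i. f i - f' i) has_sum (x - y)) A"
  using has_sum_add[OF assms(1), of "\<lambda>i. - f' i" "- y"] assms(2) by (simp add: has_sum_uminus)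

lemma le_of_all_epsilon:
  fixes x K v k :: real
  assumes "\<And>e. 0 < e \<Longrightarrow> x \<le> K * (v + e) + k" "0 \<le> K"
  shows "x \<le> K * v + k"
proof (rule field_le_epsilon)
  fix e :: real assume e: "0 < e"
  have "e * (K / (K + 1)) \<le> e * 1" using e assms(2) by (intro mult_left_mono) (simp_all add: divide_le_eq)
  then have "K * (e / (K + 1)) \<le> e" by (simp add: mult.commute)
  then show "x \<le> K * v + k + e"
    using assms(1)[of "e / (K + 1)"] e assms(2) by (simp add: distrib_left)
qed

text \<open>\<open>h J\<close> is the inverse of \<open>x \<mapsto> \<sigma> J / x + c J\<close> on \<open>{l J<..<r J}\<close>; its derivative has modulus
  \<open>(h J)\<^sup>2\<close>.\<close>

locale branch_system = interval a b for a b :: real +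
  fixes m :: real and P :: "'i set" and l r c \<sigma> :: "'i \<Rightarrow> real"
  assumes abs_a: "\<bar>a\<bar> \<le> m" and abs_b: "\<bar>b\<bar> \<le> m" and m_less_1: "m < 1"
    and countable_P: "countable P"
    and lr: "J \<in> P \<Longrightarrow> a \<le> l J \<and> l J < r J \<and> r J \<le> b"
    and nz: "J \<in> P \<Longrightarrow> 0 < l J \<or> r J < 0"
    and sgn: "J \<in> P \<Longrightarrow> \<sigma> J = 1 \<or> \<sigma> J = -1"
    and disj: "J \<in> P \<Longrightarrow> K \<in> P \<Longrightarrow> J \<noteq> K \<Longrightarrow> {l J<..<r J} \<inter> {l K<..<r K} = {}"
    and image_in: "J \<in> P \<Longrightarrow> x \<in> {l J<..<r J} \<Longrightarrow> \<sigma> J / x + c J \<in> {a..b}"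
    and finite_incomplete: "finite {J\<in>P. (\<lambda>x. \<sigma> J / x + c J) ` {l J<..<r J} \<noteq> {a<..<b}}"
begin

definition h :: "'i \<Rightarrow> real \<Rightarrow> real" where "h J y = \<sigma> J / (y - c J)"
text \<open>\<open>lo\<close> and \<open>hi\<close> are the ends of the image of the range;
  \<open>\<sigma> J / x + c J\<close> decreases for \<open>\<sigma> J = 1\<close> and increases for
  \<open>\<sigma> J = -1\<close>.\<close>

definition lo :: "'i \<Rightarrow> real" where "lo J = (if \<sigma> J = 1 then c J + 1 / r J else c J - 1 / l J)"
definition hi :: "'i \<Rightarrow> real" where "hi J = (if \<sigma> J = 1 then c J + 1 / l J else c J - 1 / r J)"
text \<open>\<open>|h'|\<close> cut off to the domain of the branch; the domain is expressed by
  where \<open>h J y\<close> lies, so that the sum may run over all of \<open>P\<close>.\<close>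

definition wt :: "'i \<Rightarrow> real \<Rightarrow> real" where
  "wt J y = (if h J y \<in> {l J<..<r J} then (h J y)\<^sup>2 else 0)"
text \<open>The maximum of \<open>x^2\<close> on the closed range, a bound for the weight that is
  uniform in \<open>y\<close>.\<close>

definition g :: "'i \<Rightarrow> real" where "g J = max ((l J)\<^sup>2) ((r J)\<^sup>2)"
definition incomplete :: "'i set" where "incomplete = {J\<in>P. \<not> (lo J = a \<and> hi J = b)}"

text \<open>The transfer operator on functions. It is polymorphic because real majorants such as
  \<open>norm (f x)\<close> and indicators are iterated along with complex functions.\<close>

definition L :: "(real \<Rightarrow> 'v::banach) \<Rightarrow> real \<Rightarrow> 'v" where
  "L f y = (\<Sum>\<^sub>\<infinity>J\<in>P. wt J y *\<^sub>R f (h J y))"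

lemma m_pos: "0 < m"
  using a_less_b abs_a abs_b by linarith

lemma abs_le_m: "x \<in> {a..b} \<Longrightarrow> \<bar>x\<bar> \<le> m"
  using abs_a abs_b by auto

lemma h_eq: "J \<in> P \<Longrightarrow> h J y = 1 / (\<sigma> J * (y - c J))"
  using sgn[of J] unfolding h_def
  by (metis minus_divide_left minus_divide_right mult_1 mult_minus1)

lemma h_mem: "J \<in> P \<Longrightarrow> h J y \<in> {l J<..<r J} \<longleftrightarrow> lo J < y \<and> y < hi J"
proof -
  assume J: "J \<in> P"
  show ?thesis
    using h_eq[OF J, of y] inverse_mem_interval_iff[of "l J" "r J" "\<sigma> J * (y - c J)"] lr[OF J] nz[OF J] sgn[OF J]
    by (auto simp: lo_def hi_def)
qed

lemma branch_h: "J \<in> P \<Longrightarrow> h J y \<in> {l J<..<r J} \<Longrightarrow> \<sigma> J / h J y + c J = y"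
proof -
  assume "J \<in> P" "h J y \<in> {l J<..<r J}"
  then have "h J y \<noteq> 0" using nz[of J] by force
  then have "y \<noteq> c J" "\<sigma> J \<noteq> 0" by (auto simp: h_def)
  then show ?thesis by (simp add: h_def)
qed

lemma h_branch: "J \<in> P \<Longrightarrow> x \<noteq> 0 \<Longrightarrow> h J (\<sigma> J / x + c J) = x"
  using sgn[of J] by (auto simp: h_def)

lemma branch_image: "J \<in> P \<Longrightarrow> (\<lambda>x. \<sigma> J / x + c J) ` {l J<..<r J} = {lo J<..<hi J}"
proof (intro equalityI subsetI)
  fix y assume J: "J \<in> P" and "y \<in> (\<lambda>x. \<sigma> J / x + c J) ` {l J<..<r J}"
  then obtain x where x: "y = \<sigma> J / x + c J" "x \<in> {l J<..<r J}" by blast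
  then have "x \<noteq> 0" using nz[OF J] by force
  then have "h J y = x" using h_branch[OF J] x by simp
  then show "y \<in> {lo J<..<hi J}" using h_mem[OF J, of y] x by simp
next
  fix y assume J: "J \<in> P" and "y \<in> {lo J<..<hi J}"
  then have "h J y \<in> {l J<..<r J}" using h_mem[OF J, of y] by simp
  then show "y \<in> (\<lambda>x. \<sigma> J / x + c J) ` {l J<..<r J}" using branch_h[OF J] by (intro image_eqI) auto
qed

lemma hi_minus_lo: "J \<in> P \<Longrightarrow> hi J - lo J = 1 / l J - 1 / r J"
  by (auto simp: hi_def lo_def dest: sgn)

lemma lo_less_hi: "J \<in> P \<Longrightarrow> lo J < hi J"
proof -
  assume J: "J \<in> P"
  have "1 / r J < 1 / l J" using lr[OF J] nz[OF J] by (auto simp: field_simps)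
  then show ?thesis using hi_minus_lo[OF J] by simp
qed

lemma lo_hi_bounds: "J \<in> P \<Longrightarrow> a \<le> lo J \<and> hi J \<le> b"
proof -
  assume J: "J \<in> P"
  have "{lo J<..<hi J} \<subseteq> {a..b}" unfolding branch_image[OF J, symmetric] using image_in[OF J] by auto
  then show ?thesis using lo_less_hi[OF J] by (simp add: greaterThanLessThan_subseteq_atLeastAtMost_iff)
qed

lemma finite_incomplete_set: "finite incomplete"
proof (rule finite_subset[OF _ finite_incomplete])
  show "incomplete \<subseteq> {J \<in> P. (\<lambda>x. \<sigma> J / x + c J) ` {l J<..<r J} \<noteq> {a<..<b}}"
  proof (clarsimp simp: incomplete_def)
    fix J assume J: "J \<in> P" and eq: "lo J = a \<longrightarrow> hi J \<noteq> b"
      "(\<lambda>x. \<sigma> J / x + c J) ` {l J<..<r J} = {a<..<b}"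
    then have "{lo J<..<hi J} = {a<..<b}" using branch_image[OF J] by simp
    then have "lo J = a \<and> hi J = b" using lo_less_hi[OF J] a_less_b
      by (simp add: set_eq_subset greaterThanLessThan_subseteq_greaterThanLessThan)
    then show False using eq by simp
  qed
qed

lemma h_in: "J \<in> P \<Longrightarrow> h J y \<in> {l J<..<r J} \<Longrightarrow> a < h J y \<and> h J y < b"
  using lr[of J] by auto

lemma wt_nonneg: "0 \<le> wt J y"
  by (simp add: wt_def)

lemma g_nonneg: "0 \<le> g J"
  by (simp add: g_def le_max_iff_disj)

lemma sq_le_g: "x \<in> {l J..r J} \<Longrightarrow> x\<^sup>2 \<le> g J"
proof -
  assume x: "x \<in> {l J..r J}"
  show ?thesis
  proof (cases "0 \<le> x")
    case True
    then have "x\<^sup>2 \<le> (r J)\<^sup>2" using x by (intro power_mono) auto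
    then show ?thesis by (simp add: g_def le_max_iff_disj)
  next
    case False
    then have "(- x)\<^sup>2 \<le> (- l J)\<^sup>2" using x by (intro power_mono) auto
    then show ?thesis by (simp add: g_def le_max_iff_disj)
  qed
qed

lemma wt_le_g: "wt J y \<le> g J"
  using sq_le_g[of "h J y" J] g_nonneg by (auto simp: wt_def)

lemma g_le: "J \<in> P \<Longrightarrow> g J \<le> m\<^sup>2"
  using abs_le_m[of "l J"] abs_le_m[of "r J"] lr[of J] by (auto simp: g_def abs_le_square_iff[symmetric])

lemma wt_le_m: "J \<in> P \<Longrightarrow> wt J y \<le> m\<^sup>2"
  using wt_le_g[of J y] g_le[of J] by linarith

text \<open>A complete branch satisfies \<open>1 / l - 1 / r = b - a\<close>, which bounds \<open>x\<^sup>2\<close> on its range by a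
  multiple of the length of the range.\<close>

lemma g_complete_le:
  assumes J: "J \<in> P" "J \<notin> incomplete"
  shows "g J \<le> 3 / (b - a) * (r J - l J)"
proof -
  have eq: "1 / l J - 1 / r J = b - a" using J hi_minus_lo[OF J(1)] by (auto simp: incomplete_def)
  have abs: "\<bar>l J\<bar> \<le> 1" "\<bar>r J\<bar> \<le> 1" using abs_le_m[of "l J"] abs_le_m[of "r J"] lr[OF J(1)] m_less_1 by auto
  have ba: "b - a \<le> 2" "0 < b - a" using abs_a abs_b m_less_1 a_less_b by auto
  have lr': "l J < r J" "l J \<noteq> 0" "r J \<noteq> 0" using lr[OF J(1)] nz[OF J(1)] by auto
  then have len: "r J - l J = l J * r J * (b - a)" using eq by (simp add: field_simps)
  have pos: "0 < l J * r J" using nz[OF J(1)] lr' by (auto simp: zero_less_mult_iff)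
  \<comment> \<open>The factor 3 comes from \<open>|l|, |r| \<le> 1\<close> and
    \<open>b - a \<le> 2\<close>: for positive ranges \<open>r - l = l r (b - a) \<le> 2 l\<close>,
    that is \<open>r \<le> 3 l\<close>, and symmetrically for negative ones.\<close>
  have "max ((l J)\<^sup>2) ((r J)\<^sup>2) \<le> 3 * (l J * r J)"
  proof (cases "0 < l J")
    case True
    then have "l J * r J * (b - a) \<le> l J * 1 * 2" using abs ba lr' by (intro mult_mono) auto
    then have "r J \<le> 3 * l J" using len by linarith
    then have "r J * r J \<le> 3 * l J * r J" "l J * l J \<le> l J * r J" using True lr' by (auto intro!: mult_right_mono mult_left_mono)
    then show ?thesis using pos by (simp add: power2_eq_square)
  next
    case False
    then have n: "r J < 0" "l J < 0" using nz[OF J(1)] lr' by auto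
    then have "(- l J) * (- r J) * (b - a) \<le> 1 * (- r J) * 2" using abs ba lr' by (intro mult_mono) auto
    then have "- l J \<le> 3 * (- r J)" using len by simp
    then have "(- l J) * (- l J) \<le> 3 * (- r J) * (- l J)" "(- r J) * (- r J) \<le> (- l J) * (- r J)"
      using n lr' by (auto intro!: mult_right_mono mult_right_mono_neg)
    then show ?thesis using pos by (simp add: power2_eq_square mult.commute)
  qed
  also have "\<dots> = 3 / (b - a) * (r J - l J)" using len ba by simp
  finally show ?thesis by (simp add: g_def)
qed

lemma sum_increments_le:
  fixes W :: "real \<Rightarrow> real"
  assumes "finite F" "F \<subseteq> P" "mono_on {a..b} W"
  shows "(\<Sum>J\<in>F. W (r J) - W (l J)) \<le> W b - W a"
proof (rule sum_disjoint_increments_le[where l = l and r = r, OF assms(1,3)])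
  fix J K assume "J \<in> F" "K \<in> F" "J \<noteq> K"
  then show "{l J<..<r J} \<inter> {l K<..<r K} = {}" using assms(2) by (intro disj) auto
qed (use assms(2) a_less_b lr in auto)

section \<open>Total weight and bounds for the operator\<close>

text \<open>Complete branches are bounded by a multiple of the lengths of disjoint ranges; each of
  the finitely many incomplete ones contributes at most 1.\<close>

lemma g_summable: "g summable_on P"
proof (rule nonneg_bdd_above_summable_on[OF g_nonneg], rule bdd_aboveI2)
  fix F assume F: "F \<in> {F. F \<subseteq> P \<and> finite F}"
  have "sum g F = sum g (F - incomplete) + sum g (F \<inter> incomplete)"
    using F sum.Int_Diff[of F g incomplete] by (simp add: add.commute)
  also have "\<dots> \<le> (\<Sum>J\<in>F - incomplete. 3 / (b - a) * (r J - l J)) + (\<Sum>J\<in>F \<inter> incomplete. 1)"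
  proof (intro add_mono sum_mono)
    fix J assume "J \<in> F \<inter> incomplete"
    then have "g J \<le> m\<^sup>2" using F g_le by auto
    also have "\<dots> \<le> 1" using m_pos m_less_1 by (simp add: power_le_one)
    finally show "g J \<le> 1" .
  qed (use F g_complete_le in auto)
  also have "(\<Sum>J\<in>F - incomplete. 3 / (b - a) * (r J - l J)) \<le> 3 / (b - a) * (b - a)"
    unfolding sum_distrib_left[symmetric]
    using F a_less_b sum_increments_le[of "F - incomplete" "\<lambda>x. x"]
    by (intro mult_left_mono) (auto simp: mono_on_def)
  also have "(\<Sum>J\<in>F \<inter> incomplete. 1::real) \<le> card incomplete"
    using finite_incomplete_set by (simp add: card_mono)
  finally show "sum g F \<le> 3 / (b - a) * (b - a) + card incomplete" by linarith
qed

text \<open>A bound for \<open>L\<close> on bounded functions, possibly above 1; it serves for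
  convergence and multiplies quantities that can be chosen small afterwards.\<close>

definition S where "S = infsum g P"

lemma sum_g_le_S: "finite F \<Longrightarrow> F \<subseteq> P \<Longrightarrow> sum g F \<le> S"
  unfolding S_def by (rule finite_sum_le_infsum[OF g_summable]) (auto simp: g_nonneg)

lemma S_nonneg: "0 \<le> S"
  unfolding S_def by (rule infsum_nonneg) (rule g_nonneg)

lemma L_term_bound:
  assumes "\<And>x. a < x \<Longrightarrow> x < b \<Longrightarrow> norm (f x) \<le> s" "0 \<le> s" "J \<in> P"
  shows "norm (wt J y *\<^sub>R f (h J y)) \<le> wt J y * s"
  using assms(1)[of "h J y"] h_in[OF assms(3), of y] wt_nonneg[of J y]
  by (cases "h J y \<in> {l J<..<r J}") (auto simp: wt_def intro!: mult_left_mono)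

lemma L_abs_summable:
  fixes f :: "real \<Rightarrow> 'v::banach"
  assumes "\<And>x. a < x \<Longrightarrow> x < b \<Longrightarrow> norm (f x) \<le> s"
  shows "(\<lambda>J. norm (wt J y *\<^sub>R f (h J y))) summable_on P"
proof -
  have s: "0 \<le> s" using order_trans[OF norm_ge_zero assms[of "(a+b)/2"]] a_less_b by simp
  have "norm (wt J y *\<^sub>R f (h J y)) \<le> g J * s" if "J \<in> P" for J
    using L_term_bound[of f s, OF assms s that, of y] mult_right_mono[OF wt_le_g s, of J y] by linarith
  then show ?thesis
    by (rule summable_on_comparison_test[OF summable_on_cmult_left[OF g_summable]]) simp_all
qed

lemma L_has_sum:
  fixes f :: "real \<Rightarrow> 'v::banach"
  assumes "\<And>x. a < x \<Longrightarrow> x < b \<Longrightarrow> norm (f x) \<le> s"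
  shows "((\<lambda>J. wt J y *\<^sub>R f (h J y)) has_sum L f y) P"
  unfolding L_def by (rule has_sum_infsum, rule abs_summable_summable, rule L_abs_summable[of f s], rule assms)

lemma L_norm_le:
  fixes f :: "real \<Rightarrow> 'v::banach"
  assumes "\<And>x. a < x \<Longrightarrow> x < b \<Longrightarrow> norm (f x) \<le> \<phi> x" "\<And>x. a < x \<Longrightarrow> x < b \<Longrightarrow> \<phi> x \<le> s"
  shows "norm (L f y) \<le> L \<phi> y"
proof (rule norm_infsum_le)
  show "((\<lambda>J. wt J y *\<^sub>R f (h J y)) has_sum L f y) P"
    by (rule L_has_sum[of _ s]) (use assms order_trans in blast)
  have "norm (\<phi> x) \<le> s" if "a < x" "x < b" for x
    using assms[OF that] norm_ge_zero[of "f x"] unfolding real_norm_def by linarith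
  then show "((\<lambda>J. wt J y *\<^sub>R \<phi> (h J y)) has_sum L \<phi> y) P" by (rule L_has_sum)
  fix J assume J: "J \<in> P"
  show "norm (wt J y *\<^sub>R f (h J y)) \<le> wt J y *\<^sub>R \<phi> (h J y)"
    using assms(1)[of "h J y"] h_in[OF J, of y]
    by (cases "h J y \<in> {l J<..<r J}") (auto simp: wt_def intro!: mult_left_mono)
qed

lemma L_bound:
  fixes f :: "real \<Rightarrow> 'v::banach"
  assumes "\<And>x. a < x \<Longrightarrow> x < b \<Longrightarrow> norm (f x) \<le> s"
  shows "norm (L f y) \<le> S * s"
proof -
  have s: "0 \<le> s" using order_trans[OF norm_ge_zero assms[of "(a+b)/2"]] a_less_b by simp
  have gs: "((\<lambda>J. g J * s) has_sum S * s) P"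
    unfolding S_def by (intro has_sum_cmult_left has_sum_infsum g_summable)
  have bound: "norm (wt J y *\<^sub>R f (h J y)) \<le> g J * s" if "J \<in> P" for J
    using L_term_bound[of f s, OF assms s that, of y] mult_right_mono[OF wt_le_g s, of J y] by linarith
  have "((\<lambda>J. wt J y *\<^sub>R f (h J y)) has_sum L f y) P" by (rule L_has_sum) (rule assms)
  from norm_infsum_le[OF this gs bound] show ?thesis by simp
qed

text \<open>The terms with nonzero weight evaluate the function in the open interval, which is why
  pointwise hypotheses are made for \<open>a < x\<close> and \<open>x < b\<close>.\<close>

lemma L_cong: "(\<And>x. a < x \<Longrightarrow> x < b \<Longrightarrow> f x = f' x) \<Longrightarrow> L f y = L f' y"
  unfolding L_def by (intro infsum_cong) (use h_in in \<open>auto simp: wt_def\<close>)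

lemma L_scale: "L (\<lambda>x. k * \<phi> x) y = k * L \<phi> y" for \<phi> :: "real \<Rightarrow> real"
  unfolding L_def by (simp add: mult.left_commute infsum_cmult_right')

lemma L_add:
  fixes f f' :: "real \<Rightarrow> 'v::banach"
  assumes "\<And>x. a < x \<Longrightarrow> x < b \<Longrightarrow> norm (f x) \<le> s" "\<And>x. a < x \<Longrightarrow> x < b \<Longrightarrow> norm (f' x) \<le> s'"
  shows "L (\<lambda>x. f x + f' x) y = L f y + L f' y"
proof -
  have "((\<lambda>J. wt J y *\<^sub>R f (h J y) + wt J y *\<^sub>R f' (h J y)) has_sum (L f y + L f' y)) P"
    by (rule has_sum_add[OF L_has_sum[of f s, OF assms(1)] L_has_sum[of f' s', OF assms(2)]])
  then show ?thesis unfolding L_def[of "\<lambda>x. f x + f' x"] by (simp add: scaleR_add_right infsumI)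
qed

abbreviation Lp :: "nat \<Rightarrow> (real \<Rightarrow> 'v::banach) \<Rightarrow> real \<Rightarrow> 'v" where "Lp n \<equiv> L ^^ n"

lemma Lp_bound:
  fixes f :: "real \<Rightarrow> 'v::banach"
  assumes "\<And>x. a < x \<Longrightarrow> x < b \<Longrightarrow> norm (f x) \<le> s" "a < y" "y < b"
  shows "norm (Lp n f y) \<le> S ^ n * s"
  using assms(2,3)
proof (induction n arbitrary: y)
  case (Suc n)
  have "norm (L (Lp n f) y) \<le> S * (S ^ n * s)" using Suc.IH by (rule L_bound)
  then show ?case by (simp add: mult.assoc)
qed (simp add: assms(1))

lemma Lp_norm_le:
  fixes f :: "real \<Rightarrow> 'v::banach"
  assumes "\<And>x. a < x \<Longrightarrow> x < b \<Longrightarrow> norm (f x) \<le> \<phi> x" "\<And>x. a < x \<Longrightarrow> x < b \<Longrightarrow> \<phi> x \<le> s" "a < y" "y < b"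
  shows "norm (Lp n f y) \<le> Lp n \<phi> y"
  using assms(3,4)
proof (induction n arbitrary: y)
  case (Suc n)
  have "\<bar>\<phi> x\<bar> \<le> s" if "a < x" "x < b" for x
    using assms(1,2)[OF that] norm_ge_zero[of "f x"] by linarith
  then have "Lp n \<phi> x \<le> S ^ n * s" if "a < x" "x < b" for x
    using Lp_bound[of \<phi> s x n] that by fastforce
  from L_norm_le[OF Suc.IH this] show ?case by simp
qed (simp add: assms(1))

lemma Lp_mono:
  fixes \<phi> \<psi> :: "real \<Rightarrow> real"
  assumes "\<And>x. a < x \<Longrightarrow> x < b \<Longrightarrow> 0 \<le> \<phi> x \<and> \<phi> x \<le> \<psi> x" "\<And>x. a < x \<Longrightarrow> x < b \<Longrightarrow> \<psi> x \<le> s" "a < y" "y < b"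
  shows "Lp n \<phi> y \<le> Lp n \<psi> y"
proof -
  have "norm (Lp n \<phi> y) \<le> Lp n \<psi> y"
    by (rule Lp_norm_le[where s = s]) (use assms in simp_all)
  then show ?thesis by simp
qed

lemma Lp_scale: "Lp n (\<lambda>x. k * \<phi> x) y = k * Lp n \<phi> y" for \<phi> :: "real \<Rightarrow> real"
proof (induction n arbitrary: y)
  case (Suc n)
  have "Lp n (\<lambda>x. k * \<phi> x) = (\<lambda>x. k * Lp n \<phi> x)" using Suc by blast
  then show ?case by (simp add: L_scale)
qed simp

lemma Lp_add:
  fixes f f' :: "real \<Rightarrow> 'v::banach"
  assumes "\<And>x. a < x \<Longrightarrow> x < b \<Longrightarrow> norm (f x) \<le> s" "\<And>x. a < x \<Longrightarrow> x < b \<Longrightarrow> norm (f' x) \<le> s'" "a < y" "y < b"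
  shows "Lp n (\<lambda>x. f x + f' x) y = Lp n f y + Lp n f' y"
  using assms(3,4)
proof (induction n arbitrary: y)
  case (Suc n)
  have "L (Lp n (\<lambda>x. f x + f' x)) y = L (\<lambda>x. Lp n f x + Lp n f' x) y"
    using Suc.IH by (intro L_cong) auto
  also have "\<dots> = L (Lp n f) y + L (Lp n f') y"
    by (rule L_add[OF Lp_bound[OF assms(1)] Lp_bound[OF assms(2)]])
  finally show ?case by simp
qed simp

section \<open>One step of the operator on the variation\<close>

lemma h_mono:
  assumes J: "J \<in> P" and y: "lo J < y" "y \<le> y'" "y' < hi J"
  shows "if \<sigma> J = 1 then h J y' \<le> h J y else h J y \<le> h J y'"
proof -
  let ?u = "\<sigma> J * (y - c J)" and ?v = "\<sigma> J * (y' - c J)"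
  note eq = h_eq[OF J]
  have "h J y \<in> {l J<..<r J}" "h J y' \<in> {l J<..<r J}" using h_mem[OF J] y by auto
  then have "(0 < ?u \<and> 0 < ?v) \<or> (?u < 0 \<and> ?v < 0)"
    unfolding eq using nz[OF J] by (auto dest: less_trans simp: zero_less_divide_iff divide_less_0_iff)
  then have "?u \<le> ?v \<Longrightarrow> 1 / ?v \<le> 1 / ?u" "?v \<le> ?u \<Longrightarrow> 1 / ?u \<le> 1 / ?v"
    by (auto intro: divide_left_mono divide_left_mono_neg simp: frac_le mult_neg_neg)
  then show ?thesis unfolding eq using sgn[OF J] y by auto
qed

text \<open>On a branch domain the term of \<open>J\<close> is \<open>x^2 f(x)\<close> composed with
  a monotone map onto the range, so the variations of the terms add up to at most that of
  \<open>x^2 f(x)\<close>, the ranges being disjoint. Only incomplete branches start or end inside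
  the interval and create jumps.\<close>

lemma L_dominated:
  fixes f :: "real \<Rightarrow> 'v::banach"
  assumes dom: "dominated f V" and s: "\<And>x. a < x \<Longrightarrow> x < b \<Longrightarrow> norm (f x) \<le> s"
  shows "\<exists>V'. dominated (L f) V' \<and>
    V' b - V' a \<le> m\<^sup>2 * (V b - V a) + (2 * (b - a) + 2 * card incomplete) * s"
proof -
  have s0: "0 \<le> s" using order_trans[OF norm_ge_zero s[of "(a+b)/2"]] a_less_b by simp
  \<comment> \<open>Dominates \<open>x^2 f(x)\<close>: \<open>m^2 V\<close> accounts for the
    increments of \<open>f\<close>, the slope \<open>2 s\<close> for
    \<open>|y^2 - x^2| \<le> 2 |y - x|\<close>.\<close>
  define W where "W x = m\<^sup>2 * V x + 2 * s * x" for x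
  have W_mono: "W x \<le> W y" if "a \<le> x" "x \<le> y" "y \<le> b" for x y
    unfolding W_def using dominated_mono[OF dom that] s0 that by (intro add_mono mult_left_mono) auto
  have step: "norm (y\<^sup>2 *\<^sub>R f y - x\<^sup>2 *\<^sub>R f x) \<le> W y - W x" if "a < x" "x \<le> y" "y < b" for x y
  proof -
    have ab: "\<bar>x\<bar> \<le> m" "\<bar>y\<bar> \<le> m" using abs_le_m[of x] abs_le_m[of y] that by auto
    have "y\<^sup>2 *\<^sub>R f y - x\<^sup>2 *\<^sub>R f x = y\<^sup>2 *\<^sub>R (f y - f x) + (y\<^sup>2 - x\<^sup>2) *\<^sub>R f x"
      by (simp add: algebra_simps)
    also have "norm \<dots> \<le> y\<^sup>2 * norm (f y - f x) + \<bar>y\<^sup>2 - x\<^sup>2\<bar> * norm (f x)"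
      using norm_triangle_ineq by (metis abs_power2 norm_scaleR)
    also have "\<dots> \<le> m\<^sup>2 * (V y - V x) + (2 * (y - x)) * s"
    proof (intro add_mono mult_mono)
      show "y\<^sup>2 \<le> m\<^sup>2" using ab m_pos by (simp add: abs_le_square_iff[symmetric])
      have "\<bar>y\<^sup>2 - x\<^sup>2\<bar> = \<bar>y + x\<bar> * (y - x)"
        using that by (simp add: power2_eq_square square_diff_square_factored abs_mult)
      also have "\<dots> \<le> 2 * (y - x)" using ab m_less_1 that by (intro mult_right_mono) auto
      finally show "\<bar>y\<^sup>2 - x\<^sup>2\<bar> \<le> 2 * (y - x)" .
      show "norm (f y - f x) \<le> V y - V x" by (rule dominated_le[OF dom that])
      show "norm (f x) \<le> s" using s that by auto
    qed (use that in auto)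
    finally show ?thesis by (simp add: W_def algebra_simps)
  qed
  \<comment> \<open>The variation swept through the range by the time \<open>y\<close> is reached.
    For \<open>\<sigma> J = 1\<close> the inverse branch decreases and sweeps from
    \<open>r J\<close> downwards.\<close>
  define K where "K J y = (if y \<le> lo J then 0 else if y < hi J then
      (if \<sigma> J = 1 then W (r J) - W (h J y) else W (h J y) - W (l J)) else W (r J) - W (l J))" for J y
  \<comment> \<open>The term is 0 at \<open>lo J\<close> and at \<open>hi J\<close>, hence one
    strict and one weak comparison: a jump right after \<open>lo J\<close> and one on reaching
    \<open>hi J\<close>, each at most \<open>s\<close> because weights are at most 1.\<close>
  define jmp where "jmp J y = (if J \<in> incomplete then s * (of_bool (lo J < y) + of_bool (hi J \<le> y)) else 0)" for J y
  have W_h: "W (l J) \<le> W (h J y) \<and> W (h J y) \<le> W (r J)" if "J \<in> P" "lo J < y" "y < hi J" for J y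
    using h_mem[OF that(1), of y] that lr[OF that(1)] by (auto intro!: W_mono)
  have K_bounds: "0 \<le> K J y" "K J y \<le> W (r J) - W (l J)" if "J \<in> P" for J y
    using W_h[OF that, of y] lr[OF that] W_mono[of "l J" "r J"] by (auto simp: K_def)
  have K_mono: "K J y \<le> K J y'" if J: "J \<in> P" and y: "y \<le> y'" for J y y'
  proof (cases "lo J < y \<and> y' < hi J")
    case True
    have mem: "h J y \<in> {l J<..<r J}" "h J y' \<in> {l J<..<r J}" using h_mem[OF J] True y by auto
    have "if \<sigma> J = 1 then W (h J y') \<le> W (h J y) else W (h J y) \<le> W (h J y')"
      using h_mono[OF J, of y y'] True y lr[OF J] mem by (auto intro!: W_mono split: if_splits)
    then show ?thesis using True y by (auto simp: K_def)
  next
    case False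
    then consider "y \<le> lo J" | "hi J \<le> y'" by linarith
    then show ?thesis
    proof cases
      case 1
      then have "K J y = 0" by (simp add: K_def)
      then show ?thesis using K_bounds(1)[OF J, of y'] by simp
    next
      case 2
      then have "K J y' = W (r J) - W (l J)" using lo_less_hi[OF J] by (simp add: K_def)
      then show ?thesis using K_bounds(2)[OF J, of y] by simp
    qed
  qed
  have jmp_mono: "jmp J y \<le> jmp J y'" if "y \<le> y'" for J y y'
    using that s0 by (auto simp: jmp_def intro!: mult_left_mono)
  have jmp_bounds: "0 \<le> jmp J y" "jmp J y \<le> (if J \<in> incomplete then 2 * s else 0)" for J y
    using s0 by (auto simp: jmp_def)
  define VJ where "VJ J y = K J y + jmp J y" for J y
  let ?t = "\<lambda>J y. wt J y *\<^sub>R f (h J y)"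
  have term_le: "norm (?t J y' - ?t J y) \<le> VJ J y' - VJ J y"
    if J: "J \<in> P" and y: "a < y" "y \<le> y'" "y' < b" for J y y'
  proof -
    have small: "norm (?t J z) \<le> s" for z
    proof -
      have "m\<^sup>2 \<le> 1" using m_pos m_less_1 by (simp add: power_le_one)
      then have "wt J z * s \<le> 1 * s" using wt_le_m[OF J, of z] s0 by (intro mult_right_mono) linarith+
      then show ?thesis using L_term_bound[of f s J z] s s0 J by simp
    qed
    have t0: "?t J z = 0" if "\<not> (lo J < z \<and> z < hi J)" for z
    proof -
      have "h J z \<notin> {l J<..<r J}" using h_mem[OF J, of z] that by blast
      then show ?thesis by (simp only: wt_def if_False scaleR_zero_left)
    qed
    \<comment> \<open>A complete branch has \<open>lo J = a\<close> and \<open>hi J = b\<close>, so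
      it always falls under the first case.\<close>
    consider "lo J < y \<and> y' < hi J" | "J \<in> incomplete" "lo J < y" "y < hi J" "hi J \<le> y'"
      | "J \<in> incomplete" "y \<le> lo J" "lo J < y'" "y' < hi J"
      | "\<not> (lo J < y \<and> y < hi J)" "\<not> (lo J < y' \<and> y' < hi J)"
    proof -
      have "lo J = a \<and> hi J = b" if "J \<notin> incomplete" using that J by (auto simp: incomplete_def)
      then show ?thesis using that y by (cases "J \<in> incomplete") force+
    qed
    then show ?thesis
    proof cases
      case 1
      have mem: "h J y \<in> {l J<..<r J}" "h J y' \<in> {l J<..<r J}" using h_mem[OF J] 1 y by auto
      then have wt: "wt J y = (h J y)\<^sup>2" "wt J y' = (h J y')\<^sup>2" by (auto simp: wt_def)
      have in_ab: "a < h J y" "h J y < b" "a < h J y'" "h J y' < b" using h_in[OF J] mem by auto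
      have "norm (?t J y' - ?t J y) \<le> K J y' - K J y"
      proof (cases "\<sigma> J = 1")
        case True
        then have "h J y' \<le> h J y" using h_mono[OF J, of y y'] 1 y by auto
        then show ?thesis using step[of "h J y'" "h J y"] in_ab True 1 y
          unfolding wt by (simp add: K_def norm_minus_commute)
      next
        case False
        then have "h J y \<le> h J y'" using h_mono[OF J, of y y'] 1 y by auto
        then show ?thesis using step[of "h J y" "h J y'"] in_ab False 1 y
          unfolding wt by (simp add: K_def)
      qed
      then show ?thesis using jmp_mono[OF y(2), of J] by (simp add: VJ_def)
    next
      case 2
      then have "jmp J y' - jmp J y = s" using lo_less_hi[OF J] y by (simp add: jmp_def)
      moreover have "?t J y' = 0" using t0[of y'] 2 by linarith
      then have "norm (?t J y' - ?t J y) \<le> s" using small[of y] by (simp only: diff_0 norm_minus_cancel)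
      ultimately show ?thesis using K_mono[OF J y(2)] unfolding VJ_def by linarith
    next
      case 3
      then have "jmp J y' - jmp J y = s" using lo_less_hi[OF J] y by (simp add: jmp_def)
      moreover have "?t J y = 0" using t0[of y] 3 by linarith
      then have "norm (?t J y' - ?t J y) \<le> s" using small[of y'] by (simp only: diff_zero)
      ultimately show ?thesis using K_mono[OF J y(2)] unfolding VJ_def by linarith
    next
      case 4
      have "norm (?t J y' - ?t J y) = 0" by (simp only: t0[OF 4(1)] t0[OF 4(2)] diff_self norm_zero)
      then show ?thesis using K_mono[OF J y(2)] jmp_mono[OF y(2), of J] unfolding VJ_def by linarith
    qed
  qed
  have VJ_nonneg: "0 \<le> VJ J y" if "J \<in> P" for J y
    using K_bounds[OF that] jmp_bounds by (simp add: VJ_def)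
  have sum_VJ: "(\<Sum>J\<in>F. VJ J y) \<le> W b - W a + 2 * s * card incomplete" if F: "finite F" "F \<subseteq> P" for F y
  proof -
    have "(\<Sum>J\<in>F. VJ J y) \<le> (\<Sum>J\<in>F. W (r J) - W (l J)) + (\<Sum>J\<in>F. if J \<in> incomplete then 2 * s else 0)"
      unfolding VJ_def sum.distrib using F K_bounds jmp_bounds by (intro add_mono sum_mono) auto
    also have "(\<Sum>J\<in>F. W (r J) - W (l J)) \<le> W b - W a"
      using F W_mono by (intro sum_increments_le) (auto simp: mono_on_def)
    also have "(\<Sum>J\<in>F. if J \<in> incomplete then 2 * s else 0) = 2 * s * card (F \<inter> incomplete)"
      using F by (simp add: sum.If_cases Int_def)
    also have "\<dots> \<le> 2 * s * card incomplete"
      using s0 finite_incomplete_set by (intro mult_left_mono) (auto intro: card_mono)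
    finally show ?thesis by simp
  qed
  have VJ_summable: "(\<lambda>J. VJ J y) summable_on P" for y
    by (rule nonneg_bdd_above_summable_on[OF VJ_nonneg]) (auto intro!: bdd_aboveI2 sum_VJ)
  define V' where "V' y = (\<Sum>\<^sub>\<infinity>J\<in>P. VJ J y)" for y
  have V'_sum: "((\<lambda>J. VJ J y) has_sum V' y) P" for y
    unfolding V'_def by (rule has_sum_infsum[OF VJ_summable])
  have "dominated (L f) V'"
    unfolding dominated_def
  proof (intro conjI mono_onI allI impI)
    show "V' x \<le> V' y" if "x \<le> y" for x y
      by (rule has_sum_mono[OF V'_sum V'_sum])
        (use K_mono[OF _ that] jmp_mono[OF that] in \<open>auto simp: VJ_def intro!: add_mono\<close>)
    fix x y assume xy: "a < x \<and> x \<le> y \<and> y < b"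
    have 1: "((\<lambda>J. ?t J y - ?t J x) has_sum (L f y - L f x)) P"
      by (rule has_sum_diff[OF L_has_sum[of f s, OF s] L_has_sum[of f s, OF s]]) simp_all
    have 2: "((\<lambda>J. VJ J y - VJ J x) has_sum (V' y - V' x)) P"
      by (rule has_sum_diff[OF V'_sum V'_sum])
    show "norm (L f y - L f x) \<le> V' y - V' x"
      by (rule norm_infsum_le[OF 1 2]) (use term_le xy in simp)
  qed
  moreover have "V' b \<le> W b - W a + 2 * s * card incomplete"
    unfolding V'_def by (rule infsum_le_finite_sums[OF VJ_summable sum_VJ])
  moreover have "0 \<le> V' a"
    unfolding V'_def by (rule infsum_nonneg) (rule VJ_nonneg)
  ultimately show ?thesis by (intro exI[of _ V']) (simp add: W_def algebra_simps)
qed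

text \<open>For \<open>s = 1\<close> and \<open>s = -1\<close>: the one-sided neighbourhoods \<open>{x..x + d}\<close> and \<open>{x - d..x}\<close>.\<close>

definition side :: "real \<Rightarrow> real \<Rightarrow> real \<Rightarrow> real set" where
  "side s x d = {t. 0 \<le> s * (t - x) \<and> s * (t - x) \<le> d}"

section \<open>Decay of the supremum under iteration\<close>

text \<open>Two open ranges that both reach \<open>x\<close> from the same side overlap next to
  \<open>x\<close>.\<close>

lemma adjacent_branch_unique:
  assumes s: "s = 1 \<or> s = -1" and JK: "J \<in> P" "K \<in> P"
    and J: "\<And>d. 0 < d \<Longrightarrow> side s x d \<inter> {l J<..<r J} \<noteq> {}"
    and K: "\<And>d. 0 < d \<Longrightarrow> side s x d \<inter> {l K<..<r K} \<noteq> {}"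
  shows "J = K"
proof (rule ccontr)
  assume "J \<noteq> K"
  then have dis: "{l J<..<r J} \<inter> {l K<..<r K} = {}" using disj JK by blast
  have adj: "if s = 1 then l M \<le> x \<and> x < r M else l M < x \<and> x \<le> r M"
    if M: "\<And>d. 0 < d \<Longrightarrow> side s x d \<inter> {l M<..<r M} \<noteq> {}" for M
  proof -
    obtain t where t: "t \<in> side s x 1" "l M < t" "t < r M" using M[of 1] by auto
    show ?thesis
    proof (rule ccontr)
      assume n: "\<not> ?thesis"
      show False
      proof (cases "s = 1")
        case True
        then have "x < l M" using n t by (auto simp: side_def)
        then show False using M[of "(l M - x) / 2"] True by (auto simp: side_def)
      next
        case False
        then have sm: "s = -1" using s by simp
        then have "r M < x" using n t by (auto simp: side_def)
        then show False using M[of "(x - r M) / 2"] sm by (auto simp: side_def)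
      qed
    qed
  qed
  from adj[OF J] adj[OF K] have
    "if s = 1 then (x + min (r J) (r K)) / 2 \<in> {l J<..<r J} \<inter> {l K<..<r K}
     else (max (l J) (l K) + x) / 2 \<in> {l J<..<r J} \<inter> {l K<..<r K}"
    by (auto simp: min_def max_def split: if_splits)
  then show False using dis by (auto split: if_splits)
qed

text \<open>The branch \<open>\<sigma> J / x + c J\<close> is monotone on its range, so it carries a
  side of \<open>x\<close> to a side of the image; the side flips for \<open>\<sigma> J = 1\<close>.
  The displacement is divided by \<open>x * t\<close>, which is bounded below on the range.\<close>

lemma branch_side:
  assumes s: "s = 1 \<or> s = -1" and J: "J \<in> P" and x: "x \<in> {l J..r J}" and d': "0 < d'"
  shows "\<exists>d>0. \<forall>y. h J y \<in> side s x d \<inter> {l J<..<r J} \<longrightarrow>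
     y \<in> side (- \<sigma> J * s) (\<sigma> J / x + c J) d'"
proof -
  \<comment> \<open>The distance of the range from 0; it leads to the witness
    \<open>d' * \<mu>^2\<close>.\<close>
  define \<mu> where "\<mu> = min \<bar>l J\<bar> \<bar>r J\<bar>"
  have mu: "0 < \<mu>" using nz[OF J] lr[OF J] by (auto simp: \<mu>_def)
  have big: "\<mu> \<le> \<bar>t\<bar>" if "t \<in> {l J..r J}" for t
    using nz[OF J] that by (auto simp: \<mu>_def)
  have prod: "\<mu>\<^sup>2 \<le> x * t" if "t \<in> {l J..r J}" for t
  proof -
    have "\<mu> * \<mu> \<le> \<bar>x\<bar> * \<bar>t\<bar>" using big[OF x] big[OF that] mu by (intro mult_mono) auto
    also have "\<dots> = x * t" using nz[OF J] x that by (auto simp: abs_mult[symmetric] mult_nonneg_nonneg mult_nonpos_nonpos)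
    finally show ?thesis by (simp add: power2_eq_square)
  qed
  have "y \<in> side (- \<sigma> J * s) (\<sigma> J / x + c J) d'"
    if y: "h J y \<in> side s x (d' * \<mu>\<^sup>2)" "h J y \<in> {l J<..<r J}" for y
  proof -
    let ?t = "h J y"
    have t: "?t \<in> {l J..r J}" using y by auto
    have pos: "0 < x * ?t" using prod[OF t] mu by (smt (verit) zero_less_power)
    then have ne: "x \<noteq> 0" "?t \<noteq> 0" by auto
    have "y - (\<sigma> J / x + c J) = \<sigma> J / ?t - \<sigma> J / x" using branch_h[OF J y(2)] by simp
    also have "\<dots> = - \<sigma> J * (?t - x) / (x * ?t)" using ne by (simp add: field_simps)
    finally have "- \<sigma> J * s * (y - (\<sigma> J / x + c J)) = s * (?t - x) / (x * ?t)"
      using sgn[OF J] by auto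
    moreover have "0 \<le> s * (?t - x) / (x * ?t)" using y(1) pos by (simp add: side_def)
    moreover have "s * (?t - x) / (x * ?t) \<le> d'"
    proof -
      have "s * (?t - x) \<le> d' * \<mu>\<^sup>2" using y(1) by (simp add: side_def)
      also have "\<dots> \<le> d' * (x * ?t)" using prod[OF t] d' by (intro mult_left_mono) auto
      finally show ?thesis using pos by (simp add: pos_divide_le_eq)
    qed
    ultimately show ?thesis by (simp add: side_def)
  qed
  then show ?thesis using d' mu by (intro exI[of _ "d' * \<mu>\<^sup>2"]) auto
qed

text \<open>The point followed in the induction may be an endpoint of a range; its image must again
  be a point of \<open>{a..b}\<close>.\<close>

lemma branch_closed_image:
  assumes J: "J \<in> P" and x: "x \<in> {l J..r J}"
  shows "\<sigma> J / x + c J \<in> {a..b}"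
proof -
  have ne: "x \<noteq> 0" using nz[OF J] x by force
  have "1 / r J \<le> 1 / x \<and> 1 / x \<le> 1 / l J"
    using nz[OF J] x unfolding inverse_eq_divide[symmetric]
    by (auto intro: le_imp_inverse_le le_imp_inverse_le_neg)
  then have "lo J \<le> \<sigma> J / x + c J \<and> \<sigma> J / x + c J \<le> hi J"
    using sgn[OF J] by (auto simp: lo_def hi_def)
  then show ?thesis using lo_hi_bounds[OF J] by auto
qed

text \<open>Away from \<open>0\<close> a short one-sided neighbourhood meets a single branch range; near \<open>0\<close> the
  total weight of all the branch ranges it meets is small.\<close>

lemma Lp_side_small:
  assumes "s = 1 \<or> s = -1" "x \<in> {a..b}" "0 < e"
  shows "\<exists>d>0. \<forall>y. a < y \<longrightarrow> y < b \<longrightarrow> Lp n (indicator (side s x d)) y \<le> m ^ (2 * n) + e"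
  using assms
proof (induction n arbitrary: s x e)
  case 0
  then show ?case by (intro exI[of _ 1]) (auto simp: indicator_def)
next
  case (Suc n)
  \<comment> \<open>The weight neglected in this step is multiplied by at most \<open>S ^ n\<close>
    in the remaining ones, which leaves \<open>e / 2\<close>.\<close>
  define e' where "e' = e / 2 / (S ^ n + 1)"
  have Sn: "0 \<le> S ^ n" using S_nonneg by simp
  then have e': "0 < e'" "e' * S ^ n \<le> e / 2" using Suc.prems by (auto simp: e'_def field_simps)
  obtain F where F: "finite F" "F \<subseteq> P" "dist (sum g F) S \<le> e'"
    using infsum_finite_approximation[OF g_summable e'(1)] unfolding S_def by blast
  have tail: "(\<Sum>J\<in>F' - F. g J) \<le> e'" if "finite F'" "F' \<subseteq> P" for F'
  proof -
    have "sum g (F' - F) + sum g F = sum g ((F' - F) \<union> F)"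
      using that F by (intro sum.union_disjoint[symmetric]) auto
    also have "\<dots> \<le> S" using that F by (intro sum_g_le_S) auto
    finally show ?thesis using F(3) by (simp add: dist_real_def)
  qed
  \<comment> \<open>Ranges that reach \<open>x\<close> from the given side; there is at most
    one.\<close>
  define adj where "adj J \<longleftrightarrow> (\<forall>d>0. side s x d \<inter> {l J<..<r J} \<noteq> {})" for J
  \<comment> \<open>\<open>q\<close> collects the points whose preimage under the adjacent branch of
    \<open>F\<close> is near \<open>x\<close>. It is a one-sided neighbourhood of the image of
    \<open>x\<close>, handled by the induction hypothesis, or empty if no such branch
    exists.\<close>
  have "\<exists>d>0. \<exists>q. (\<forall>y. a < y \<longrightarrow> y < b \<longrightarrow> Lp n (indicator q) y \<le> m ^ (2 * n) + e / 2) \<and>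
      (\<forall>J\<in>F. adj J \<longrightarrow> (\<forall>y. h J y \<in> side s x d \<inter> {l J<..<r J} \<longrightarrow> y \<in> q))"
  proof (cases "\<exists>J\<in>F. adj J")
    case False
    have "Lp n (indicator {}) y \<le> m ^ (2 * n) + e / 2" for y
    proof -
      have empty: "(indicator {} :: real \<Rightarrow> real) = (\<lambda>x. 0 * 1)" by auto
      have "Lp n (indicator {} :: real \<Rightarrow> real) y = 0" unfolding empty Lp_scale by simp
      then show ?thesis using m_pos Suc.prems by (simp add: power_mult)
    qed
    then show ?thesis using False by (intro exI[of _ 1]) auto
  next
    case True
    then obtain J where J: "J \<in> F" "adj J" by blast
    then have JP: "J \<in> P" using F by auto
    have x: "x \<in> {l J..r J}"
    proof (rule ccontr)
      assume n: "\<not> ?thesis"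
      then have "side s x (max (l J - x) (x - r J) / 2) \<inter> {l J<..<r J} = {}"
        using Suc.prems(1) lr[OF JP] by (auto simp: side_def max_def)
      moreover have "0 < max (l J - x) (x - r J) / 2" using n by auto
      ultimately show False using J(2) by (auto simp: adj_def)
    qed
    have "\<exists>d>0. \<forall>y. a < y \<longrightarrow> y < b \<longrightarrow>
        Lp n (indicator (side (- \<sigma> J * s) (\<sigma> J / x + c J) d)) y \<le> m ^ (2 * n) + e / 2"
      using Suc.prems sgn[OF JP] branch_closed_image[OF JP x] by (intro Suc.IH) auto
    then obtain d' where d': "d' > 0" "\<And>y. a < y \<Longrightarrow> y < b \<Longrightarrow>
        Lp n (indicator (side (- \<sigma> J * s) (\<sigma> J / x + c J) d')) y \<le> m ^ (2 * n) + e / 2" by blast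
    obtain d where d: "d > 0" "\<And>y. h J y \<in> side s x d \<inter> {l J<..<r J} \<Longrightarrow>
        y \<in> side (- \<sigma> J * s) (\<sigma> J / x + c J) d'"
      using branch_side[OF Suc.prems(1) JP x d'(1)] by blast
    have uniq: "K = J" if "K \<in> F" "adj K" for K
      using adjacent_branch_unique[OF Suc.prems(1), of K J x] that J JP F by (auto simp: adj_def)
    show ?thesis
    proof (intro exI conjI ballI impI allI)
      show "0 < d" by fact
      show "Lp n (indicator (side (- \<sigma> J * s) (\<sigma> J / x + c J) d')) y \<le> m ^ (2 * n) + e / 2"
        if "a < y" "y < b" for y using d'(2)[OF that] .
      fix K y assume "K \<in> F" "adj K" "h K y \<in> side s x d \<inter> {l K<..<r K}"
      then show "y \<in> side (- \<sigma> J * s) (\<sigma> J / x + c J) d'" using uniq d(2) by blast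
    qed
  qed
  then obtain d0 q where d0: "d0 > 0"
    and q: "\<And>y. a < y \<Longrightarrow> y < b \<Longrightarrow> Lp n (indicator q) y \<le> m ^ (2 * n) + e / 2"
    and dq: "\<And>J y. J \<in> F \<Longrightarrow> adj J \<Longrightarrow> h J y \<in> side s x d0 \<Longrightarrow> h J y \<in> {l J<..<r J} \<Longrightarrow> y \<in> q"
    by blast
  \<comment> \<open>The other ranges in \<open>F\<close> are avoided by shrinking the
    neighbourhood.\<close>
  have "\<exists>\<delta>. \<forall>J. \<delta> J > 0 \<and> (J \<in> F \<and> \<not> adj J \<longrightarrow> side s x (\<delta> J) \<inter> {l J<..<r J} = {})"
    by (rule choice) (auto simp: adj_def intro: zero_less_one)
  then obtain \<delta> where \<delta>: "\<And>J. \<delta> J > 0"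
    "\<And>J. J \<in> F \<Longrightarrow> \<not> adj J \<Longrightarrow> side s x (\<delta> J) \<inter> {l J<..<r J} = {}" by blast
  define d where "d = Min (insert d0 (\<delta> ` F))"
  have d: "0 < d" "d \<le> d0" "\<And>J. J \<in> F \<Longrightarrow> d \<le> \<delta> J" using F(1) d0 \<delta>(1) by (auto simp: d_def)
  have sub: "side s x d \<subseteq> side s x d1" if "d \<le> d1" for d1 using that by (auto simp: side_def)
  \<comment> \<open>The adjacent branch contributes at most \<open>m^2\<close> on \<open>q\<close>,
    and the branches outside \<open>F\<close> at most \<open>e'\<close> in total.\<close>
  have L1: "L (indicator (side s x d)) y \<le> m\<^sup>2 * indicator q y + e'" for y
    unfolding L_def
  proof (rule infsum_le_finite_sums)
    show "(\<lambda>J. wt J y *\<^sub>R (indicator (side s x d) (h J y) :: real)) summable_on P"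
      by (rule abs_summable_summable, rule L_abs_summable[where s = 1]) (simp add: indicator_def)
    fix F' assume F': "finite F'" "F' \<subseteq> P"
    let ?t = "\<lambda>J. wt J y *\<^sub>R (indicator (side s x d) (h J y) :: real)"
    have t_le: "?t J \<le> g J" for J using wt_le_g[of J y] g_nonneg[of J] by (simp add: indicator_def)
    have t_F: "?t J \<le> (if adj J then m\<^sup>2 * indicator q y else 0)" if J: "J \<in> F" for J
    proof (cases "h J y \<in> side s x d \<and> h J y \<in> {l J<..<r J}")
      case True
      have "adj J"
      proof (rule ccontr)
        assume "\<not> adj J"
        then show False using \<delta>(2)[OF J] sub[OF d(3)[OF J]] True by blast
      qed
      moreover have "y \<in> q" using dq[OF J \<open>adj J\<close>] sub[OF d(2)] True by blast
      ultimately show ?thesis using True wt_le_m[of J y] J F by auto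
    next
      case False
      then have zero: "?t J = 0" by (auto simp: wt_def)
      show ?thesis by (subst zero) simp
    qed
    have adj1: "(\<Sum>J\<in>F' \<inter> F. if adj J then m\<^sup>2 * indicator q y else 0) \<le> m\<^sup>2 * indicator q y"
    proof -
      have "card (F' \<inter> F \<inter> Collect adj) \<le> 1"
      proof (rule ccontr)
        assume "\<not> ?thesis"
        then obtain J K where "J \<in> F" "adj J" "K \<in> F" "adj K" "J \<noteq> K"
          using card_le_Suc0_iff_eq[of "F' \<inter> F \<inter> Collect adj"] F(1) by auto
        then show False
          using adjacent_branch_unique[OF Suc.prems(1), of J K x] F(2) by (auto simp: adj_def)
      qed
      then have "real (card (F' \<inter> F \<inter> Collect adj)) * (m\<^sup>2 * indicator q y) \<le> 1 * (m\<^sup>2 * indicator q y)"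
        by (intro mult_right_mono) auto
      then show ?thesis using F(1) by (simp add: sum.If_cases)
    qed
    have "sum ?t F' = sum ?t (F' \<inter> F) + sum ?t (F' - F)" using F'(1) by (rule sum.Int_Diff)
    also have "\<dots> \<le> (\<Sum>J\<in>F' \<inter> F. if adj J then m\<^sup>2 * indicator q y else 0) + (\<Sum>J\<in>F' - F. g J)"
      by (intro add_mono sum_mono t_le t_F) auto
    also have "\<dots> \<le> m\<^sup>2 * indicator q y + e'" using tail[OF F'] adj1 by linarith
    finally show "sum ?t F' \<le> m\<^sup>2 * indicator q y + e'" .
  qed
  have L1_nonneg: "0 \<le> (L (indicator (side s x d)) y :: real)" for y
    unfolding L_def by (intro infsum_nonneg) (simp add: wt_nonneg)
  show ?case
  proof (intro exI[of _ d] conjI allI impI)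
    show "0 < d" by fact
    fix y assume y: "a < y" "y < b"
    let ?B = "m\<^sup>2 + e'"
    \<comment> \<open>\<open>L\<close> is applied ahead of the other \<open>n\<close> steps, since
      \<open>L1\<close> describes its effect on the indicator.\<close>
    have "Lp (Suc n) (indicator (side s x d)) y = Lp n (L (indicator (side s x d))) y"
      by (simp only: funpow_Suc_right o_apply)
    also have "\<dots> \<le> Lp n (\<lambda>y. m\<^sup>2 * indicator q y + e') y"
    proof (rule Lp_mono[where s = ?B])
      show "m\<^sup>2 * indicator q x + e' \<le> ?B" for x using m_pos by (simp add: indicator_def)
    qed (use L1 L1_nonneg y in auto)
    also have "\<dots> = Lp n (\<lambda>y. m\<^sup>2 * indicator q y) y + Lp n (\<lambda>y. e' * 1) y"
      using y e' m_pos Lp_add[of "\<lambda>y. m\<^sup>2 * indicator q y" "m\<^sup>2" "\<lambda>_. e'" e' y n] by (simp add: indicator_def)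
    also have "\<dots> = m\<^sup>2 * Lp n (indicator q) y + e' * Lp n (\<lambda>_. 1) y"
      by (simp only: Lp_scale)
    also have "\<dots> \<le> m\<^sup>2 * (m ^ (2 * n) + e / 2) + e' * S ^ n"
    proof (intro add_mono mult_left_mono q y)
      show "Lp n (\<lambda>_. 1) y \<le> S ^ n" using Lp_bound[of "\<lambda>_. 1::real" 1 y n] y by simp
    qed (use e' in auto)
    also have "\<dots> \<le> m ^ (2 * Suc n) + e"
    proof -
      have "m\<^sup>2 * (e / 2) \<le> 1 * (e / 2)"
        using m_pos m_less_1 Suc.prems by (intro mult_right_mono) (auto simp: power_le_one)
      moreover have "m\<^sup>2 * m ^ (2 * n) = m ^ (2 * Suc n)" by (simp flip: power_add)
      ultimately show ?thesis unfolding distrib_left using e' by linarith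
    qed
    finally show "Lp (Suc n) (indicator (side s x d)) y \<le> m ^ (2 * Suc n) + e" .
  qed
qed

text \<open>\<open>C\<close> may depend on \<open>n\<close>, \<open>u\<close> and \<open>v\<close>
  but not on the function. The variation enters through the increment over the piece alone, which
  makes the property additive.\<close>

definition local_sup :: "nat \<Rightarrow> real \<Rightarrow> real \<Rightarrow> real \<Rightarrow> bool" where
  "local_sup n \<kappa> u v \<longleftrightarrow> (\<exists>C\<ge>0. \<forall>f V F. admissible f V F \<longrightarrow> (\<forall>y. a < y \<longrightarrow> y < b \<longrightarrow>
      Lp n (\<lambda>x. norm (f x) * indicator {u..v} x) y \<le> \<kappa> * (V v - V u) + C * L1 F))"

text \<open>On the piece, \<open>norm (f x)\<close> is at most the increment of \<open>V\<close>
  plus a mean value, and the iterated indicator of \<open>q\<close> contributes the factor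
  \<open>\<kappa>\<close>.\<close>

lemma local_sup_piece:
  assumes uv: "a \<le> u" "u < v" "v \<le> b" and sub: "{u..v} \<subseteq> q" and k: "0 \<le> \<kappa>"
    and q: "\<And>y. a < y \<Longrightarrow> y < b \<Longrightarrow> Lp n (indicator q) y \<le> \<kappa>"
  shows "local_sup n \<kappa> u v"
  unfolding local_sup_def
proof (intro exI conjI allI impI)
  show "0 \<le> \<kappa> / (v - u)" using k uv by simp
  fix f V F y assume adm: "admissible f V F" and y: "a < y" "y < b"
  let ?B = "V v - V u + L1 F / (v - u)"
  have dom: "dominated f V" using adm by (simp add: admissible_def)
  have Vuv: "0 \<le> V v - V u" using dominated_mono[OF dom] uv by simp
  have B: "0 \<le> ?B" using Vuv uv by simp
  have "Lp n (\<lambda>x. norm (f x) * indicator {u..v} x) y \<le> Lp n (\<lambda>x. ?B * indicator q x) y"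
  proof (rule Lp_mono[where s = ?B, OF _ _ y])
    fix x assume x: "a < x" "x < b"
    show "?B * indicator q x \<le> ?B" using B by (simp add: indicator_def)
    have "norm (f x) \<le> ?B" if "x \<in> {u..v}"
    proof -
      have "(v - u) * norm (f x) \<le> (v - u) * (V v - V u) + L1 F"
        using adm uv that x by (intro average_bound) (auto simp: admissible_def)
      also have "\<dots> = (v - u) * ?B" using uv by (simp add: field_simps)
      finally show ?thesis using uv by simp
    qed
    then show "0 \<le> norm (f x) * indicator {u..v} x \<and> norm (f x) * indicator {u..v} x \<le> ?B * indicator q x"
      using sub B by (auto simp: indicator_def)
  qed
  also have "\<dots> = ?B * Lp n (indicator q) y" by (rule Lp_scale)
  also have "\<dots> \<le> ?B * \<kappa>" using q[OF y] B by (rule mult_left_mono)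
  finally show "Lp n (\<lambda>x. norm (f x) * indicator {u..v} x) y \<le> \<kappa> * (V v - V u) + \<kappa> / (v - u) * L1 F"
    by (simp add: algebra_simps)
qed

text \<open>The increments of \<open>V\<close> telescope, so \<open>\<kappa>\<close> is kept when
  pieces are joined and only the L^1 constants add up.\<close>

lemma local_sup_trans:
  assumes "local_sup n \<kappa> u v" "local_sup n \<kappa> v w" "u \<le> v" "v \<le> w"
  shows "local_sup n \<kappa> u w"
proof -
  obtain C where C: "C \<ge> 0" "\<And>f V F y. admissible f V F \<Longrightarrow> a < y \<Longrightarrow> y < b \<Longrightarrow>
      Lp n (\<lambda>x. norm (f x) * indicator {u..v} x) y \<le> \<kappa> * (V v - V u) + C * L1 F"
    using assms(1) unfolding local_sup_def by blast
  obtain D where D: "D \<ge> 0" "\<And>f V F y. admissible f V F \<Longrightarrow> a < y \<Longrightarrow> y < b \<Longrightarrow>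
      Lp n (\<lambda>x. norm (f x) * indicator {v..w} x) y \<le> \<kappa> * (V w - V v) + D * L1 F"
    using assms(2) unfolding local_sup_def by blast
  show ?thesis
    unfolding local_sup_def
  proof (intro exI conjI allI impI)
    show "0 \<le> C + D" using C D by simp
    fix f V F y assume adm: "admissible f V F" and y: "a < y" "y < b"
    obtain s where s: "s \<ge> 0" "\<And>x. a < x \<Longrightarrow> x < b \<Longrightarrow> norm (f x) \<le> s"
      using dominated_bounded[of f V] adm by (auto simp: admissible_def)
    let ?\<phi> = "\<lambda>u v x. norm (f x) * indicator {u..v} x :: real"
    have \<phi>: "norm (?\<phi> u v x) \<le> s" if "a < x" "x < b" for u v x
      using s(2)[OF that] s(1) by (simp add: indicator_def)
    have "Lp n (?\<phi> u w) y \<le> Lp n (\<lambda>x. ?\<phi> u v x + ?\<phi> v w x) y"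
    proof (rule Lp_mono[where s = "s + s", OF _ _ y])
      fix x assume x: "a < x" "x < b"
      show "0 \<le> ?\<phi> u w x \<and> ?\<phi> u w x \<le> ?\<phi> u v x + ?\<phi> v w x" by (auto simp: indicator_def)
      show "?\<phi> u v x + ?\<phi> v w x \<le> s + s" using \<phi>[OF x, of u v] \<phi>[OF x, of v w] by simp
    qed
    also have "\<dots> = Lp n (?\<phi> u v) y + Lp n (?\<phi> v w) y"
      by (rule Lp_add[OF \<phi> \<phi> y])
    also have "\<dots> \<le> (\<kappa> * (V v - V u) + C * L1 F) + (\<kappa> * (V w - V v) + D * L1 F)"
      by (intro add_mono C(2)[OF adm y] D(2)[OF adm y])
    finally show "Lp n (?\<phi> u w) y \<le> \<kappa> * (V w - V u) + (C + D) * L1 F" by (simp add: algebra_simps)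
  qed
qed

text \<open>Every point has small neighbourhoods on both sides with the bound; bisection joins them
  to the whole interval.\<close>

lemma local_sup_all:
  assumes "0 < e"
  shows "local_sup n (m ^ (2 * n) + e) a b"
proof -
  let ?\<kappa> = "m ^ (2 * n) + e"
  have k: "0 \<le> ?\<kappa>" using assms m_pos by simp
  let ?P = "\<lambda>u v. u < v \<longrightarrow> a \<le> u \<longrightarrow> v \<le> b \<longrightarrow> local_sup n ?\<kappa> u v"
  have "?P a b"
  proof (rule Bolzano[where P = ?P])
    show "a \<le> b" using a_less_b by simp
    show "?P u w" if "?P u v" "?P v w" "u \<le> v" "v \<le> w" for u v w
      using that local_sup_trans[of n ?\<kappa> u v w] by (cases "u = v"; cases "v = w") auto
    fix x assume x: "a \<le> x" "x \<le> b"
    obtain d1 where d1: "d1 > 0" "\<And>y. a < y \<Longrightarrow> y < b \<Longrightarrow> Lp n (indicator (side 1 x d1)) y \<le> ?\<kappa>"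
      using Lp_side_small[of 1 x e n] x assms by auto
    obtain d2 where d2: "d2 > 0" "\<And>y. a < y \<Longrightarrow> y < b \<Longrightarrow> Lp n (indicator (side (-1) x d2)) y \<le> ?\<kappa>"
      using Lp_side_small[of "-1" x e n] x assms by auto
    show "\<exists>d>0. \<forall>u v. u \<le> x \<and> x \<le> v \<and> v - u < d \<longrightarrow> ?P u v"
    proof (intro exI conjI allI impI)
      show "0 < min d1 d2" using d1 d2 by simp
      fix u v assume uv: "u \<le> x \<and> x \<le> v \<and> v - u < min d1 d2" "u < v" "a \<le> u" "v \<le> b"
      have right: "local_sup n ?\<kappa> x v" if "x < v"
        using that uv x by (intro local_sup_piece[OF _ _ _ _ k d1(2)]) (auto simp: side_def)
      have left: "local_sup n ?\<kappa> u x" if "u < x"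
        using that uv x by (intro local_sup_piece[OF _ _ _ _ k d2(2)]) (auto simp: side_def)
      consider "u = x" | "x = v" | "u < x" "x < v" using uv by linarith
      then show "local_sup n ?\<kappa> u v"
      proof cases
        case 1 then show ?thesis using right uv by simp
      next
        case 2 then show ?thesis using left uv by simp
      next
        case 3 then show ?thesis using local_sup_trans[OF left right] by simp
      qed
    qed
  qed
  then show ?thesis using a_less_b by simp
qed

text \<open>The error \<open>e\<close> is taken equal to the main term \<open>m ^ (2 * n)\<close>,
  hence the factor 2.\<close>

lemma Lp_sup:
  "\<exists>C\<ge>0. \<forall>f V F. admissible f V F \<longrightarrow> (\<forall>y. a < y \<longrightarrow> y < b \<longrightarrow>
      norm (Lp n f y) \<le> 2 * m ^ (2 * n) * (V b - V a) + C * L1 F)"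
proof -
  have "0 < m ^ (2 * n)" using m_pos by simp
  from local_sup_all[OF this, of n] obtain C where C: "C \<ge> 0" "\<And>f V F y. admissible f V F \<Longrightarrow> a < y \<Longrightarrow> y < b \<Longrightarrow>
      Lp n (\<lambda>x. norm (f x) * indicator {a..b} x) y \<le> (m ^ (2 * n) + m ^ (2 * n)) * (V b - V a) + C * L1 F"
    unfolding local_sup_def by blast
  have "norm (Lp n f y) \<le> 2 * m ^ (2 * n) * (V b - V a) + C * L1 F"
    if adm: "admissible f V F" and y: "a < y" "y < b" for f V F y
  proof -
    obtain s where s: "s \<ge> 0" "\<And>x. a < x \<Longrightarrow> x < b \<Longrightarrow> norm (f x) \<le> s"
      using dominated_bounded[of f V] adm by (auto simp: admissible_def)
    have "norm (Lp n f y) \<le> Lp n (\<lambda>x. norm (f x) * indicator {a..b} x) y"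
      by (rule Lp_norm_le[where s = s, OF _ _ y]) (use s in auto)
    also have "\<dots> \<le> (m ^ (2 * n) + m ^ (2 * n)) * (V b - V a) + C * L1 F" by (rule C(2)[OF adm y])
    finally show ?thesis by (simp add: algebra_simps)
  qed
  then show ?thesis using C(1) by blast
qed

text \<open>The variation contracts by \<open>m\<^sup>2\<close> in each step, up to the supremum, which itself decays like
  \<open>m\<^sup>2\<^sup>n\<close> up to the \<open>L\<^sup>1\<close> norm; the resulting bound is of order \<open>n m\<^sup>2\<^sup>n\<close>.\<close>

definition jump_const :: real where "jump_const = 2 * (b - a) + 2 * card incomplete"

lemma Lp_dominated:
  "\<exists>C\<ge>0. \<forall>f V F. admissible f V F \<longrightarrow> (\<exists>V'. dominated (Lp n f) V' \<and>
      V' b - V' a \<le> (1 + 2 * real n * jump_const / m\<^sup>2) * m ^ (2 * n) * (V b - V a) + C * L1 F)"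
proof (induction n)
  case 0
  show ?case by (intro exI[of _ 0]) (auto simp: admissible_def)
next
  case (Suc n)
  let ?k = "jump_const"
  have k0: "0 \<le> ?k" using a_less_b by (simp add: jump_const_def)
  obtain C where C: "C \<ge> 0" "\<And>f V F. admissible f V F \<Longrightarrow> \<exists>V'. dominated (Lp n f) V' \<and>
      V' b - V' a \<le> (1 + 2 * real n * ?k / m\<^sup>2) * m ^ (2 * n) * (V b - V a) + C * L1 F"
    using Suc.IH by blast
  obtain D where D: "D \<ge> 0" "\<And>f V F y. admissible f V F \<Longrightarrow> a < y \<Longrightarrow> y < b \<Longrightarrow>
      norm (Lp n f y) \<le> 2 * m ^ (2 * n) * (V b - V a) + D * L1 F"
    using Lp_sup[of n] by blast
  show ?case
  proof (intro exI[of _ "m\<^sup>2 * C + ?k * D"] conjI allI impI)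
    show "0 \<le> m\<^sup>2 * C + ?k * D" using C D k0 by simp
    fix f V F assume adm: "admissible f V F"
    obtain V1 where V1: "dominated (Lp n f) V1"
      "V1 b - V1 a \<le> (1 + 2 * real n * ?k / m\<^sup>2) * m ^ (2 * n) * (V b - V a) + C * L1 F"
      using C(2)[OF adm] by blast
    obtain V' where V': "dominated (L (Lp n f)) V'"
      "V' b - V' a \<le> m\<^sup>2 * (V1 b - V1 a) + ?k * (2 * m ^ (2 * n) * (V b - V a) + D * L1 F)"
      using L_dominated[OF V1(1) D(2)[OF adm]] unfolding jump_const_def by auto
    \<comment> \<open>With \<open>A\<close> the coefficient for \<open>n\<close> and
      \<open>k\<close> the jump constant, \<open>m^2 A + 2 k\<close> is \<open>m^2\<close> times the
      coefficient for \<open>n + 1\<close>; this dictates the linear growth in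
      \<open>n\<close>.\<close>
    have alg: "M * (A * x * v + C * w) + k * (2 * x * v + D * w) = (M * A + 2 * k) * x * v + (M * C + k * D) * w"
      for M A x v w k :: real by (simp add: algebra_simps)
    have "V' b - V' a \<le> m\<^sup>2 * ((1 + 2 * real n * ?k / m\<^sup>2) * m ^ (2 * n) * (V b - V a) + C * L1 F)
        + ?k * (2 * m ^ (2 * n) * (V b - V a) + D * L1 F)"
      using V'(2) mult_left_mono[OF V1(2), of "m\<^sup>2"] by simp
    also have "\<dots> = (m\<^sup>2 * (1 + 2 * real n * ?k / m\<^sup>2) + 2 * ?k) * m ^ (2 * n) * (V b - V a)
        + (m\<^sup>2 * C + ?k * D) * L1 F" by (rule alg)
    also have "m\<^sup>2 * (1 + 2 * real n * ?k / m\<^sup>2) + 2 * ?k = (1 + 2 * real (Suc n) * ?k / m\<^sup>2) * m\<^sup>2"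
      using m_pos by (simp add: field_simps)
    finally have "V' b - V' a \<le> (1 + 2 * real (Suc n) * ?k / m\<^sup>2) * m ^ (2 * Suc n) * (V b - V a)
        + (m\<^sup>2 * C + ?k * D) * L1 F" by (simp add: power_add power2_eq_square mult_ac)
    then show "\<exists>V'. dominated (Lp (Suc n) f) V' \<and> V' b - V' a \<le>
        (1 + 2 * real (Suc n) * ?k / m\<^sup>2) * m ^ (2 * Suc n) * (V b - V a) + (m\<^sup>2 * C + ?k * D) * L1 F"
      using V'(1) by auto
  qed
qed

section \<open>Measurability and contraction in L^1\<close>

lemma measurable_h [measurable]: "h J \<in> borel_measurable borel"
  unfolding h_def[abs_def] by measurable

lemma measurable_wt [measurable]: "wt J \<in> borel_measurable borel"
  unfolding wt_def[abs_def] by measurable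

text \<open>After the reflection \<open>y \<mapsto> - \<sigma> J * y\<close> the inverse branch is increasing.\<close>

lemma nn_integral_branch:
  fixes f :: "real \<Rightarrow> ennreal"
  assumes J: "J \<in> P" and f [measurable]: "f \<in> borel_measurable borel"
  shows "(\<integral>\<^sup>+y. ennreal (wt J y) * f (h J y) \<partial>lborel) = (\<integral>\<^sup>+x. f x * indicator {l J<..<r J} x \<partial>lborel)"
proof -
  \<comment> \<open>Chosen so that \<open>h J (- \<sigma> J * y) = - 1 / (y + k)\<close>, an
    increasing function taking \<open>A\<close> to \<open>l J\<close> and \<open>B\<close> to
    \<open>r J\<close>.\<close>
  define k where "k = \<sigma> J * c J"
  define A B where "A = - 1 / l J - k" and "B = - 1 / r J - k"
  define G where "G y = - 1 / (y + k)" for y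
  have lr': "l J < r J" "l J \<noteq> 0" "r J \<noteq> 0" using lr[OF J] nz[OF J] by auto
  have AB: "A < B" using nz[OF J] lr' by (auto simp: A_def B_def field_simps)
  have ne: "y + k \<noteq> 0" if "y \<in> {A..B}" for y
  proof -
    have "- 1 / l J \<le> y + k" "y + k \<le> - 1 / r J" using that by (auto simp: A_def B_def)
    moreover have "- 1 / r J < 0 \<or> 0 < - 1 / l J" using nz[OF J] lr' by auto
    ultimately show ?thesis by linarith
  qed
  have G_ends: "G A = l J" "G B = r J" using lr' by (simp_all add: G_def A_def B_def)
  have flip: "1 / (- z) = - 1 / z" for z :: real by simp
  have hG: "h J (- \<sigma> J * y) = G y" for y
  proof -
    have eq: "\<sigma> J * (- \<sigma> J * y - c J) = - (y + k)" using sgn[OF J] by (auto simp: k_def)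
    show ?thesis unfolding h_eq[OF J] eq G_def by (rule flip)
  qed
  have "(\<integral>\<^sup>+x. f x * indicator {G A..G B} x \<partial>lborel) = (\<integral>\<^sup>+y. f (G y) * ennreal ((G y)\<^sup>2) * indicator {A..B} y \<partial>lborel)"
  proof (rule nn_integral_substitution_aux[OF f _ _ _ _ AB])
    show "(G has_real_derivative (G y)\<^sup>2) (at y)" if "y \<in> {A..B}" for y
      unfolding G_def[abs_def] using ne[OF that]
      by (auto intro!: derivative_eq_intros simp: power2_eq_square divide_simps)
    show "continuous_on {A..B} (\<lambda>y. (G y)\<^sup>2)"
      unfolding G_def using ne by (auto intro!: continuous_intros)
  qed auto
  also have "\<dots> = (\<integral>\<^sup>+y. ennreal (wt J (- \<sigma> J * y)) * f (h J (- \<sigma> J * y)) \<partial>lborel)"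
  proof (rule nn_integral_cong_AE)
    have iff: "G y \<in> {l J<..<r J} \<longleftrightarrow> A < y \<and> y < B" for y
    proof -
      have "G y = 1 / (- (y + k))" unfolding G_def by (rule flip[symmetric])
      then show ?thesis using inverse_mem_interval_iff[OF lr'(1) nz[OF J], of "- (y + k)"]
        by (auto simp: A_def B_def)
    qed
    show "AE y in lborel. f (G y) * ennreal ((G y)\<^sup>2) * indicator {A..B} y =
        ennreal (wt J (- \<sigma> J * y)) * f (h J (- \<sigma> J * y))"
      using AE_lborel_singleton[of A] AE_lborel_singleton[of B]
    proof eventually_elim
      case (elim y)
      then show ?case unfolding wt_def hG iff by (auto simp: indicator_def mult.commute)
    qed
  qed
  also have "\<dots> = (\<integral>\<^sup>+y. ennreal (wt J y) * f (h J y) \<partial>lborel)"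
    using nn_integral_real_affine[of "\<lambda>y. ennreal (wt J y) * f (h J y)" "- \<sigma> J" 0] sgn[OF J] by auto
  finally have eq: "(\<integral>\<^sup>+y. ennreal (wt J y) * f (h J y) \<partial>lborel) = (\<integral>\<^sup>+x. f x * indicator {l J..r J} x \<partial>lborel)"
    by (simp add: G_ends)
  also have "\<dots> = (\<integral>\<^sup>+x. f x * indicator {l J<..<r J} x \<partial>lborel)"
  proof (rule nn_integral_cong_AE)
    show "AE x in lborel. f x * indicator {l J..r J} x = f x * indicator {l J<..<r J} x"
      using AE_lborel_singleton[of "l J"] AE_lborel_singleton[of "r J"]
      by eventually_elim (auto simp: indicator_def)
  qed
  finally show ?thesis .
qed

text \<open>Enumeration of the branches by natural numbers, which makes series of measurable
  functions and termwise integration available.\<close>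

definition branch_of :: "nat \<Rightarrow> 'i" where "branch_of = inv_into P (to_nat_on P)"
definition idx :: "nat set" where "idx = to_nat_on P ` P"

lemma bij_branch_of: "bij_betw branch_of idx P"
  unfolding branch_of_def idx_def
  by (intro bij_betw_inv_into inj_on_imp_bij_betw inj_on_to_nat_on countable_P)

definition branch_term :: "(real \<Rightarrow> complex) \<Rightarrow> nat \<Rightarrow> real \<Rightarrow> complex" where
  "branch_term f k y = (if k \<in> idx then wt (branch_of k) y *\<^sub>R f (h (branch_of k) y) else 0)"

lemma L_eq_infsum_branch_term: "L f y = (\<Sum>\<^sub>\<infinity>k. branch_term f k y)" for f :: "real \<Rightarrow> complex"
proof -
  have "L f y = (\<Sum>\<^sub>\<infinity>k\<in>idx. wt (branch_of k) y *\<^sub>R f (h (branch_of k) y))"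
    unfolding L_def by (rule infsum_reindex_bij_betw[OF bij_branch_of, symmetric])
  also have "\<dots> = (\<Sum>\<^sub>\<infinity>k. branch_term f k y)"
    by (rule infsum_cong_neutral) (auto simp: branch_term_def)
  finally show ?thesis .
qed

text \<open>For complex terms unconditional and absolute summability agree, and otherwise
  \<open>infsum\<close> is 0. This explicit form gives measurability of \<open>L f\<close> also for
  unbounded \<open>f\<close>.\<close>

lemma L_eq_suminf: "L f y = (if summable (\<lambda>k. norm (branch_term f k y)) then \<Sum>k. branch_term f k y else 0)"
  for f :: "real \<Rightarrow> complex"
proof (cases "summable (\<lambda>k. norm (branch_term f k y))")
  case True
  then have "(\<lambda>k. norm (branch_term f k y)) summable_on UNIV" by (subst summable_on_UNIV_nonneg_real_iff) auto
  then have "(\<lambda>k. branch_term f k y) summable_on UNIV" by (rule abs_summable_summable)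
  then have "(\<lambda>k. branch_term f k y) sums (\<Sum>\<^sub>\<infinity>k. branch_term f k y)" by (intro has_sum_imp_sums has_sum_infsum)
  then show ?thesis using True by (simp add: L_eq_infsum_branch_term sums_unique)
next
  case False
  have "\<not> (\<lambda>k. branch_term f k y) summable_on UNIV"
    unfolding summable_on_iff_abs_summable_on_complex
    using False by (subst summable_on_UNIV_nonneg_real_iff) auto
  then show ?thesis using False by (simp add: L_eq_infsum_branch_term infsum_not_exists)
qed

lemma measurable_branch_term [measurable]:
  "f \<in> borel_measurable borel \<Longrightarrow> branch_term f k \<in> borel_measurable borel"
  unfolding branch_term_def[abs_def] by (cases "k \<in> idx") auto

lemma summable_norm_iff: "summable (\<lambda>k. norm (z k)) \<longleftrightarrow> (\<Sum>k. ennreal (norm (z k))) < \<infinity>"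
  for z :: "nat \<Rightarrow> complex"
proof
  assume "summable (\<lambda>k. norm (z k))"
  then show "(\<Sum>k. ennreal (norm (z k))) < \<infinity>" by (subst suminf_ennreal2) auto
next
  assume "(\<Sum>k. ennreal (norm (z k))) < \<infinity>"
  then show "summable (\<lambda>k. norm (z k))" by (intro summable_suminf_not_top) auto
qed

lemma measurable_L:
  fixes f :: "real \<Rightarrow> complex"
  assumes [measurable]: "f \<in> borel_measurable borel"
  shows "L f \<in> borel_measurable borel"
proof -
  have "L f = (\<lambda>y. if (\<Sum>k. ennreal (norm (branch_term f k y))) < \<infinity> then \<Sum>k. branch_term f k y else 0)"
    by (simp add: fun_eq_iff L_eq_suminf summable_norm_iff)
  then show ?thesis by simp
qed

text \<open>Substitution turns each term into the integral over its range, and the indicators of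
  disjoint ranges sum to at most 1.\<close>

lemma nn_integral_sum_term:
  assumes [measurable]: "f \<in> borel_measurable borel"
  shows "(\<integral>\<^sup>+y. (\<Sum>k. ennreal (norm (branch_term f k y))) \<partial>lborel) \<le> (\<integral>\<^sup>+x. ennreal (norm (f x)) \<partial>lborel)"
proof -
  have "(\<integral>\<^sup>+y. ennreal (norm (branch_term f k y)) \<partial>lborel) =
      (\<integral>\<^sup>+x. ennreal (norm (f x)) * (if k \<in> idx then indicator {l (branch_of k)<..<r (branch_of k)} x else 0) \<partial>lborel)" for k
  proof (cases "k \<in> idx")
    case True
    then have P: "branch_of k \<in> P" using bij_branch_of by (auto dest: bij_betwE)
    have "ennreal (norm (branch_term f k y)) = ennreal (wt (branch_of k) y) * ennreal (norm (f (h (branch_of k) y)))" for y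
      using True wt_nonneg[of "branch_of k" y] by (simp add: branch_term_def ennreal_mult)
    then show ?thesis using True nn_integral_branch[OF P, of "\<lambda>x. ennreal (norm (f x))"] by simp
  qed (simp add: branch_term_def)
  then have "(\<integral>\<^sup>+y. (\<Sum>k. ennreal (norm (branch_term f k y))) \<partial>lborel) =
      (\<Sum>k. \<integral>\<^sup>+x. ennreal (norm (f x)) * (if k \<in> idx then indicator {l (branch_of k)<..<r (branch_of k)} x else 0) \<partial>lborel)"
    by (subst nn_integral_suminf) auto
  also have "\<dots> = (\<integral>\<^sup>+x. (\<Sum>k. ennreal (norm (f x)) * (if k \<in> idx then indicator {l (branch_of k)<..<r (branch_of k)} x else 0)) \<partial>lborel)"
    by (subst nn_integral_suminf) auto
  also have "\<dots> \<le> (\<integral>\<^sup>+x. ennreal (norm (f x)) \<partial>lborel)"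
  proof (rule nn_integral_mono)
    fix x
    let ?i = "\<lambda>k. (if k \<in> idx then indicator {l (branch_of k)<..<r (branch_of k)} x else 0) :: ennreal"
    have uniq: "j = k" if "j \<in> idx" "k \<in> idx" "x \<in> {l (branch_of j)<..<r (branch_of j)}" "x \<in> {l (branch_of k)<..<r (branch_of k)}" for j k
    proof -
      have "branch_of j \<in> P" "branch_of k \<in> P" using that bij_branch_of by (auto dest: bij_betwE)
      then have "branch_of j = branch_of k" using disj[of "branch_of j" "branch_of k"] that(3,4) by blast
      then show ?thesis using that bij_branch_of by (auto simp: bij_betw_def dest: inj_onD)
    qed
    have "(\<Sum>k. ?i k) \<le> 1"
    proof (cases "\<exists>j\<in>idx. x \<in> {l (branch_of j)<..<r (branch_of j)}")
      case True
      then obtain j where j: "j \<in> idx" "x \<in> {l (branch_of j)<..<r (branch_of j)}" by blast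
      have "?i k = 0" if "k \<notin> {j}" for k using uniq[OF j(1) _ j(2), of k] that by (auto simp: indicator_def)
      then have "(\<Sum>k. ?i k) = (\<Sum>k\<in>{j}. ?i k)" by (intro suminf_finite) auto
      also have "\<dots> \<le> 1" by (simp add: indicator_def)
      finally show ?thesis .
    next
      case False
      then have "?i = (\<lambda>k. 0)" by (auto simp: indicator_def)
      then show ?thesis by simp
    qed
    then show "(\<Sum>k. ennreal (norm (f x)) * ?i k) \<le> ennreal (norm (f x))"
      by (subst ennreal_suminf_cmult) (use mult_left_mono[of "\<Sum>k. ?i k" 1 "ennreal (norm (f x))"] in auto)
  qed
  finally show ?thesis .
qed

lemma L_norm_le_suminf: "ennreal (norm (L f y)) \<le> (\<Sum>k. ennreal (norm (branch_term f k y)))" for f :: "real \<Rightarrow> complex"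
proof (cases "summable (\<lambda>k. norm (branch_term f k y))")
  case True
  then have "norm (L f y) \<le> (\<Sum>k. norm (branch_term f k y))" by (simp add: L_eq_suminf summable_norm)
  then show ?thesis using True by (subst suminf_ennreal2) (auto intro: ennreal_leI)
qed (simp add: L_eq_suminf)

lemma nn_integral_L_le:
  fixes f :: "real \<Rightarrow> complex"
  assumes [measurable]: "f \<in> borel_measurable borel"
  shows "(\<integral>\<^sup>+y. ennreal (norm (L f y)) \<partial>lborel) \<le> (\<integral>\<^sup>+x. ennreal (norm (f x)) \<partial>lborel)"
proof -
  have "(\<integral>\<^sup>+y. ennreal (norm (L f y)) \<partial>lborel) \<le> (\<integral>\<^sup>+y. (\<Sum>k. ennreal (norm (branch_term f k y))) \<partial>lborel)"
    by (rule nn_integral_mono) (rule L_norm_le_suminf)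
  also have "\<dots> \<le> (\<integral>\<^sup>+x. ennreal (norm (f x)) \<partial>lborel)" by (rule nn_integral_sum_term[OF assms])
  finally show ?thesis .
qed

lemma integrable_L: "integrable lborel f \<Longrightarrow> integrable lborel (L f)" for f :: "real \<Rightarrow> complex"
proof -
  assume f: "integrable lborel f"
  then have [measurable]: "f \<in> borel_measurable borel" by simp
  show ?thesis
  proof (rule integrableI_bounded)
    show "L f \<in> borel_measurable lborel" using measurable_L[of f] by simp
    show "(\<integral>\<^sup>+y. ennreal (norm (L f y)) \<partial>lborel) < \<infinity>"
      using nn_integral_L_le[of f] f by (auto simp: integrable_iff_bounded intro: order.strict_trans1)
  qed
qed

lemma integral_norm_L_le:
  fixes f :: "real \<Rightarrow> complex"
  assumes f: "integrable lborel f"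
  shows "(LINT y|lborel. norm (L f y)) \<le> (LINT x|lborel. norm (f x))"
proof -
  have "ennreal (LINT y|lborel. norm (L f y)) \<le> ennreal (LINT x|lborel. norm (f x))"
    using nn_integral_L_le[of f] f integrable_L[OF f]
    by (simp add: nn_integral_eq_integral[symmetric] integrable_norm)
  then show ?thesis by (subst (asm) ennreal_le_iff) auto
qed

text \<open>The sum of absolute values has a finite integral. For a merely integrable function the
  series may diverge on a null set, so additivity of \<open>L\<close> holds almost
  everywhere.\<close>

lemma AE_term_summable:
  assumes f: "integrable lborel f"
  shows "AE y in lborel. (\<lambda>k. norm (branch_term f k y)) summable_on UNIV"
proof -
  have [measurable]: "f \<in> borel_measurable borel" using f by simp
  have fin: "(\<integral>\<^sup>+x. ennreal (norm (f x)) \<partial>lborel) < \<infinity>" using f by (simp add: integrable_iff_bounded)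
  have "(\<integral>\<^sup>+y. (\<Sum>k. ennreal (norm (branch_term f k y))) \<partial>lborel) < \<infinity>"
    by (rule le_less_trans[OF nn_integral_sum_term fin]) measurable
  then have "(\<integral>\<^sup>+y. (\<Sum>k. ennreal (norm (branch_term f k y))) \<partial>lborel) \<noteq> \<infinity>" by simp
  then have "AE y in lborel. (\<Sum>k. ennreal (norm (branch_term f k y))) \<noteq> \<infinity>"
    by (intro nn_integral_PInf_AE) auto
  then show ?thesis
  proof eventually_elim
    case (elim y)
    then have "summable (\<lambda>k. norm (branch_term f k y))" by (simp add: summable_norm_iff top.not_eq_extremum)
    then show ?case by (subst summable_on_UNIV_nonneg_real_iff) auto
  qed
qed

lemma AE_L_add:
  fixes f f' :: "real \<Rightarrow> complex"
  assumes "integrable lborel f" "integrable lborel f'"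
  shows "AE y in lborel. L (\<lambda>x. f x + f' x) y = L f y + L f' y"
  using AE_term_summable[OF assms(1)] AE_term_summable[OF assms(2)]
proof eventually_elim
  case (elim y)
  have "(\<Sum>\<^sub>\<infinity>k. branch_term (\<lambda>x. f x + f' x) k y) = (\<Sum>\<^sub>\<infinity>k. branch_term f k y + branch_term f' k y)"
    by (intro infsum_cong) (simp add: branch_term_def scaleR_add_right)
  also have "\<dots> = (\<Sum>\<^sub>\<infinity>k. branch_term f k y) + (\<Sum>\<^sub>\<infinity>k. branch_term f' k y)"
    by (rule infsum_add[OF abs_summable_summable[OF elim(1)] abs_summable_summable[OF elim(2)]])
  finally show ?case by (simp add: L_eq_infsum_branch_term)
qed

lemma L_cmult: "L (\<lambda>x. z * f x) y = z * L f y" for f :: "real \<Rightarrow> complex"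
proof -
  have "L (\<lambda>x. z * f x) y = (\<Sum>\<^sub>\<infinity>J\<in>P. z * (wt J y *\<^sub>R f (h J y)))"
    unfolding L_def by (intro infsum_cong) (simp add: scaleR_conv_of_real)
  also have "\<dots> = z * L f y" unfolding L_def by (rule infsum_cmult_right')
  finally show ?thesis .
qed

text \<open>Inverse branches pull null sets back to null sets: substitution applied to an indicator
  makes its weighted pullback vanish almost everywhere, and the weight is positive on the
  domain.\<close>

lemma AE_L_cong:
  fixes f f' :: "real \<Rightarrow> complex"
  assumes "AE x in lborel. x \<in> {a..b} \<longrightarrow> f x = f' x"
  shows "AE y in lborel. L f y = L f' y"
proof -
  obtain E where E: "E \<in> null_sets lborel" "{x \<in> space lborel. \<not> (x \<in> {a..b} \<longrightarrow> f x = f' x)} \<subseteq> E"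
    using assms unfolding eventually_ae_filter by blast
  then have [measurable]: "E \<in> sets borel" by auto
  have "AE y in lborel. h J y \<in> {l J<..<r J} \<longrightarrow> h J y \<notin> E" if J: "J \<in> P" for J
  proof -
    have "(\<integral>\<^sup>+y. ennreal (wt J y) * indicator E (h J y) \<partial>lborel) = (\<integral>\<^sup>+x. indicator E x * indicator {l J<..<r J} x \<partial>lborel)"
      by (rule nn_integral_branch[OF J]) measurable
    also have "\<dots> \<le> (\<integral>\<^sup>+x. indicator E x \<partial>lborel)" by (intro nn_integral_mono) (auto simp: indicator_def)
    also have "\<dots> = 0" using E by auto
    finally have "AE y in lborel. ennreal (wt J y) * indicator E (h J y) = 0"
      by (subst (asm) le_zero_eq, subst (asm) nn_integral_0_iff_AE) auto
    then show ?thesis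
    proof eventually_elim
      case (elim y)
      show ?case
      proof (intro impI notI)
        assume y: "h J y \<in> {l J<..<r J}" "h J y \<in> E"
        then have "h J y \<noteq> 0" using nz[OF J] by force
        then show False using elim y by (simp add: wt_def)
      qed
    qed
  qed
  then have "AE y in lborel. \<forall>J\<in>P. h J y \<in> {l J<..<r J} \<longrightarrow> h J y \<notin> E"
    using countable_P by (simp add: AE_ball_countable)
  then show ?thesis
  proof eventually_elim
    case (elim y)
    have "wt J y *\<^sub>R f (h J y) = wt J y *\<^sub>R f' (h J y)" if J: "J \<in> P" for J
    proof (cases "h J y \<in> {l J<..<r J}")
      case True
      then have "h J y \<in> {a..b}" "h J y \<notin> E" using h_in[OF J True] elim J by auto
      then have "f (h J y) = f' (h J y)" using E(2) by auto
      then show ?thesis by simp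
    next
      case False
      then show ?thesis by (simp only: wt_def if_False scaleR_zero_left)
    qed
    then show ?case unfolding L_def by (intro infsum_cong)
  qed
qed

lemma L_outside: "y \<notin> {a..b} \<Longrightarrow> L f y = 0"
proof -
  assume y: "y \<notin> {a..b}"
  have "wt J y *\<^sub>R f (h J y) = 0" if J: "J \<in> P" for J
  proof -
    have "h J y \<notin> {l J<..<r J}" using h_mem[OF J, of y] lo_hi_bounds[OF J] y by auto
    then show ?thesis by (simp only: wt_def if_False scaleR_zero_left)
  qed
  then show ?thesis unfolding L_def by (rule infsum_0)
qed

section \<open>The operator on classes and its Lasota-Yorke inequality\<close>

definition Hop :: "l1 \<Rightarrow> l1" where "Hop u = abs_l1 (L (rep_l1 u))"

lemma rep_Hop: "AE x in lborel. rep_l1 (Hop u) x = L (rep_l1 u) x"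
  unfolding Hop_def by (intro rep_abs_l1 integrable_L integrable_rep_l1)

lemma Hop_add: "Hop (u + v) = Hop u + Hop v"
proof (rule l1_eqI)
  have "AE x in lborel. x \<in> {a..b} \<longrightarrow> rep_l1 (u + v) x = rep_l1 u x + rep_l1 v x"
    using rep_plus_l1[of u v] by eventually_elim simp
  from rep_Hop[of "u + v"] rep_Hop[of u] rep_Hop[of v] AE_L_cong[OF this]
    AE_L_add[OF integrable_rep_l1[of u] integrable_rep_l1[of v]] rep_plus_l1[of "Hop u" "Hop v"]
  show "AE x in lborel. rep_l1 (Hop (u + v)) x = rep_l1 (Hop u + Hop v) x"
    by eventually_elim simp
qed

lemma Hop_scale: "Hop (k *\<^sub>C u) = k *\<^sub>C Hop u"
proof (rule l1_eqI)
  have "AE x in lborel. x \<in> {a..b} \<longrightarrow> rep_l1 (k *\<^sub>C u) x = k * rep_l1 u x"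
    using rep_scale_l1[of k u] by eventually_elim simp
  from rep_Hop[of "k *\<^sub>C u"] rep_Hop[of u] AE_L_cong[OF this] rep_scale_l1[of k "Hop u"]
  show "AE x in lborel. rep_l1 (Hop (k *\<^sub>C u)) x = rep_l1 (k *\<^sub>C Hop u) x"
    by eventually_elim (simp add: L_cmult)
qed

lemma norm_l1_Hop_le: "norm_l1 (Hop u) \<le> norm_l1 u"
proof -
  have "norm_l1 (Hop u) = (LINT x|lborel. norm (L (rep_l1 u) x))"
    unfolding norm_l1_eq
  proof (rule integral_cong_AE)
    show "AE x in lborel. norm (rep_l1 (Hop u) x) = norm (L (rep_l1 u) x)"
      using rep_Hop[of u] by eventually_elim simp
    show "(\<lambda>x. norm (L (rep_l1 u) x)) \<in> borel_measurable lborel"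
      using measurable_L[OF borel_rep_l1[of u]] by simp
  qed simp
  also have "\<dots> \<le> norm_l1 u" unfolding norm_l1_eq by (rule integral_norm_L_le) simp
  finally show ?thesis .
qed

lemma Hop_L1_on: "Hop u \<in> L1_on a b"
  unfolding L1_on_def mem_Collect_eq using rep_Hop[of u]
  by eventually_elim (auto simp: L_outside)

lemma Hop_power_L1_on: "u \<in> L1_on a b \<Longrightarrow> (Hop ^^ n) u \<in> L1_on a b"
  by (induction n) (simp_all add: Hop_L1_on)

lemma rep_Hop_power:
  assumes "AE x in lborel. x \<in> {a..b} \<longrightarrow> f x = rep_l1 u x"
  shows "AE x in lborel. x \<in> {a..b} \<longrightarrow> Lp n f x = rep_l1 ((Hop ^^ n) u) x"
proof (induction n)
  case 0
  then show ?case using assms by simp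
next
  case (Suc n)
  from AE_L_cong[OF Suc.IH] rep_Hop[of "(Hop ^^ n) u"] show ?case by eventually_elim simp
qed

text \<open>The first summand comes from \<open>Lp_dominated\<close>; the second is the cost of two
  jumps at the ends of the interval, each bounded by \<open>Lp_sup\<close>.\<close>

definition rate :: "nat \<Rightarrow> real" where
  "rate n = (1 + 2 * real n * jump_const / m\<^sup>2) * m ^ (2 * n) + 4 * m ^ (2 * n)"

lemma rate_nonneg: "0 \<le> rate n"
  using m_pos a_less_b by (auto simp: rate_def jump_const_def intro!: add_nonneg_nonneg mult_nonneg_nonneg)

lemma rate_tendsto_0: "rate \<longlonglongrightarrow> 0"
proof -
  have q: "norm (m\<^sup>2) < 1" using m_pos m_less_1 by (simp add: power_less_one_iff)
  have "(\<lambda>n. 5 * (m\<^sup>2) ^ n + (2 * jump_const / m\<^sup>2) * (of_nat n * (m\<^sup>2) ^ n)) \<longlonglongrightarrow>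
      5 * 0 + (2 * jump_const / m\<^sup>2) * 0"
    by (intro tendsto_add tendsto_mult_left powser_times_n_limit_0 q LIMSEQ_power_zero)
  moreover have "rate = (\<lambda>n. 5 * (m\<^sup>2) ^ n + (2 * jump_const / m\<^sup>2) * (of_nat n * (m\<^sup>2) ^ n))"
    by (rule ext) (simp add: rate_def power_mult[symmetric] algebra_simps)
  ultimately show ?thesis by simp
qed

text \<open>Iterates are controlled on the open interval. The value 0 at \<open>a\<close> and
  \<open>b\<close> extends this to the closed one, at the price of a jump of at most
  \<open>s\<close> at each end.\<close>

lemma open_to_closed_closed_dominated:
  assumes dom: "dominated f V" and s: "\<And>x. a < x \<Longrightarrow> x < b \<Longrightarrow> norm (f x) \<le> s"
  shows "closed_dominated (\<lambda>x. if a < x \<and> x < b then f x else 0) (\<lambda>x. V x + s * (of_bool (a < x) + of_bool (b \<le> x)))"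
  unfolding closed_dominated_def
proof (intro allI impI)
  fix x y assume xy: "a \<le> x \<and> x \<le> y \<and> y \<le> b"
  have s0: "0 \<le> s" using order_trans[OF norm_ge_zero s[of "(a+b)/2"]] a_less_b by simp
  have V: "V x \<le> V y" using dominated_mono[OF dom] xy by simp
  consider "a < x" "y < b" | "x = y" | "x = a" "a < y" "y < b" | "a < x" "x < b" "y = b" | "x = a" "y = b"
    using xy by fastforce
  then show "norm ((if a < y \<and> y < b then f y else 0) - (if a < x \<and> x < b then f x else 0))
      \<le> V y + s * (of_bool (a < y) + of_bool (b \<le> y)) - (V x + s * (of_bool (a < x) + of_bool (b \<le> x)))"
  proof cases
    case 1
    then show ?thesis using dominated_le[OF dom, of x y] xy by auto
  next
    case 3
    then show ?thesis using s[of y] V a_less_b by auto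
  next
    case 4
    then show ?thesis using s[of x] V a_less_b by (auto simp: algebra_simps)
  next
    case 5
    then show ?thesis using s0 V a_less_b by auto
  qed simp
qed

lemma Lasota_Yorke_BV:
  "\<exists>C\<ge>0. \<forall>u\<in>BV a b. (Hop ^^ n) u \<in> BV a b \<and> ess_var ((Hop ^^ n) u) \<le> rate n * ess_var u + C * norm_l1 u"
proof -
  obtain C where C: "C \<ge> 0" "\<And>f V F. admissible f V F \<Longrightarrow> \<exists>V'. dominated (Lp n f) V' \<and>
      V' b - V' a \<le> (1 + 2 * real n * jump_const / m\<^sup>2) * m ^ (2 * n) * (V b - V a) + C * L1 F"
    using Lp_dominated[of n] by blast
  obtain D where D: "D \<ge> 0" "\<And>f V F y. admissible f V F \<Longrightarrow> a < y \<Longrightarrow> y < b \<Longrightarrow>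
      norm (Lp n f y) \<le> 2 * m ^ (2 * n) * (V b - V a) + D * L1 F"
    using Lp_sup[of n] by blast
  \<comment> \<open>A version attains the essential variation only up to \<open>e\<close>; the
    constants do not depend on \<open>e\<close>, which is removed at the end.\<close>
  have main: "(Hop ^^ n) u \<in> BV a b \<and> ess_var ((Hop ^^ n) u) \<le> rate n * (ess_var u + e) + (C + 2 * D) * norm_l1 u"
    if u: "u \<in> BV a b" and e: "0 < e" for u e
  proof -
    obtain g V where gV: "represents u g V" "V b - V a \<le> ess_var u + e" using BV_represents[OF u e] by blast
    then have AE: "AE x in lborel. x \<in> {a..b} \<longrightarrow> g x = rep_l1 u x" and cd: "closed_dominated g V"
      by (simp_all add: represents_def)
    have adm: "admissible g V (rep_l1 u)"
      unfolding admissible_def using AE closed_dominated_dominated[OF cd] by simp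
    obtain V' where V': "dominated (Lp n g) V'"
      "V' b - V' a \<le> (1 + 2 * real n * jump_const / m\<^sup>2) * m ^ (2 * n) * (V b - V a) + C * norm_l1 u"
      using C(2)[OF adm] unfolding norm_l1_eq by blast
    define s where "s = 2 * m ^ (2 * n) * (V b - V a) + D * norm_l1 u"
    have s: "norm (Lp n g y) \<le> s" if "a < y" "y < b" for y
      using D(2)[OF adm that] by (simp add: s_def norm_l1_eq)
    let ?g = "\<lambda>x. if a < x \<and> x < b then Lp n g x else 0"
    let ?V = "\<lambda>x. V' x + s * (of_bool (a < x) + of_bool (b \<le> x))"
    have "AE x in lborel. x \<in> {a..b} \<longrightarrow> ?g x = rep_l1 ((Hop ^^ n) u) x"
      using rep_Hop_power[OF AE, of n] AE_lborel_singleton[of a] AE_lborel_singleton[of b]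
      by eventually_elim auto
    then have r: "represents ((Hop ^^ n) u) ?g ?V"
      unfolding represents_def using open_to_closed_closed_dominated[OF V'(1) s] by simp
    have "ess_var ((Hop ^^ n) u) \<le> V' b - V' a + 2 * s"
      using represents_ess_var_le[OF r] a_less_b by simp
    also have "\<dots> \<le> (1 + 2 * real n * jump_const / m\<^sup>2) * m ^ (2 * n) * (V b - V a) + C * norm_l1 u + 2 * s"
      using V'(2) by simp
    also have "\<dots> = rate n * (V b - V a) + (C + 2 * D) * norm_l1 u"
      by (simp add: s_def rate_def algebra_simps)
    also have "\<dots> \<le> rate n * (ess_var u + e) + (C + 2 * D) * norm_l1 u"
      using gV(2) rate_nonneg by (intro add_right_mono mult_left_mono)
    finally show ?thesis using represents_BV[OF r Hop_power_L1_on[OF BV_L1_on[OF u]]] by simp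
  qed
  show ?thesis
  proof (intro exI[of _ "C + 2 * D"] conjI ballI)
    show "0 \<le> C + 2 * D" using C D by simp
    fix u assume u: "u \<in> BV a b"
    show "(Hop ^^ n) u \<in> BV a b" using main[OF u zero_less_one] by simp
    show "ess_var ((Hop ^^ n) u) \<le> rate n * ess_var u + (C + 2 * D) * norm_l1 u"
      by (rule le_of_all_epsilon[OF _ rate_nonneg]) (use main[OF u] in simp)
  qed
qed

lemma norm_l1_Hop_power_le: "norm_l1 ((Hop ^^ n) u) \<le> norm_l1 u"
proof (induction n)
  case (Suc n)
  then show ?case using norm_l1_Hop_le[of "(Hop ^^ n) u"] by simp
qed simp

lemma quasi_compact_Hop: "quasi_compact scale_l1 (BV a b) (norm_BV a b) norm_l1 Hop"
proof unfold_locales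
  show "l1.subspace (BV a b)" by (rule subspace_BV)
  show "norm_BV a b (x + y) \<le> norm_BV a b x + norm_BV a b y" if "x \<in> BV a b" "y \<in> BV a b" for x y
    using norm_l1_add[of x y] BV_add[OF that] by (simp add: norm_BV_eq)
  show "norm_BV a b (c *\<^sub>C x) = cmod c * norm_BV a b x" if "x \<in> BV a b" for c x
    using ess_var_scale[OF that, of c] by (simp add: norm_BV_eq norm_l1_scale distrib_left)
  show "norm_l1 x \<le> norm_BV a b x" for x by (simp add: norm_BV_eq)
  show "\<exists>s\<in>BV a b. (\<lambda>n. norm_BV a b (s - (\<Sum>k<n. u k))) \<longlonglongrightarrow> 0"
    if "\<And>n. u n \<in> BV a b" "summable (\<lambda>n. norm_BV a b (u n))" for u
    using that by (rule BV_complete)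
  show "\<exists>F. finite F \<and> {x \<in> BV a b. norm_BV a b x \<le> R} \<subseteq> \<Union>F \<and>
      (\<forall>S\<in>F. \<forall>x\<in>S. \<forall>y\<in>S. norm_l1 (x - y) < e)" if "0 < e" for e R
    using that by (rule BV_totally_bounded)
  show HX: "Hop x \<in> BV a b" if "x \<in> BV a b" for x
    using Lasota_Yorke_BV[of 1] that by auto
  show "\<exists>M. \<forall>x\<in>BV a b. norm_BV a b (Hop x) \<le> M * norm_BV a b x"
  proof -
    obtain C where C: "C \<ge> 0" "\<And>u. u \<in> BV a b \<Longrightarrow> ess_var (Hop u) \<le> rate 1 * ess_var u + C * norm_l1 u"
      using Lasota_Yorke_BV[of 1] by auto
    have "norm_BV a b (Hop u) \<le> (1 + rate 1 + C) * norm_BV a b u" if u: "u \<in> BV a b" for u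
    proof -
      have "norm_BV a b (Hop u) \<le> norm_l1 u + (rate 1 * ess_var u + C * norm_l1 u)"
        using C(2)[OF u] norm_l1_Hop_le[of u] by (simp add: norm_BV_eq)
      also have "\<dots> \<le> (1 + rate 1 + C) * norm_l1 u + (1 + rate 1 + C) * ess_var u"
        using C(1) rate_nonneg[of 1] norm_l1_nonneg[of u] by (simp add: distrib_right)
      finally show ?thesis by (simp add: norm_BV_eq distrib_left)
    qed
    then show ?thesis by blast
  qed
  show "\<exists>n \<theta> K. 0 < n \<and> \<theta> < 1 \<and> (\<forall>x\<in>BV a b. norm_BV a b ((Hop ^^ n) x) \<le> \<theta> * norm_BV a b x + K * norm_l1 x)"
  proof -
    have "\<forall>\<^sub>F n in sequentially. rate n < 1" by (rule order_tendstoD[OF rate_tendsto_0]) simp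
    then obtain n0 where n0: "\<And>n. n \<ge> n0 \<Longrightarrow> rate n < 1" by (auto simp: eventually_sequentially)
    \<comment> \<open>The successor ensures a positive exponent.\<close>
    let ?n = "Suc n0"
    obtain C where C: "C \<ge> 0" "\<And>u. u \<in> BV a b \<Longrightarrow> ess_var ((Hop ^^ ?n) u) \<le> rate ?n * ess_var u + C * norm_l1 u"
      using Lasota_Yorke_BV[of ?n] by blast
    have "norm_BV a b ((Hop ^^ ?n) u) \<le> rate ?n * norm_BV a b u + (1 + C) * norm_l1 u" if u: "u \<in> BV a b" for u
    proof -
      have "norm_BV a b ((Hop ^^ ?n) u) \<le> norm_l1 u + (rate ?n * ess_var u + C * norm_l1 u)"
        unfolding norm_BV_eq using C(2)[OF u] norm_l1_Hop_power_le[of ?n u] by linarith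
      also have "\<dots> \<le> rate ?n * norm_BV a b u + (1 + C) * norm_l1 u"
        using mult_nonneg_nonneg[OF rate_nonneg[of ?n] norm_l1_nonneg[of u]] unfolding norm_BV_eq
        by (simp add: algebra_simps)
      finally show ?thesis .
    qed
    then show ?thesis using n0[of ?n] by (intro exI[of _ ?n] exI[of _ "rate ?n"] exI[of _ "1 + C"]) simp
  qed
qed (simp_all add: norm_l1_add norm_l1_scale norm_l1_nonneg norm_l1_eq_0 Hop_add Hop_scale norm_l1_Hop_le)

end

section \<open>Iwasawa continued fraction maps\<close>

text \<open>A closed interval containing an interior point of another one overlaps its interior.
  Hence the exemption of common endpoints in the partition leaves the formula for \<open>T\<close>
  intact on interiors.\<close>

lemma partition_interior_unique:
  fixes J K :: "real set"
  assumes "l < r" "J = {l..r}" "l' < r'" "K = {l'..r'}" "J \<noteq> K \<Longrightarrow> interior J \<inter> interior K = {}"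
    "x \<in> interior J" "x \<in> K"
  shows "K = J"
proof (rule ccontr)
  assume "K \<noteq> J"
  then have dis: "{l<..<r} \<inter> {l'<..<r'} = {}" using assms by auto
  have "(max l l' + min r r') / 2 \<in> {l<..<r} \<inter> {l'<..<r'}"
    using assms(1-4,6,7) by (auto simp: max_def min_def)
  then show False using dis by blast
qed

text \<open>Excludes 0 from the closure of every branch range: since \<open>T\<close> has values in
  \<open>{a..b}\<close>, no branch can come close to the pole.\<close>

lemma inversion_unbounded:
  assumes "\<iota> \<in> inversions" "l < r" "l \<le> 0" "0 \<le> r"
  shows "\<exists>x\<in>{l<..<r}. x \<noteq> 0 \<and> B < \<bar>\<iota> x + c\<bar>"
proof -
  \<comment> \<open>\<open>1 / d\<close> exceeds \<open>|B| + |c|\<close>, so the additive constant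
    cannot compensate the size of the inversion.\<close>
  define d where "d = 1 / (1 + \<bar>B\<bar> + \<bar>c\<bar>)"
  have d: "0 < d" by (simp add: d_def add_pos_nonneg)
  obtain x where x: "x \<in> {l<..<r}" "x \<noteq> 0" "\<bar>x\<bar> \<le> d"
  proof (cases "0 < r")
    case True
    then show ?thesis using that[of "min d (r / 2)"] d assms by (auto simp: min_def)
  next
    case False
    then have "l < 0" "r = 0" using assms by auto
    then show ?thesis using that[of "max (- d) (l / 2)"] d by (auto simp: max_def)
  qed
  have "1 / d \<le> 1 / \<bar>x\<bar>" using x d by (intro divide_left_mono) auto
  also have "1 / \<bar>x\<bar> = \<bar>\<iota> x\<bar>" using assms(1) by (auto simp: inversions_def)
  finally have "B < \<bar>\<iota> x + c\<bar>" by (simp add: d_def)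
  then show ?thesis using x by blast
qed

text \<open>A range avoiding 0 has constant sign, so each of the four inversions is
  \<open>1 / x\<close> or \<open>- 1 / x\<close> on it; for the two with absolute values the sign
  depends on the range.\<close>

lemma iwasawa_branches:
  assumes iw: "iwasawa_map a b T P"
  defines "l \<equiv> Inf" and "r \<equiv> Sup"
  shows "J \<in> P \<Longrightarrow> J = {l J..r J} \<and> a \<le> l J \<and> l J < r J \<and> r J \<le> b \<and> interior J = {l J<..<r J}"
    and "J \<in> P \<Longrightarrow> 0 < l J \<or> r J < 0"
    and "\<exists>\<sigma> c. \<forall>J\<in>P. (\<sigma> J = 1 \<or> \<sigma> J = - 1) \<and> (\<forall>x\<in>{l J<..<r J}. T x = \<sigma> J / x + c J)"
proof -
  have part: "\<And>J. J \<in> P \<Longrightarrow> \<exists>u v. u < v \<and> J = {u..v} \<and> J \<subseteq> {a..b}"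
    and dis: "\<And>J K. J \<in> P \<Longrightarrow> K \<in> P \<Longrightarrow> J \<noteq> K \<Longrightarrow> interior J \<inter> interior K = {}"
    and T: "T ` {a..b} \<subseteq> {a..b}"
    using iw by (auto simp: iwasawa_map_def iwasawa_partition_def)
  have "\<exists>\<iota>\<in>inversions. \<forall>J\<in>P. \<exists>c. \<forall>x\<in>J - {0}. (\<forall>K\<in>P. x \<in> K \<longrightarrow> K = J) \<longrightarrow> T x = \<iota> x + c"
    using iw unfolding iwasawa_map_def iwasawa_partition_def by (elim conjE)
  then obtain \<iota> where \<iota>: "\<iota> \<in> inversions"
    "\<forall>J\<in>P. \<exists>c. \<forall>x\<in>J - {0}. (\<forall>K\<in>P. x \<in> K \<longrightarrow> K = J) \<longrightarrow> T x = \<iota> x + c" by (rule bexE)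
  have J: "J = {l J..r J} \<and> a \<le> l J \<and> l J < r J \<and> r J \<le> b \<and> interior J = {l J<..<r J}" if "J \<in> P" for J
  proof -
    obtain u v where uv: "u < v" "J = {u..v}" "J \<subseteq> {a..b}" using part \<open>J \<in> P\<close> by blast
    then show ?thesis by (auto simp: l_def r_def)
  qed
  then show "J \<in> P \<Longrightarrow> J = {l J..r J} \<and> a \<le> l J \<and> l J < r J \<and> r J \<le> b \<and> interior J = {l J<..<r J}" .
  have T_eq: "\<exists>c. \<forall>x\<in>{l J<..<r J}. x \<noteq> 0 \<longrightarrow> T x = \<iota> x + c" if JP: "J \<in> P" for J
  proof -
    obtain c where c: "\<forall>x\<in>J - {0}. (\<forall>K\<in>P. x \<in> K \<longrightarrow> K = J) \<longrightarrow> T x = \<iota> x + c" using bspec[OF \<iota>(2) JP] by (rule exE)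
    have "T x = \<iota> x + c" if x: "x \<in> {l J<..<r J}" "x \<noteq> 0" for x
    proof -
      have xi: "x \<in> interior J" "x \<in> J - {0}" using J[OF JP] x interior_subset[of J] by auto
      have "K = J" if K: "K \<in> P" "x \<in> K" for K
      proof -
        have "l J < r J" "J = {l J..r J}" "l K < r K" "K = {l K..r K}" using J[OF JP] J[OF K(1)] by auto
        from partition_interior_unique[OF this dis[OF JP K(1)] xi(1) K(2)] show ?thesis .
      qed
      then show ?thesis using c xi(2) by blast
    qed
    then show ?thesis by blast
  qed
  have nz: "0 < l J \<or> r J < 0" if JP: "J \<in> P" for J
  proof (rule ccontr)
    assume n: "\<not> ?thesis"
    obtain c where c: "\<And>x. x \<in> {l J<..<r J} \<Longrightarrow> x \<noteq> 0 \<Longrightarrow> T x = \<iota> x + c" using T_eq[OF JP] by blast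
    obtain x where x: "x \<in> {l J<..<r J}" "x \<noteq> 0" "\<bar>a\<bar> + \<bar>b\<bar> < \<bar>\<iota> x + c\<bar>"
      using inversion_unbounded[OF \<iota>(1), of "l J" "r J" "\<bar>a\<bar> + \<bar>b\<bar>" c] J[OF JP] n by auto
    have "T x \<in> {a..b}" using T J[OF JP] x(1) by (force simp: image_subset_iff)
    then show False using x c[OF x(1,2)] by auto
  qed
  then show "J \<in> P \<Longrightarrow> 0 < l J \<or> r J < 0" .
  have "\<exists>\<sigma> c. (\<sigma> = 1 \<or> \<sigma> = - 1) \<and> (\<forall>x\<in>{l J<..<r J}. T x = \<sigma> / x + c)" if JP: "J \<in> P" for J
  proof -
    obtain c where c: "\<And>x. x \<in> {l J<..<r J} \<Longrightarrow> x \<noteq> 0 \<Longrightarrow> T x = \<iota> x + c" using T_eq[OF JP] by blast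
    have "\<exists>\<sigma>. (\<sigma> = 1 \<or> \<sigma> = - 1) \<and> (\<forall>x\<in>{l J<..<r J}. \<iota> x = \<sigma> / x)"
    proof (cases "0 < l J")
      case True
      then show ?thesis using \<iota>(1) unfolding inversions_def
        by (elim insertE) (auto intro: exI[of _ 1] exI[of _ "- 1"])
    next
      case False
      then have "r J < 0" using nz[OF JP] by simp
      then show ?thesis using \<iota>(1) unfolding inversions_def
        by (elim insertE) (auto intro: exI[of _ 1] exI[of _ "- 1"])
    qed
    moreover have "x \<noteq> 0" if "x \<in> {l J<..<r J}" for x using nz[OF JP] that by auto
    ultimately show ?thesis using c by metis
  qed
  then show "\<exists>\<sigma> c. \<forall>J\<in>P. (\<sigma> J = 1 \<or> \<sigma> J = - 1) \<and> (\<forall>x\<in>{l J<..<r J}. T x = \<sigma> J / x + c J)"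
    by metis
qed

text \<open>Incomplete branches are finite in number because only a leftmost and a rightmost range
  can be incomplete, and each is unique.\<close>

lemma iwasawa_branch_system:
  assumes iw: "iwasawa_map a b T P" and pr: "proper_interval a b"
  obtains c \<sigma> where "branch_system a b (max \<bar>a\<bar> \<bar>b\<bar>) P Inf Sup c \<sigma>"
    "\<And>J x. J \<in> P \<Longrightarrow> x \<in> {Inf J<..<Sup J} \<Longrightarrow> T x = \<sigma> J / x + c J"
proof -
  obtain \<sigma> c where \<sigma>: "\<And>J. J \<in> P \<Longrightarrow> \<sigma> J = 1 \<or> \<sigma> J = - 1"
    and T_eq: "\<And>J x. J \<in> P \<Longrightarrow> x \<in> {Inf J<..<Sup J} \<Longrightarrow> T x = \<sigma> J / x + c J"
    using iwasawa_branches(3)[OF iw] by blast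
  note J = iwasawa_branches(1)[OF iw] and nz = iwasawa_branches(2)[OF iw]
  have dis: "interior J \<inter> interior K = {}" if "J \<in> P" "K \<in> P" "J \<noteq> K" for J K
    using iw that by (auto simp: iwasawa_map_def iwasawa_partition_def)
  have eqI: "J = K" if JK: "J \<in> P" "K \<in> P" and I: "interior J \<inter> interior K \<noteq> {}" for J K
    using dis[OF JK] I by blast
  have "branch_system a b (max \<bar>a\<bar> \<bar>b\<bar>) P Inf Sup c \<sigma>"
  proof unfold_locales
    show "a < b" "countable P" using iw by (auto simp: iwasawa_map_def iwasawa_partition_def)
    show "max \<bar>a\<bar> \<bar>b\<bar> < 1" using pr by (simp add: proper_interval_def)
    show "a \<le> Inf J \<and> Inf J < Sup J \<and> Sup J \<le> b" if "J \<in> P" for J using J[OF that] by blast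
    show "0 < Inf J \<or> Sup J < 0" if "J \<in> P" for J using nz[OF that] .
    show "\<sigma> J = 1 \<or> \<sigma> J = - 1" if "J \<in> P" for J using \<sigma>[OF that] .
    show "{Inf J<..<Sup J} \<inter> {Inf K<..<Sup K} = {}" if "J \<in> P" "K \<in> P" "J \<noteq> K" for J K
      using dis[OF that] J[OF that(1)] J[OF that(2)] by metis
    show "\<sigma> J / x + c J \<in> {a..b}" if "J \<in> P" "x \<in> {Inf J<..<Sup J}" for J x
    proof -
      have "x \<in> {a..b}" using J[OF that(1)] that(2) by auto
      then have "T x \<in> {a..b}" using iw by (auto simp: iwasawa_map_def image_subset_iff)
      then show ?thesis using T_eq[OF that] by simp
    qed
    show "finite {J \<in> P. (\<lambda>x. \<sigma> J / x + c J) ` {Inf J<..<Sup J} \<noteq> {a<..<b}}"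
    proof (rule finite_subset)
      let ?A = "{J\<in>P. \<forall>K\<in>P. Inf J \<le> Inf K}" and ?B = "{J\<in>P. \<forall>K\<in>P. Sup K \<le> Sup J}"
      show "{J \<in> P. (\<lambda>x. \<sigma> J / x + c J) ` {Inf J<..<Sup J} \<noteq> {a<..<b}} \<subseteq> ?A \<union> ?B"
      proof
        fix J assume JP: "J \<in> {J \<in> P. (\<lambda>x. \<sigma> J / x + c J) ` {Inf J<..<Sup J} \<noteq> {a<..<b}}"
        have "branch_dom T J = (\<lambda>x. \<sigma> J / x + c J) ` {Inf J<..<Sup J}"
          unfolding branch_dom_def using J[of J] JP T_eq[of J] by (auto intro!: image_cong)
        then have "branch_dom T J \<noteq> {a<..<b}" using JP by simp
        moreover have "branch_dom T J = {a<..<b} \<or> ((\<forall>K\<in>P. Inf J \<le> Inf K) \<or> (\<forall>K\<in>P. Sup K \<le> Sup J))"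
        proof -
          have "\<forall>J\<in>P. branch_dom T J = {a<..<b} \<or>
              ((\<forall>K\<in>P. Inf J \<le> Inf K) \<or> (\<forall>K\<in>P. Sup K \<le> Sup J)) \<and>
              (\<exists>u v. u < v \<and> branch_dom T J = {u<..<v} \<and> (u = a \<or> v = b))"
            using iw unfolding iwasawa_map_def iwasawa_partition_def by (elim conjE)
          moreover have "J \<in> P" using JP by simp
          ultimately show ?thesis by (meson bspec)
        qed
        ultimately show "J \<in> ?A \<union> ?B" using JP by blast
      qed
      \<comment> \<open>Two nondegenerate ranges with the same left end have overlapping
        interiors.\<close>
      have A: "J = K" if "J \<in> ?A" "K \<in> ?A" for J K
      proof (rule eqI)
        have "Inf J = Inf K" using that by (auto intro: antisym)
        then have "(Inf J + min (Sup J) (Sup K)) / 2 \<in> interior J \<inter> interior K"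
          using J[of J] J[of K] that by (auto simp: min_def)
        then show "interior J \<inter> interior K \<noteq> {}" by blast
      qed (use that in auto)
      have B: "J = K" if "J \<in> ?B" "K \<in> ?B" for J K
      proof (rule eqI)
        have "Sup J = Sup K" using that by (auto intro: antisym)
        then have "(max (Inf J) (Inf K) + Sup J) / 2 \<in> interior J \<inter> interior K"
          using J[of J] J[of K] that by (auto simp: max_def)
        then show "interior J \<inter> interior K \<noteq> {}" by blast
      qed (use that in auto)
      have sub: "finite S" if "\<And>J K. J \<in> S \<Longrightarrow> K \<in> S \<Longrightarrow> J = K" for S :: "real set set"
      proof (cases "S = {}")
        case False
        then obtain J where "J \<in> S" by blast
        then have "S \<subseteq> {J}" using that by blast
        then show ?thesis by (rule finite_subset) simp
      qed simp
      show "finite (?A \<union> ?B)" using sub[of ?A, OF A] sub[of ?B, OF B] by blast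
    qed
  qed simp_all
  then show ?thesis using that T_eq by blast
qed

text \<open>On its domain the inverse branch agrees with \<open>h J\<close> near \<open>y\<close>,
  so their derivatives coincide; off the domain both sides vanish, whatever \<open>inv_into\<close>
  and \<open>deriv\<close> return there.\<close>

lemma (in branch_system) transfer_fun_summand:
  fixes T :: "real \<Rightarrow> real"
  assumes "J \<in> P" "interior K = {l J<..<r J}" "\<And>x. x \<in> {l J<..<r J} \<Longrightarrow> T x = \<sigma> J / x + c J"
  shows "of_real \<bar>deriv (inv_branch T K) y\<bar> * f (inv_branch T K y) * indicator (branch_dom T K) y =
    wt J y *\<^sub>R (f (h J y) :: complex)"
proof -
  have "branch_dom T K = (\<lambda>x. \<sigma> J / x + c J) ` {l J<..<r J}"
    unfolding branch_dom_def assms(2) using assms(3) by (intro image_cong) auto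
  then have dom: "branch_dom T K = {lo J<..<hi J}" using branch_image[OF assms(1)] by simp
  show ?thesis
  proof (cases "y \<in> {lo J<..<hi J}")
    case True
    have inj: "inj_on T {l J<..<r J}"
    proof (rule inj_on_inverseI[where g = "h J"])
      fix x assume x: "x \<in> {l J<..<r J}"
      then have "x \<noteq> 0" using nz[OF assms(1)] by auto
      then show "h J (T x) = x" using assms(3)[OF x] h_branch[OF assms(1)] by simp
    qed
    have inv: "inv_branch T K z = h J z" if z: "z \<in> {lo J<..<hi J}" for z
    proof -
      have hz: "h J z \<in> {l J<..<r J}" using h_mem[OF assms(1), of z] z by simp
      have "T (h J z) = z" using assms(3)[OF hz] branch_h[OF assms(1) hz] by simp
      then show ?thesis unfolding inv_branch_def assms(2) using inj hz by (intro inv_into_f_eq)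
    qed
    have hy: "h J y \<in> {l J<..<r J}" using h_mem[OF assms(1), of y] True by simp
    then have "h J y \<noteq> 0" using nz[OF assms(1)] by auto
    then have ne: "y - c J \<noteq> 0" by (auto simp: h_def)
    have "eventually (\<lambda>z. z \<in> {lo J<..<hi J}) (nhds y)" using True by (intro eventually_nhds_in_open) auto
    then have ev: "eventually (\<lambda>z. inv_branch T K z = h J z) (nhds y)"
      by eventually_elim (rule inv)
    have "(h J has_real_derivative - \<sigma> J / (y - c J)\<^sup>2) (at y)"
      unfolding h_def[abs_def] using ne
      by (auto intro!: derivative_eq_intros simp: power2_eq_square)
    then have "deriv (h J) y = - \<sigma> J / (y - c J)\<^sup>2" by (rule DERIV_imp_deriv)
    then have "\<bar>deriv (inv_branch T K) y\<bar> = \<bar>- \<sigma> J / (y - c J)\<^sup>2\<bar>"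
      using deriv_cong_ev[OF ev refl] by simp
    also have "\<dots> = (h J y)\<^sup>2" using sgn[OF assms(1)] by (auto simp: h_def power_divide)
    finally have "\<bar>deriv (inv_branch T K) y\<bar> = wt J y" using hy by (simp add: wt_def)
    then show ?thesis using True inv[OF True] by (simp add: dom scaleR_conv_of_real)
  next
    case False
    then have "h J y \<notin> {l J<..<r J}" using h_mem[OF assms(1), of y] by simp
    then have wt: "wt J y = 0" unfolding wt_def by (rule if_not_P)
    show ?thesis unfolding wt using False by (simp add: dom)
  qed
qed

theorem mainTheorem5:
  fixes a b :: real and T :: "real \<Rightarrow> real" and P :: "real set set"
    and H :: "l1 \<Rightarrow> l1" and G :: "complex set"
  assumes "iwasawa_map a b T P" and "proper_interval a b"
  defines "H \<equiv> transfer_op T P"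
  defines "G \<equiv> peripheral_eigenvalues a b H"
  shows "finite G \<and>
    (\<forall>z\<in>G. finite_dimensional (eigenspace a b H z)) \<and>
    (\<exists>(U :: complex \<Rightarrow> l1 \<Rightarrow> l1) (V :: l1 \<Rightarrow> l1).
       (\<forall>z\<in>G. bounded_operator a b (U z)) \<and> bounded_operator a b V \<and>
       (\<forall>n\<ge>1. \<forall>u\<in>BV a b. (H ^^ n) u = (\<Sum>z\<in>G. z ^ n *\<^sub>C U z u) + (V ^^ n) u) \<and>
       (\<forall>z\<in>G. \<forall>u\<in>BV a b. U z (U z u) = U z u) \<and>
       (\<forall>z\<in>G. \<forall>w\<in>G. w \<noteq> z \<longrightarrow> (\<forall>u\<in>BV a b. U z (U w u) = 0)) \<and>
       (\<forall>z\<in>G. \<forall>u\<in>BV a b. U z (V u) = 0 \<and> V (U z u) = 0) \<and>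
       (\<forall>z\<in>G. U z ` BV a b = eigenspace a b H z) \<and>
       spectral_radius a b V < 1)"
proof -
  obtain c \<sigma> where bs: "branch_system a b (max \<bar>a\<bar> \<bar>b\<bar>) P Inf Sup c \<sigma>"
    and T_eq: "\<And>J x. J \<in> P \<Longrightarrow> x \<in> {Inf J<..<Sup J} \<Longrightarrow> T x = \<sigma> J / x + c J"
    using iwasawa_branch_system[OF assms(1,2)] by blast
  interpret branch_system a b "max \<bar>a\<bar> \<bar>b\<bar>" P Inf Sup c \<sigma> by (rule bs)
  have transfer_eq: "transfer_fun T P f = L f" for f
  proof
    fix y
    show "transfer_fun T P f y = L f y"
      unfolding transfer_fun_def L_def
    proof (rule infsum_cong)
      fix J assume J: "J \<in> P"
      have "interior J = {Inf J<..<Sup J}" using iwasawa_branches(1)[OF assms(1) J] by blast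
      from transfer_fun_summand[OF J this T_eq[OF J]]
      show "of_real \<bar>deriv (inv_branch T J) y\<bar> * f (inv_branch T J y) * indicator (branch_dom T J) y =
          wt J y *\<^sub>R f (h J y)" .
    qed
  qed
  have H: "H = Hop"
    by (rule ext) (simp only: H_def transfer_op_def Hop_def transfer_eq)
  interpret qc: quasi_compact scale_l1 "BV a b" "norm_BV a b" norm_l1 H
    unfolding H by (rule quasi_compact_Hop)
  have bop: "qc.bounded_op A = bounded_operator a b A" for A
    unfolding qc.bounded_op_def bounded_operator_def ..
  have G: "{z. cmod z = 1 \<and> (\<exists>x\<in>BV a b. x \<noteq> 0 \<and> H x = z *\<^sub>C x)} = G"
    by (simp add: G_def peripheral_eigenvalues_def eigenvalue_def)
  have E: "{x \<in> BV a b. H x = z *\<^sub>C x} = eigenspace a b H z" for z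
    by (simp add: eigenspace_def)
  note dec = qc.spectral_decomposition[unfolded G E bop]
  obtain U V \<rho> where UV: "\<rho> < 1" "\<forall>z\<in>G. bounded_operator a b (U z)" "bounded_operator a b V"
    "\<forall>n\<ge>1. \<forall>u\<in>BV a b. (H ^^ n) u = (\<Sum>z\<in>G. z ^ n *\<^sub>C U z u) + (V ^^ n) u"
    "\<forall>z\<in>G. \<forall>u\<in>BV a b. U z (U z u) = U z u"
    "\<forall>z\<in>G. \<forall>w\<in>G. w \<noteq> z \<longrightarrow> (\<forall>u\<in>BV a b. U z (U w u) = 0)"
    "\<forall>z\<in>G. \<forall>u\<in>BV a b. U z (V u) = 0 \<and> V (U z u) = 0"
    "\<forall>z\<in>G. U z ` BV a b = eigenspace a b H z"
    and res: "\<forall>z. \<rho> < cmod z \<longrightarrow> (\<exists>S. bounded_operator a b S \<and>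
      (\<forall>x\<in>BV a b. S (z *\<^sub>C x - V x) = x \<and> z *\<^sub>C S x - V (S x) = x))"
    using dec(3) by (elim exE conjE) rule
  \<comment> \<open>Resolvents exist outside the disc of radius \<open>\<rho>\<close>, which
    therefore contains the spectrum.\<close>
  have "spectral_radius a b V \<le> ennreal \<rho>"
    unfolding spectral_radius_def
  proof (rule SUP_least)
    fix z assume "z \<in> spectrum a b V"
    then have "\<not> \<rho> < cmod z" using res unfolding spectrum_def by blast
    then show "ennreal (cmod z) \<le> ennreal \<rho>" by (intro ennreal_leI) simp
  qed
  also have "\<dots> < 1" using UV(1) by simp
  finally have "spectral_radius a b V < 1" .
  moreover have "\<forall>z\<in>G. finite_dimensional (eigenspace a b H z)"
    unfolding finite_dimensional_def by (rule dec(2))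
  ultimately show ?thesis using dec(1) UV(2-8) by (intro conjI exI[of _ U] exI[of _ V])
qed

end
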